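(* Let $\epsilon>0$ and suppose that $K$ is the uniform kernel $K(\eta)=\mathbf{1}_{\{\|\eta\|<\epsilon\}}$. Let $M\ge1$ be an integer and suppose that the ABC-MCMC transition kernel $Q_M$ (using $M$ pseudo-samples per iteration) is nonnegative definite. Then for every $f\in L^2(\pi_K)$ and every $\delta>0$, the running time of $Q_1$ is at most twice that of $Q_M$, for both serial and parallel computing: $$C^{\mathrm{ser}}_{f,Q_1,\delta}\le 2\,C^{\mathrm{ser}}_{f,Q_M,\delta}\qquad\text{and}\qquad C^{M\text{-}\mathrm{par}}_{f,Q_1,\delta}\le 2\,C^{M\text{-}\mathrm{par}}_{f,Q_M,\delta}.$$
   Context: Setting. $\Theta$ is the parameter space with a reference measure $d\theta$, $\pi(\theta)$ is a prior density on $\Theta$, $p(y|\theta)$ is a model (for each $\theta$, a probability density in $y$ on the data space $\mathcal{Y}$ with reference measure $dy$), $y_{\mathrm{obs}}\in\mathcal{Y}$ is the observed data, $\eta$ is a summary statistic on $\mathcal{Y}$ with values in a finite-dimensional real vector space with norm $\|\cdot\|$, and $K\ge 0$ is a kernel function on that vector space. The target is the probability density $$\pi_K(\theta)\propto \pi(\theta)\int K(\eta(y_{\mathrm{obs}})-\eta(y))\,p(y|\theta)\,dy,$$ whose normalizing constant is assumed positive and finite. The proposal $q(\theta'|\theta)$ is a transition kernel on $\Theta$ with a density with respect to $d\theta$, and is reversible (with respect to some measure on $\Theta$). ABC-MCMC kernel $Q_M$. For an integer $M\ge1$ and $\theta\in\Theta$, let $T_{M,\theta}$ be the random variable $\pi(\theta)\frac1M\sum_{i=1}^M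 K(\eta(y_{\mathrm{obs}})-\eta(y_i))$, where $y_1,\dots,y_M$ are i.i.d. from $p(\cdot|\theta)$. $Q_M$ is the following Markov kernel on $\Theta\times[0,\infty)$: from state $(\theta,T)$, draw $\theta'\sim q(\cdot|\theta)$, draw $T'$ from the law of $T_{M,\theta'}$ with fresh randomness, and move to $(\theta',T')$ with probability $\min\left\{1,\frac{T'q(\theta|\theta')}{T q(\theta'|\theta)}\right\}$ (interpreted as $1$ when the denominator is $0$); otherwise stay at $(\theta,T)$. $Q_M$ is reversible with respect to the probability measure $\tilde\pi_M(d\theta,dt)\propto t\,\mathbb{P}(T_{M,\theta}\in dt)\,d\theta$, whose $\theta$-marginal is $\pi_K$. $Q_1$ is the case of a single pseudo-sample with all other ingredients the same. Nonnegative definite means $\int g\,(Q_Mg)\,d\tilde\pi_M\ge0$ for all $g\in L^2(\tilde\pi_M)$. Asymptotic variance. For a probability measure $\mu$, $L^2(\mu)$ is the set of real measurable $f$ with $\int f^2d\mu<\infty$. A function $f$ of $\theta$ is identified with the function $(\theta,t)\mapsto f(\theta)$. For a reversible kernel $H$ with its stationary distribution, $v(f,H)=\lim_{n\to\infty} n\,\mathrm{Var}\left(\frac1n\sum_{t=1}^n f(X^{(t)})\right)\in[0,\infty]$, where $(X^{(t)})$ is the Markov chain with kernel $H$ started from its stationary distribution. The value $+\infty$ is allowed. Running times. The serial running time (number of pseudo-samples needed to reach variance $\delta$) with $m$ pseudo-samples per iteration is $C^{\mathrm{ser}}_{f,Q_m,\delta}=m\,v(f,Q_m)/\delta$ (used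 for $m=M$ and $m=1$). The parallel running time across $M$ processors (number of Markov chain iterations needed) is $C^{M\text{-}\mathrm{par}}_{f,Q_M,\delta}=v(f,Q_M)/\delta$ for a single chain $Q_M$ whose $M$ pseudo-samples are drawn in parallel, and $C^{M\text{-}\mathrm{par}}_{f,Q_1,\delta}=v(f,Q_1)/(\delta M)$ for $M$ parallel chains each with kernel $Q_1$. *)

theory Defs
  imports "HOL-Probability.Probability"
begin

definition L2 :: "'a measure \<Rightarrow> ('a \<Rightarrow> real) set" where
  "L2 \<mu> = {f \<in> borel_measurable \<mu>. integrable \<mu> (\<lambda>x. (f x)\<^sup>2)}"

text \<open>The probability measure proportional to a measure of positive finite total mass.\<close>

definition normalized :: "'a measure \<Rightarrow> 'a measure" where
  "normalized \<mu> = scale_measure (1 / emeasure \<mu> (space \<mu>)) \<mu>"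

definition reversible_wrt :: "'a measure \<Rightarrow> ('a \<Rightarrow> 'a measure) \<Rightarrow> bool" where
  "reversible_wrt \<nu> H \<longleftrightarrow>
    (\<forall>A\<in>sets \<nu>. \<forall>B\<in>sets \<nu>. (\<integral>\<^sup>+x\<in>A. emeasure (H x) B \<partial>\<nu>) = (\<integral>\<^sup>+x\<in>B. emeasure (H x) A \<partial>\<nu>))"

definition nonneg_definite :: "'a measure \<Rightarrow> ('a \<Rightarrow> 'a measure) \<Rightarrow> bool" where
  "nonneg_definite \<mu> H \<longleftrightarrow> (\<forall>g\<in>L2 \<mu>. 0 \<le> (\<integral>x. g x * (\<integral>y. g y \<partial>H x) \<partial>\<mu>))"

text \<open>
  The law on trajectories of the chain with initial distribution \<open>\<mu>\<close> and kernel \<open>H\<close>,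
  by the Ionescu-Tulcea construction.
\<close>

definition chain_step ::
  "'a measure \<Rightarrow> ('a \<Rightarrow> 'a measure) \<Rightarrow> nat \<Rightarrow> (nat \<Rightarrow> 'a) \<Rightarrow> 'a measure" where
  "chain_step \<mu> H n \<omega> = (case n of 0 \<Rightarrow> \<mu> | Suc k \<Rightarrow> H (\<omega> k))"

definition chain_law :: "'a measure \<Rightarrow> ('a \<Rightarrow> 'a measure) \<Rightarrow> (nat \<Rightarrow> 'a) measure" where
  "chain_law \<mu> H =
    projective_family.lim UNIV (Ionescu_Tulcea.CI (chain_step \<mu> H) (\<lambda>_. \<mu>)) (\<lambda>_. \<mu>)"

lemma Ionescu_Tulcea_chain_step:
  assumes "prob_space \<mu>" and H: "H \<in> measurable \<mu> (prob_algebra \<mu>)"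
  shows "Ionescu_Tulcea (chain_step \<mu> H) (\<lambda>_. \<mu>)"
proof (rule Ionescu_Tulcea.intro)
  have [measurable]: "H \<in> measurable \<mu> (subprob_algebra \<mu>)"
    using H by (rule measurable_prob_algebraD)
  interpret prob_space \<mu> by fact
  show "chain_step \<mu> H i \<in> measurable (PiM {0..<i} (\<lambda>_. \<mu>)) (subprob_algebra \<mu>)" for i
  proof (cases i)
    case 0
    then show ?thesis
      by (auto simp: chain_step_def[abs_def] space_subprob_algebra intro!: measurable_const subprob_space_axioms)
  next
    case (Suc k)
    then have [measurable]: "(\<lambda>\<omega>. \<omega> k) \<in> measurable (PiM {0..<i} (\<lambda>_. \<mu>)) \<mu>"
      by (intro measurable_component_singleton) auto
    show ?thesis unfolding chain_step_def[abs_def] Suc nat.case by (fold Suc) measurable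
  qed
  show "prob_space (chain_step \<mu> H i x)" if "x \<in> space (PiM {0..<i} (\<lambda>_. \<mu>))" for i x
  proof (cases i)
    case 0
    then show ?thesis using assms by (simp add: chain_step_def)
  next
    case (Suc k)
    then have "x k \<in> space \<mu>" using that by (auto simp: space_PiM)
    then show ?thesis
      using measurable_space[OF H] Suc by (auto simp: chain_step_def space_prob_algebra)
  qed
qed

text \<open>The trajectory index starts at 0, so the average runs over \<open>i < n\<close>.\<close>

definition chain_average :: "('a \<Rightarrow> real) \<Rightarrow> nat \<Rightarrow> (nat \<Rightarrow> 'a) \<Rightarrow> real" where
  "chain_average f n \<omega> = (1 / real n) * (\<Sum>i<n. f (\<omega> i))"

definition asymptotic_variance :: "'a measure \<Rightarrow> ('a \<Rightarrow> 'a measure) \<Rightarrow> ('a \<Rightarrow> real) \<Rightarrow> ennreal" where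
  "asymptotic_variance \<mu> H f =
    lim (\<lambda>n. ennreal (real n * prob_space.variance (chain_law \<mu> H) (chain_average f n)))"

text \<open>
  \<open>p \<theta> y\<close> is the model density at \<open>y\<close> given \<open>\<theta>\<close>, and \<open>q \<theta> \<theta>'\<close> is the density at \<open>\<theta>'\<close> of
  the proposal from \<open>\<theta>\<close>. The prior density need not be normalized. The class
  \<open>real_normed_vector\<close> together with \<open>finite_dim\<close> allows an arbitrary norm on the space of
  summary statistics.
\<close>

locale abc_model =
  fixes \<Theta> :: "'a measure" and Y :: "'b measure"
    and prior :: "'a \<Rightarrow> real" and p :: "'a \<Rightarrow> 'b \<Rightarrow> real"
    and yobs :: 'b and \<eta> :: "'b \<Rightarrow> 'e::real_normed_vector" and K :: "'e \<Rightarrow> real"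
    and q :: "'a \<Rightarrow> 'a \<Rightarrow> real"
  assumes \<Theta>_sigma_finite: "sigma_finite_measure \<Theta>"
    and Y_sigma_finite: "sigma_finite_measure Y"
    and prior_measurable: "prior \<in> borel_measurable \<Theta>"
    and prior_nonneg: "\<And>\<theta>. \<theta> \<in> space \<Theta> \<Longrightarrow> 0 \<le> prior \<theta>"
    and p_measurable: "(\<lambda>(\<theta>, y). p \<theta> y) \<in> borel_measurable (\<Theta> \<Otimes>\<^sub>M Y)"
    and p_nonneg: "\<And>\<theta> y. \<theta> \<in> space \<Theta> \<Longrightarrow> y \<in> space Y \<Longrightarrow> 0 \<le> p \<theta> y"
    and p_integral: "\<And>\<theta>. \<theta> \<in> space \<Theta> \<Longrightarrow> (\<integral>\<^sup>+y. ennreal (p \<theta> y) \<partial>Y) = 1"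
    and yobs_in_space: "yobs \<in> space Y"
    and finite_dim: "\<exists>B :: 'e set. finite B \<and> span B = UNIV"
    and \<eta>_measurable: "\<eta> \<in> borel_measurable Y"
    and K_measurable: "K \<in> borel_measurable borel"
    and K_nonneg: "\<And>z. 0 \<le> K z"
    and normalizing_constant_pos:
      "0 < (\<integral>\<^sup>+\<theta>. ennreal (prior \<theta>) * (\<integral>\<^sup>+y. ennreal (K (\<eta> yobs - \<eta> y) * p \<theta> y) \<partial>Y) \<partial>\<Theta>)"
    and normalizing_constant_finite:
      "(\<integral>\<^sup>+\<theta>. ennreal (prior \<theta>) * (\<integral>\<^sup>+y. ennreal (K (\<eta> yobs - \<eta> y) * p \<theta> y) \<partial>Y) \<partial>\<Theta>) < \<infinity>"
    and q_measurable: "(\<lambda>(\<theta>, \<theta>'). q \<theta> \<theta>') \<in> borel_measurable (\<Theta> \<Otimes>\<^sub>M \<Theta>)"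
    and q_nonneg: "\<And>\<theta> \<theta>'. \<theta> \<in> space \<Theta> \<Longrightarrow> \<theta>' \<in> space \<Theta> \<Longrightarrow> 0 \<le> q \<theta> \<theta>'"
    and q_integral: "\<And>\<theta>. \<theta> \<in> space \<Theta> \<Longrightarrow> (\<integral>\<^sup>+\<theta>'. ennreal (q \<theta> \<theta>') \<partial>\<Theta>) = 1"
    and q_reversible:
      "\<exists>\<nu>. sets \<nu> = sets \<Theta> \<and> sigma_finite_measure \<nu> \<and> emeasure \<nu> (space \<nu>) \<noteq> 0 \<and>
        reversible_wrt \<nu> (\<lambda>\<theta>. density \<Theta> (\<lambda>\<theta>'. ennreal (q \<theta> \<theta>')))"
begin

definition \<pi>_K :: "'a measure" where
  "\<pi>_K = normalized (density \<Theta>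
    (\<lambda>\<theta>. ennreal (prior \<theta>) * (\<integral>\<^sup>+y. ennreal (K (\<eta> yobs - \<eta> y) * p \<theta> y) \<partial>Y)))"

definition T_value :: "nat \<Rightarrow> 'a \<Rightarrow> (nat \<Rightarrow> 'b) \<Rightarrow> real" where
  "T_value m \<theta> y = prior \<theta> * ((1 / real m) * (\<Sum>i<m. K (\<eta> yobs - \<eta> (y i))))"

definition T_law :: "nat \<Rightarrow> 'a \<Rightarrow> real measure" where
  "T_law m \<theta> = distr (PiM {..<m} (\<lambda>_. density Y (\<lambda>y. ennreal (p \<theta> y))))
    (restrict_space borel {0..}) (T_value m \<theta>)"

definition state_space :: "('a \<times> real) measure" where
  "state_space = \<Theta> \<Otimes>\<^sub>M restrict_space borel {0..}"

definition acceptance :: "'a \<times> real \<Rightarrow> 'a \<times> real \<Rightarrow> real" where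
  "acceptance = (\<lambda>(\<theta>, t) (\<theta>', t').
    if t * q \<theta> \<theta>' = 0 then 1 else min 1 ((t' * q \<theta>' \<theta>) / (t * q \<theta> \<theta>')))"

definition Q :: "nat \<Rightarrow> 'a \<times> real \<Rightarrow> ('a \<times> real) measure" where
  "Q m x =
    density \<Theta> (\<lambda>\<theta>'. ennreal (q (fst x) \<theta>')) \<bind> (\<lambda>\<theta>'.
    T_law m \<theta>' \<bind> (\<lambda>t'.
    distr (bernoulli_pmf (acceptance x (\<theta>', t'))) state_space
      (\<lambda>accept. if accept then (\<theta>', t') else x)))"

definition \<pi>_tilde :: "nat \<Rightarrow> ('a \<times> real) measure" where
  "\<pi>_tilde m = normalized (density
    (\<Theta> \<bind> (\<lambda>\<theta>. distr (T_law m \<theta>) state_space (\<lambda>t. (\<theta>, t)))) (\<lambda>(\<theta>, t). ennreal t))"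

definition v :: "('a \<Rightarrow> real) \<Rightarrow> nat \<Rightarrow> ennreal" where
  "v f m = asymptotic_variance (\<pi>_tilde m) (Q m) (\<lambda>(\<theta>, t). f \<theta>)"

definition serial_time :: "('a \<Rightarrow> real) \<Rightarrow> nat \<Rightarrow> real \<Rightarrow> ennreal" where
  "serial_time f m \<delta> = of_nat m * v f m / ennreal \<delta>"

text \<open>
  The parallel running times, on \<open>m\<close> processors, count chain iterations: either one chain whose
  \<open>m\<close> pseudo-samples are drawn in parallel, or \<open>m\<close> independent chains with one pseudo-sample each.
\<close>

definition parallel_time_single_chain :: "('a \<Rightarrow> real) \<Rightarrow> nat \<Rightarrow> real \<Rightarrow> ennreal" where
  "parallel_time_single_chain f m \<delta> = v f m / ennreal \<delta>"

definition parallel_time_multiple_chains :: "('a \<Rightarrow> real) \<Rightarrow> nat \<Rightarrow> real \<Rightarrow> ennreal" where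
  "parallel_time_multiple_chains f m \<delta> = v f 1 / ennreal (\<delta> * real m)"

end

definition uniform_kernel :: "real \<Rightarrow> 'e::real_normed_vector \<Rightarrow> real" where
  "uniform_kernel \<epsilon> z = indicator {z. norm z < \<epsilon>} z"

end

theory Submission
  imports Defs
begin

text \<open>
  Let \<open>\<gamma> k = \<langle>f, H^k f\<rangle>\<close> be the autocovariances of a centred \<open>f\<close> along a reversible chain. The scaled
  variance of the average over \<open>n\<close> steps is the Cesaro mean of \<open>2 S - \<gamma> 0\<close>, where \<open>S\<close> runs over the
  partial sums of \<open>\<gamma>\<close>. It converges in \<open>[0, \<infinity>]\<close> because \<open>\<gamma>\<close> has nonnegative pair sums and its even
  terms decrease, and Abel summation then gives the same limit. The Abel sums are
  \<open>\<langle>f, (1 - r H)^(-1) f\<rangle> = sup_u (2 \<langle>f, u\<rangle> - \<langle>u, (1 - r H) u\<rangle>)\<close>, so an inequality between Dirichlet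
  forms yields one between asymptotic variances, without any spectral theory.

  For a kernel with values in {0, 1} the Dirichlet form of \<open>Q_M\<close> on functions of \<open>\<theta>\<close> is at most \<open>M\<close> times
  that of \<open>Q_1\<close>, and \<open>Q_1\<close> is essentially a chain in \<open>\<theta>\<close>. Therefore
  \<open>v(f, Q_1) + Var f \<le> M (v(f, Q_M) + Var f)\<close>, and nonnegative definiteness
  gives \<open>Var f \<le> v(f, Q_M)\<close>.
\<close>

section \<open>Cesaro and Abel means of autocovariances\<close>

text \<open>The two chains have different stationary laws on the enlarged space, so their operators
  cannot be compared directly; only functions of the parameter are common to both. The variational
  formula is one-sided in just the way this needs: restricting the test functions to functions of
  \<open>\<theta>\<close> can only lower the supremum for \<open>Q_M\<close>, while for
  \<open>Q_1\<close> nothing is lost.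

  Asymptotic variances may be infinite and autocovariances need not be summable, so the comparison
  is made at each \<open>r < 1\<close>, where all series converge absolutely, and \<open>r\<close>
  tends to 1 only at the end. In the limit an Abel sum is half of the sum of variance and asymptotic
  variance. That sum is what \<open>M\<close> multiplies, and the 2 of the theorem is the price of
  returning to the asymptotic variance alone.

  The factor \<open>M\<close> has its origin in a product: the flow between two parameters is
  bounded through the product of two independent sums of \<open>M\<close> hits, whose mean is of
  order \<open>M^2\<close>, and the averaging takes one factor back.\<close>

lemma eventually_le_add_const:
  fixes x y :: "nat \<Rightarrow> real"
  assumes "eventually (\<lambda>n. x n \<le> y n) sequentially"
  shows "\<exists>C. \<forall>n. x n \<le> y n + C"
proof -
  obtain N where N: "\<And>n. N \<le> n \<Longrightarrow> x n \<le> y n"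
    using assms by (auto simp: eventually_sequentially)
  have "x n \<le> y n + (\<Sum>j<N. \<bar>x j - y j\<bar>)" for n
  proof (cases "n < N")
    case True
    then have "\<bar>x n - y n\<bar> \<le> (\<Sum>j<N. \<bar>x j - y j\<bar>)"
      by (intro member_le_sum) auto
    then show ?thesis by linarith
  next
    case False
    then show ?thesis using N[of n] by (intro add_increasing2) (auto intro: sum_nonneg)
  qed
  then show ?thesis by blast
qed

lemma sum_ge_linear:
  fixes x :: "nat \<Rightarrow> real"
  assumes "eventually (\<lambda>j. b \<le> x j) sequentially"
  obtains C where "\<And>n. b * real n - C \<le> (\<Sum>j<n. x j)"
proof -
  obtain N where N: "\<And>j. N \<le> j \<Longrightarrow> b \<le> x j"
    using assms by (auto simp: eventually_sequentially)
  have "b * real n - (\<Sum>j<N. \<bar>b - x j\<bar>) \<le> (\<Sum>j<n. x j)" for n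
  proof -
    have "b * real n - (\<Sum>j<n. x j) = (\<Sum>j<n. b - x j)"
      by (simp add: sum_subtractf)
    also have "\<dots> \<le> (\<Sum>j<n. if j < N then \<bar>b - x j\<bar> else 0)"
      using N by (intro sum_mono) (auto simp: not_less)
    also have "\<dots> = (\<Sum>j\<in>{..<n} \<inter> {..<N}. \<bar>b - x j\<bar>)"
      by (simp add: sum.inter_restrict)
    also have "\<dots> \<le> (\<Sum>j<N. \<bar>b - x j\<bar>)"
      by (intro sum_mono2) auto
    finally show ?thesis by simp
  qed
  then show ?thesis by (rule that)
qed

text \<open>The early terms cost only a constant, which the gap between \<open>c\<close> and
  \<open>b\<close> absorbs once \<open>n\<close> is large. The one-sided form also serves for means
  that diverge to infinity.\<close>

lemma cesaro_eventually_ge: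
  fixes x :: "nat \<Rightarrow> real"
  assumes "eventually (\<lambda>j. b \<le> x j) sequentially" and "c < b"
  shows "eventually (\<lambda>n. c \<le> (\<Sum>j<n. x j) / real n) sequentially"
proof -
  obtain C where C: "\<And>n. b * real n - C \<le> (\<Sum>j<n. x j)"
    using sum_ge_linear[OF assms(1)] by blast
  obtain N where N: "C / (b - c) < real N"
    using reals_Archimedean2 by blast
  have "c \<le> (\<Sum>j<n. x j) / real n" if n: "n \<ge> Suc N" for n
  proof -
    have "C / (b - c) \<le> real n" using N n by linarith
    then have "C \<le> (b - c) * real n"
      using assms(2) by (simp add: pos_divide_le_eq mult.commute)
    then have "c * real n \<le> (\<Sum>j<n. x j)" using C[of n] by (simp add: algebra_simps)
    then show ?thesis using n by (simp add: pos_le_divide_eq)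
  qed
  then show ?thesis by (auto simp: eventually_sequentially)
qed

lemma cesaro_tendsto:
  fixes x :: "nat \<Rightarrow> real"
  assumes "x \<longlonglongrightarrow> l"
  shows "(\<lambda>n. (\<Sum>j<n. x j) / real n) \<longlonglongrightarrow> l"
proof (rule order_tendstoI)
  fix a assume "a < l"
  then obtain b c where "a < c" "c < b" "b < l" by (meson dense)
  have "\<forall>\<^sub>F j in sequentially. b \<le> x j"
    using order_tendstoD(1)[OF assms \<open>b < l\<close>] by (rule eventually_mono) simp
  from cesaro_eventually_ge[OF this \<open>c < b\<close>]
  show "\<forall>\<^sub>F n in sequentially. a < (\<Sum>j<n. x j) / real n"
    by (rule eventually_mono) (use \<open>a < c\<close> in simp)
next
  fix a assume "l < a"
  then obtain b c where bc: "c < a" "b < c" "l < b" by (meson dense)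
  have "\<forall>\<^sub>F n in sequentially. - c \<le> (\<Sum>j<n. - x j) / real n"
    using bc order_tendstoD(2)[OF assms \<open>l < b\<close>]
    by (intro cesaro_eventually_ge[of "- b"]) (auto elim!: eventually_mono)
  then show "\<forall>\<^sub>F n in sequentially. (\<Sum>j<n. x j) / real n < a"
    using bc by (auto simp: sum_negf elim!: eventually_mono)
qed

text \<open>Subtracting the two-periodic pattern \<open>p\<close> leaves a null sequence, so plain
  Cesaro convergence applies to the difference and the means of \<open>p\<close> are
  explicit.\<close>

lemma cesaro_alternating:
  fixes x :: "nat \<Rightarrow> real"
  assumes "(\<lambda>m. x (2 * m)) \<longlonglongrightarrow> a" and "(\<lambda>m. x (2 * m + 1)) \<longlonglongrightarrow> b"
  shows "(\<lambda>n. (\<Sum>j<n. x j) / real n) \<longlonglongrightarrow> (a + b) / 2"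
proof -
  define p where "p j = (if even j then a else b)" for j :: nat
  have "(\<lambda>j. x j - p j) \<longlonglongrightarrow> 0"
  proof (rule LIMSEQ_I)
    fix r :: real assume r: "0 < r"
    obtain N1 where N1: "\<And>m. m \<ge> N1 \<Longrightarrow> norm (x (2 * m) - a) < r"
      using LIMSEQ_D[OF assms(1) r] by blast
    obtain N2 where N2: "\<And>m. m \<ge> N2 \<Longrightarrow> norm (x (2 * m + 1) - b) < r"
      using LIMSEQ_D[OF assms(2) r] by blast
    have "norm (x j - p j - 0) < r" if "j \<ge> 2 * (N1 + N2) + 1" for j
      using that N1[of "j div 2"] N2[of "j div 2"]
      by (cases "even j") (auto simp: p_def elim!: evenE oddE)
    then show "\<exists>no. \<forall>j\<ge>no. norm (x j - p j - 0) < r" by blast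
  qed
  then have 1: "(\<lambda>n. (\<Sum>j<n. x j - p j) / real n) \<longlonglongrightarrow> 0"
    by (rule cesaro_tendsto)
  \<comment> \<open>An odd number of terms contains one more \<open>a\<close> than \<open>b\<close>,
    hence the correction \<open>(a - b) / 2\<close>.\<close>
  have sp: "(\<Sum>j<n. p j) = (a + b) / 2 * real n + (if even n then 0 else (a - b) / 2)" for n
    by (induction n) (auto simp: p_def field_simps)
  have "(\<lambda>n. (if even n then 0 else (a - b) / 2) / real n) \<longlonglongrightarrow> 0"
  proof (rule tendsto_0_le[where K = 1])
    show "(\<lambda>n. \<bar>(a - b) / 2\<bar> / real n) \<longlonglongrightarrow> 0"
      by (rule lim_const_over_n)
  qed (auto simp: divide_right_mono)
  from tendsto_add[OF tendsto_const this, of "(a + b) / 2"]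
  have "(\<lambda>n. (a + b) / 2 + (if even n then 0 else (a - b) / 2) / real n) \<longlonglongrightarrow> (a + b) / 2"
    by simp
  then have 2: "(\<lambda>n. (\<Sum>j<n. p j) / real n) \<longlonglongrightarrow> (a + b) / 2"
    by (rule Lim_transform_eventually)
       (rule eventually_mono[OF eventually_gt_at_top[of 0]], simp add: sp add_divide_distrib)
  from tendsto_add[OF 1 2] show ?thesis
    by (simp add: sum_subtractf diff_divide_distrib)
qed

section \<open>Double sums over lags and their generating functions\<close>

definition double_sum :: "(nat \<Rightarrow> real) \<Rightarrow> nat \<Rightarrow> real" where
  "double_sum \<gamma> n = (\<Sum>i<n. \<Sum>j<n. \<gamma> (if i \<le> j then j - i else i - j))"

text \<open>Enlarging the square adds a row and a column, each running through the lags from 0 to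
  \<open>n\<close>. They share the corner entry, which is therefore subtracted once.\<close>

lemma double_sum_Suc: "double_sum \<gamma> (Suc n) = double_sum \<gamma> n + (2 * (\<Sum>k<Suc n. \<gamma> k) - \<gamma> 0)"
proof -
  let ?g = "\<lambda>i j. \<gamma> (if i \<le> j then j - i else i - j)"
  have refl: "(\<Sum>i<n. \<gamma> (n - i)) = (\<Sum>k<n. \<gamma> (Suc k))"
    by (rule sum.reindex_bij_witness[of _ "\<lambda>k. n - Suc k" "\<lambda>k. n - Suc k"]) (auto simp: Suc_diff_Suc)
  have "double_sum \<gamma> (Suc n) = (\<Sum>i<n. (\<Sum>j<n. ?g i j) + ?g i n) + ((\<Sum>j<n. ?g n j) + ?g n n)"
    by (simp add: double_sum_def)
  also have "\<dots> = double_sum \<gamma> n + (\<Sum>i<n. \<gamma> (n - i)) + (\<Sum>j<n. \<gamma> (n - j)) + \<gamma> 0"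
    by (simp add: double_sum_def sum.distrib)
  also have "\<dots> = double_sum \<gamma> n + (2 * (\<Sum>k<Suc n. \<gamma> k) - \<gamma> 0)"
    unfolding sum.lessThan_Suc_shift refl by simp
  finally show ?thesis .
qed

lemma double_sum_eq: "double_sum \<gamma> n = (\<Sum>j<n. 2 * (\<Sum>k<Suc j. \<gamma> k) - \<gamma> 0)"
  by (induction n) (simp add: double_sum_def, simp add: double_sum_Suc)

text \<open>Each increment in \<open>double_sum_eq\<close> is \<open>\<gamma> 0\<close> plus twice a
  sum of nonnegative terms. Through this bound nonnegative definiteness will make the variance at
  most the asymptotic variance.\<close>

lemma double_sum_ge:
  assumes "\<And>k. 0 \<le> \<gamma> k"
  shows "\<gamma> 0 * real n \<le> double_sum \<gamma> n"
proof -
  have "(\<Sum>j<n. \<gamma> 0) \<le> double_sum \<gamma> n"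
    unfolding double_sum_eq sum.lessThan_Suc_shift
    using assms by (intro sum_mono) (auto intro!: sum_nonneg)
  then show ?thesis by (simp add: mult.commute)
qed

text \<open>Taking partial sums of the coefficients is multiplication by the geometric series, hence
  a Cauchy product. The absolute summability in the conclusion allows a second application to the
  result of the first.\<close>

lemma power_series_partial_sums:
  fixes a :: "nat \<Rightarrow> real"
  assumes "(\<lambda>k. a k * r ^ k) sums s" and "summable (\<lambda>k. \<bar>a k * r ^ k\<bar>)" and "0 \<le> r" "r < 1"
  shows "(\<lambda>n. (\<Sum>k<Suc n. a k) * r ^ n) sums (s / (1 - r))"
    and "summable (\<lambda>n. \<bar>(\<Sum>k<Suc n. a k) * r ^ n\<bar>)"
proof -
  have eq: "(\<Sum>k\<le>n. (a k * r ^ k) * r ^ (n - k)) = (\<Sum>k<Suc n. a k) * r ^ n" for n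
    unfolding sum_distrib_right lessThan_Suc_atMost
    by (intro sum.cong) (auto simp: power_add[symmetric])
  have r: "summable (\<lambda>k. norm (r ^ k))" using assms(3,4) by (simp add: summable_geometric)
  have "(\<lambda>n. \<Sum>k\<le>n. (a k * r ^ k) * r ^ (n - k)) sums ((\<Sum>k. a k * r ^ k) * (\<Sum>k. r ^ k))"
    using assms(2) r by (intro Cauchy_product_sums) auto
  then show "(\<lambda>n. (\<Sum>k<Suc n. a k) * r ^ n) sums (s / (1 - r))"
    using assms sums_unique[OF assms(1)] suminf_geometric[of r] unfolding eq by simp
  have "summable (\<lambda>n. \<Sum>k\<le>n. \<bar>a k * r ^ k\<bar> * r ^ (n - k))"
    using assms(2) r by (intro summable_Cauchy_product) auto
  then show "summable (\<lambda>n. \<bar>(\<Sum>k<Suc n. a k) * r ^ n\<bar>)"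
    unfolding eq[symmetric]
    by (rule summable_comparison_test[rotated])
       (auto intro!: exI[of _ 0] order_trans[OF sum_abs] sum_mono simp: abs_mult assms(3))
qed


text \<open>Partial sums are taken twice, over the lags and then over the growing square, and each
  time contributes a factor \<open>1 / (1 - r)\<close>.\<close>

lemma double_sum_power_series:
  assumes "(\<lambda>k. \<gamma> k * r ^ k) sums A" and "summable (\<lambda>k. \<bar>\<gamma> k * r ^ k\<bar>)" and "0 \<le> r" "r < 1"
  shows "(\<lambda>n. double_sum \<gamma> (Suc n) * r ^ n) sums ((2 * A - \<gamma> 0) / (1 - r)\<^sup>2)"
proof -
  \<comment> \<open>The sequence whose partial sums are the increments of \<open>double_sum\<close>:
    lag 0 counts once, every other lag twice.\<close>
  define c where "c k = (if k = 0 then \<gamma> 0 else 2 * \<gamma> k)" for k :: nat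
  have c_eq: "c k * r ^ k = 2 * (\<gamma> k * r ^ k) - (if k = 0 then \<gamma> 0 else 0)" for k
    by (simp add: c_def)
  have "(\<lambda>k. c k * r ^ k) sums (2 * A - \<gamma> 0)"
    unfolding c_eq using sums_single[of 0 "\<lambda>_. \<gamma> 0"]
    by (intro sums_diff sums_mult assms(1)) (simp add: eq_commute cong: if_cong)
  moreover have "summable (\<lambda>k. \<bar>c k * r ^ k\<bar>)"
    by (rule summable_comparison_test[OF _ summable_mult[OF assms(2), of 2]])
       (auto simp: c_def abs_mult intro!: exI[of _ 0])
  ultimately have "(\<lambda>n. (\<Sum>j<Suc n. \<Sum>k<Suc j. c k) * r ^ n) sums ((2 * A - \<gamma> 0) / (1 - r) / (1 - r))"
    by (intro power_series_partial_sums assms)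
  moreover have "(\<Sum>k<Suc j. c k) = 2 * (\<Sum>k<Suc j. \<gamma> k) - \<gamma> 0" for j
    by (induction j) (simp_all add: c_def)
  ultimately show ?thesis
    unfolding double_sum_eq by (simp add: power2_eq_square)
qed

text \<open>The line \<open>b * n + C\<close> has a generating function with a double pole of weight
  \<open>b\<close> and a simple pole of weight \<open>C\<close> at 1. After multiplication by
  \<open>(1 - r)^2\<close> the constant carries a factor \<open>1 - r\<close> and will vanish in the
  limit.\<close>

lemma double_sum_abel_le:
  assumes "(\<lambda>k. \<gamma> k * r ^ k) sums A" and "summable (\<lambda>k. \<bar>\<gamma> k * r ^ k\<bar>)" and "0 \<le> r" "r < 1"
    and "\<And>n. double_sum \<gamma> n \<le> b * real n + C"
  shows "2 * A - \<gamma> 0 \<le> b + (1 - r) * C"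
proof -
  have "(\<lambda>n. (b * real (Suc n) + C) * r ^ n) sums (b * (1 / (1 - r)\<^sup>2) + C * (1 / (1 - r)))"
    using sums_add[OF sums_mult[OF geometric_deriv_sums[of r], of b] sums_mult[OF geometric_sums[of r], of C]] assms(3,4)
    by (simp add: algebra_simps)
  from sums_le[OF _ double_sum_power_series[OF assms(1-4)] this]
  have "(2 * A - \<gamma> 0) / (1 - r)\<^sup>2 \<le> b * (1 / (1 - r)\<^sup>2) + C * (1 / (1 - r))"
    using mult_right_mono[OF assms(5) zero_le_power[OF assms(3)]] by blast
  also have "\<dots> = (b + (1 - r) * C) / (1 - r)\<^sup>2"
    using assms(4) by (simp add: power2_eq_square add_divide_distrib)
  finally show ?thesis using assms(4) by (simp add: divide_le_cancel)
qed

lemma double_sum_uminus: "double_sum (\<lambda>k. - \<gamma> k) n = - double_sum \<gamma> n"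
  by (simp add: double_sum_def sum_negf)

lemma double_sum_abel_ge:
  assumes "(\<lambda>k. \<gamma> k * r ^ k) sums A" and "summable (\<lambda>k. \<bar>\<gamma> k * r ^ k\<bar>)" and "0 \<le> r" "r < 1"
    and "\<And>n. b * real n - C \<le> double_sum \<gamma> n"
  shows "b - (1 - r) * C \<le> 2 * A - \<gamma> 0"
proof -
  have "(\<lambda>k. - \<gamma> k * r ^ k) sums (- A)"
    using sums_minus[OF assms(1)] by simp
  then have "2 * (- A) - (- \<gamma> 0) \<le> - b + (1 - r) * C"
    using assms(2-) by (intro double_sum_abel_le) (auto simp: double_sum_uminus algebra_simps)
  then show ?thesis by simp
qed

text \<open>
  The hypotheses hold for the autocovariances of a reversible chain: the even-indexed ones are the
  squared norms of the iterates, and consecutive pairs have nonnegative sums (Geyer).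
\<close>

locale reversible_autocovariance =
  fixes \<gamma> :: "nat \<Rightarrow> real"
  assumes even_nonneg: "0 \<le> \<gamma> (2 * k)"
    and even_decreasing: "\<gamma> (2 * Suc k) \<le> \<gamma> (2 * k)"
    and pair_nonneg: "0 \<le> \<gamma> (2 * k) + \<gamma> (2 * k + 1)"
    and abs_odd_le: "\<bar>\<gamma> (2 * k + 1)\<bar> \<le> \<gamma> (2 * k)"
begin

lemma abs_le: "\<bar>\<gamma> k\<bar> \<le> \<gamma> 0"
proof -
  have "\<gamma> (2 * j) \<le> \<gamma> 0" for j
  proof (induction j)
    case (Suc j)
    then show ?case using even_decreasing[of j] by linarith
  qed simp
  from this[of "k div 2"] show ?thesis
    using even_nonneg[of "k div 2"] abs_odd_le[of "k div 2"]
    by (cases "even k") auto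
qed

lemma summable_abs:
  assumes "0 \<le> r" "r < 1"
  shows "summable (\<lambda>k. \<bar>\<gamma> k * r ^ k\<bar>)"
  using assms abs_le
  by (intro summable_comparison_test[OF _ summable_mult[OF summable_geometric[of r], of "\<gamma> 0"]])
     (auto simp: abs_mult mult_right_mono intro!: exI[of _ 0])

lemma double_sum_converges: "\<exists>L. (\<lambda>n. ennreal (double_sum \<gamma> n / real n)) \<longlonglongrightarrow> L"
proof -
  define S where "S n = (\<Sum>k<n. \<gamma> k)" for n
  define x where "x j = 2 * S (Suc j) - \<gamma> 0" for j
  have D: "double_sum \<gamma> n = (\<Sum>j<n. x j)" for n
    by (simp add: double_sum_eq x_def S_def)
  have S_even: "incseq (\<lambda>m. S (2 * m))"
    using pair_nonneg by (intro incseq_SucI) (simp add: S_def add.assoc)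
  have x_even: "x (2 * m) = 2 * (S (2 * m) + \<gamma> (2 * m)) - \<gamma> 0" for m
    by (simp add: x_def S_def)
  have x_odd: "x (2 * m + 1) = 2 * S (2 * Suc m) - \<gamma> 0" for m
    by (simp add: x_def)
  show ?thesis
  proof (cases "bdd_above (range (\<lambda>m. S (2 * m)))")
    case True
    then obtain s where s: "(\<lambda>m. S (2 * m)) \<longlonglongrightarrow> s"
      using LIMSEQ_incseq_SUP[OF True S_even] by blast
    have "decseq (\<lambda>m. \<gamma> (2 * m))"
      by (intro decseq_SucI even_decreasing)
    then obtain c where c: "(\<lambda>m. \<gamma> (2 * m)) \<longlonglongrightarrow> c"
      using decseq_convergent[of "\<lambda>m. \<gamma> (2 * m)" 0] even_nonneg by metis
    \<comment> \<open>The limits along even and odd indices differ by \<open>2 * c\<close>, which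
      need not be 0 when the chain has a periodic part. So \<open>x\<close> itself may oscillate,
      and only its means converge.\<close>
    have "(\<lambda>m. x (2 * m)) \<longlonglongrightarrow> 2 * (s + c) - \<gamma> 0"
      unfolding x_even by (intro tendsto_intros s c)
    moreover have "(\<lambda>m. x (2 * m + 1)) \<longlonglongrightarrow> 2 * s - \<gamma> 0"
      unfolding x_odd by (intro tendsto_intros LIMSEQ_Suc[OF s])
    ultimately show ?thesis
      unfolding D using cesaro_alternating tendsto_ennrealI by blast
  next
    case False
    \<comment> \<open>The increasing even partial sums control both residue classes, because an odd
      number of lags only adds an autocovariance of even index, which is nonnegative.\<close>
    have "eventually (\<lambda>j. b \<le> x j) sequentially" for b
    proof -
      obtain m where m: "(b + \<gamma> 0) / 2 \<le> S (2 * m)"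
        using False unfolding bdd_above_def by (metis linear rangeE)
      have "b \<le> x j" if j: "j \<ge> 2 * m" for j
      proof (cases "even j")
        case True
        then obtain i where i: "j = 2 * i" by (elim evenE)
        have "S (2 * m) \<le> S (2 * i)" using S_even j i by (auto simp: incseq_def)
        then show ?thesis unfolding i x_even using m even_nonneg[of i] by (simp add: field_simps)
      next
        case odd: False
        then obtain i where i: "j = 2 * i + 1" by (elim oddE)
        have "S (2 * m) \<le> S (2 * Suc i)" using incseqD[OF S_even, of m "Suc i"] j i by auto
        then show ?thesis unfolding i x_odd using m by (simp add: field_simps)
      qed
      then show ?thesis by (auto simp: eventually_sequentially)
    qed
    then have ev: "eventually (\<lambda>n. c \<le> double_sum \<gamma> n / real n) sequentially" for c
      unfolding D by (rule cesaro_eventually_ge[of "c + 1"]) auto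
    have "(\<lambda>n. ennreal (double_sum \<gamma> n / real n)) \<longlonglongrightarrow> \<top>"
    proof (rule order_tendstoI)
      fix a :: ennreal assume "a < \<top>"
      then obtain c where c: "a = ennreal c" "0 \<le> c" by (cases a) auto
      show "\<forall>\<^sub>F n in sequentially. a < ennreal (double_sum \<gamma> n / real n)"
        using ev[of "c + 1"] c by (auto elim!: eventually_mono simp: ennreal_less_iff)
    qed auto
    then show ?thesis by blast
  qed
qed

end

text \<open>Both limits may be infinite. A violated inequality leaves room for a real
  \<open>b\<close> strictly between the two sides, which yields linear bounds on the double sums
  with finite slopes; to these the Abel estimates apply, without separating finite from infinite
  limits.\<close>

lemma asymptotic_comparison:
  assumes "reversible_autocovariance \<gamma>" and "reversible_autocovariance \<gamma>'"
    and "1 \<le> c" and "\<gamma> 0 = \<gamma>' 0"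
    and abel: "\<And>r. 0 < r \<Longrightarrow> r < 1 \<Longrightarrow> (\<Sum>k. \<gamma> k * r ^ k) \<le> c * (\<Sum>k. \<gamma>' k * r ^ k)"
    and nonneg: "\<And>k. 0 \<le> \<gamma>' k"
    and L: "(\<lambda>n. ennreal (double_sum \<gamma> n / real n)) \<longlonglongrightarrow> L"
    and L': "(\<lambda>n. ennreal (double_sum \<gamma>' n / real n)) \<longlonglongrightarrow> L'"
  shows "L \<le> ennreal (2 * c) * L'"
proof (rule ccontr)
  interpret g: reversible_autocovariance \<gamma> by fact
  interpret g': reversible_autocovariance \<gamma>' by fact
  have c: "0 < c" using \<open>1 \<le> c\<close> by simp
  assume "\<not> L \<le> ennreal (2 * c) * L'"
  then have "ennreal (2 * c) * L' < L" by (simp add: not_le)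
  from dense[OF this] obtain B where B: "ennreal (2 * c) * L' < B" "B < L"
    by blast
  then obtain b where b: "B = ennreal b" "0 \<le> b" by (cases B) auto
  \<comment> \<open>\<open>b'\<close> is a real strictly above \<open>L'\<close> for which
    \<open>2 * c * b'\<close> is still strictly below \<open>L\<close>.\<close>
  define b' where "b' = b / (2 * c)"
  have b'0: "0 \<le> b'" using b c by (simp add: b'_def)
  have bb': "b = 2 * c * b'" using c by (simp add: b'_def)
  have L'b: "L' < ennreal b'"
  proof -
    have "ennreal (2 * c) * L' < ennreal (2 * c) * ennreal b'"
      using B(1) c b'0 unfolding b bb' by (subst (asm) ennreal_mult) auto
    then show ?thesis by (meson mult_left_mono not_le zero_le)
  qed
  have "\<forall>\<^sub>F n in sequentially. b * real n \<le> double_sum \<gamma> n"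
    using order_tendstoD(1)[OF L \<open>B < L\<close>] eventually_gt_at_top[of 0]
    by eventually_elim (use b in \<open>simp add: ennreal_less_iff pos_less_divide_eq\<close>)
  \<comment> \<open>Abel means involve every index, so the eventual bound is made global at the
    price of an additive constant.\<close>
  from eventually_le_add_const[OF this] obtain C where C: "\<And>n. b * real n \<le> double_sum \<gamma> n + C"
    by blast
  have ev': "\<forall>\<^sub>F n in sequentially. 0 < n \<and> double_sum \<gamma>' n \<le> b' * real n"
    using order_tendstoD(2)[OF L' L'b] eventually_gt_at_top[of 0]
  proof eventually_elim
    case (elim n)
    have "0 \<le> double_sum \<gamma>' n" by (simp add: double_sum_def nonneg sum_nonneg)
    with elim show ?case by (simp add: ennreal_less_iff pos_divide_less_eq)
  qed
  then have "\<forall>\<^sub>F n in sequentially. double_sum \<gamma>' n \<le> b' * real n"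
    by (rule eventually_mono) simp
  from eventually_le_add_const[OF this] obtain C' where C': "\<And>n. double_sum \<gamma>' n \<le> b' * real n + C'"
    by blast
  have ge: "\<gamma>' 0 \<le> b'"
  proof -
    obtain n where n: "0 < n" "double_sum \<gamma>' n \<le> b' * real n"
      using eventually_happens'[OF _ ev'] by auto
    then have "\<gamma>' 0 * real n \<le> b' * real n"
      using double_sum_ge[of \<gamma>' n] nonneg by (meson order_trans)
    then show ?thesis using n(1) by simp
  qed
  have "b - (1 - r) * C + \<gamma> 0 \<le> c * (b' + (1 - r) * C' + \<gamma>' 0)" if r: "0 < r" "r < 1" for r
  proof -
    have s: "(\<lambda>k. \<gamma> k * r ^ k) sums (\<Sum>k. \<gamma> k * r ^ k)" and s': "(\<lambda>k. \<gamma>' k * r ^ k) sums (\<Sum>k. \<gamma>' k * r ^ k)"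
      using r g.summable_abs[of r] g'.summable_abs[of r]
      by (auto intro!: summable_sums intro: summable_rabs_cancel)
    have "b - (1 - r) * C \<le> 2 * (\<Sum>k. \<gamma> k * r ^ k) - \<gamma> 0"
      using r by (intro double_sum_abel_ge[OF s g.summable_abs]) (use C in \<open>auto simp: diff_le_eq\<close>)
    moreover have "2 * (\<Sum>k. \<gamma>' k * r ^ k) - \<gamma>' 0 \<le> b' + (1 - r) * C'"
      using r by (intro double_sum_abel_le[OF s' g'.summable_abs _ _ C']) auto
    then have "c * (2 * (\<Sum>k. \<gamma>' k * r ^ k)) \<le> c * (b' + (1 - r) * C' + \<gamma>' 0)"
      using c by (intro mult_left_mono) auto
    ultimately show ?thesis
      using abel[OF r] by simp
  qed
  \<comment> \<open>As \<open>r\<close> tends to 1 from below, the constants \<open>C\<close> and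
    \<open>C'\<close>, which paid for the small indices, disappear.\<close>
  then have "\<forall>\<^sub>F r in at_left 1. b - (1 - r) * C + \<gamma> 0 \<le> c * (b' + (1 - r) * C' + \<gamma>' 0)"
    by (intro eventually_at_leftI[of 0]) auto
  moreover have "((\<lambda>r. b - (1 - r) * C + \<gamma> 0) \<longlongrightarrow> b - (1 - 1) * C + \<gamma> 0) (at_left 1)"
    "((\<lambda>r. c * (b' + (1 - r) * C' + \<gamma>' 0)) \<longlongrightarrow> c * (b' + (1 - 1) * C' + \<gamma>' 0)) (at_left 1)"
    by (intro tendsto_intros)+
  ultimately have "b + \<gamma> 0 \<le> c * (b' + \<gamma>' 0)"
    by (auto dest: tendsto_le[rotated 2] simp: trivial_limit_at_left_real)
  \<comment> \<open>The limit is only a weak inequality, but with \<open>b = 2 * c * b'\<close> and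
    \<open>\<gamma>' 0 \<le> b'\<close> it forces first \<open>\<gamma>' 0 = 0\<close> and then
    \<open>b' \<le> 0\<close>, against \<open>L' < b'\<close>.\<close>
  then have "c * b' + \<gamma>' 0 \<le> c * \<gamma>' 0" using bb' assms(4) by (simp add: algebra_simps)
  also have "\<dots> \<le> c * b'" using ge c by simp
  finally have "\<gamma>' 0 \<le> 0" by simp
  moreover have "0 \<le> \<gamma>' 0" by (rule nonneg)
  ultimately have "c * b' \<le> 0" using \<open>c * b' + \<gamma>' 0 \<le> c * \<gamma>' 0\<close> by simp
  then have "b' \<le> 0" using c by (simp add: mult_le_0_iff)
  then show False using L'b by (simp add: ennreal_neg)
qed

section \<open>Reversible chains on \<open>L2\<close>\<close>

text \<open>The three facts reduce to nonnegative integrals of the positive and negative parts,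
  which are finite because \<open>\<bar>f\<bar>\<close> dominates them. The inner integral is
  meaningful only almost everywhere, so all identities between inner integrals are almost sure
  ones.\<close>

lemma
  fixes f :: "'b \<Rightarrow> real"
  assumes N[measurable]: "N \<in> measurable M (subprob_algebra B)"
    and f[measurable]: "f \<in> borel_measurable B" and int: "integrable (M \<bind> N) f"
  shows AE_integrable_bind: "AE x in M. integrable (N x) f"
    and integrable_integral_bind: "integrable M (\<lambda>x. \<integral>y. f y \<partial>N x)"
    and integral_bind_integrable: "(\<integral>y. f y \<partial>(M \<bind> N)) = (\<integral>x. \<integral>y. f y \<partial>N x \<partial>M)"
proof -
  have meas[measurable]: "(\<lambda>x. \<integral>y. f y \<partial>N x) \<in> borel_measurable M"
    by (rule measurable_compose[OF N integral_measurable_subprob_algebra]) simp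
  have mN: "f \<in> borel_measurable (N x)" if "x \<in> space M" for x
    using that by (subst measurable_cong_sets[OF sets_kernel[OF N that] refl]) simp
  have nm[measurable]: "(\<lambda>x. \<integral>\<^sup>+y. ennreal (g y) \<partial>N x) \<in> borel_measurable M"
    if "g \<in> borel_measurable B" for g :: "'b \<Rightarrow> real"
    by (rule measurable_compose[OF N nn_integral_measurable_subprob_algebra]) (use that in simp)
  \<comment> \<open>Stated for every \<open>g\<close> below \<open>\<bar>f\<bar>\<close>, so that it
    covers \<open>f\<close>, \<open>- f\<close> and \<open>\<bar>f\<bar>\<close> at once.\<close>
  have fin: "(\<integral>\<^sup>+x. \<integral>\<^sup>+y. ennreal (g y) \<partial>N x \<partial>M) < \<infinity>"
    if "g \<in> borel_measurable B" "\<And>y. g y \<le> \<bar>f y\<bar>" for g :: "'b \<Rightarrow> real"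
  proof -
    have "(\<integral>\<^sup>+x. \<integral>\<^sup>+y. ennreal (g y) \<partial>N x \<partial>M) = (\<integral>\<^sup>+y. ennreal (g y) \<partial>(M \<bind> N))"
      using that by (subst nn_integral_bind[OF _ N]) auto
    also have "\<dots> \<le> (\<integral>\<^sup>+y. ennreal (norm (f y)) \<partial>(M \<bind> N))"
      using that by (intro nn_integral_mono ennreal_leI) auto
    also have "\<dots> < \<infinity>"
      using int by (simp add: integrable_iff_bounded)
    finally show ?thesis .
  qed
  have AE_fin: "AE x in M. (\<integral>\<^sup>+y. ennreal (g y) \<partial>N x) < \<infinity>"
    if "g \<in> borel_measurable B" "\<And>y. g y \<le> \<bar>f y\<bar>" for g :: "'b \<Rightarrow> real"
    using nn_integral_PInf_AE[OF nm[OF that(1)]] fin[OF that] by (auto simp: less_top)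
  show AE: "AE x in M. integrable (N x) f"
    using AE_fin[of "\<lambda>y. \<bar>f y\<bar>"] by (auto simp: integrable_iff_bounded mN)
  have nn: "(\<integral>\<^sup>+x. ennreal (enn2real (\<integral>\<^sup>+y. ennreal (g y) \<partial>N x)) \<partial>M) = (\<integral>\<^sup>+y. ennreal (g y) \<partial>(M \<bind> N))"
    if "g \<in> borel_measurable B" "\<And>y. g y \<le> \<bar>f y\<bar>" for g :: "'b \<Rightarrow> real"
    using that AE_fin[OF that]
    by (subst nn_integral_bind[OF _ N]) (auto intro!: nn_integral_cong_AE elim!: eventually_mono)
  have I: "integrable M (\<lambda>x. enn2real (\<integral>\<^sup>+y. ennreal (g y) \<partial>N x))"
    and E: "(\<integral>x. enn2real (\<integral>\<^sup>+y. ennreal (g y) \<partial>N x) \<partial>M) = enn2real (\<integral>\<^sup>+y. ennreal (g y) \<partial>(M \<bind> N))"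
    if g: "g \<in> borel_measurable B" "\<And>y. g y \<le> \<bar>f y\<bar>" for g :: "'b \<Rightarrow> real"
  proof -
    have "(\<integral>\<^sup>+y. ennreal (g y) \<partial>(M \<bind> N)) < \<infinity>"
      using fin[OF g] g by (subst nn_integral_bind[OF _ N]) auto
    then show "integrable M (\<lambda>x. enn2real (\<integral>\<^sup>+y. ennreal (g y) \<partial>N x))"
      using g nn[OF g] by (intro integrableI_nonneg) auto
    show "(\<integral>x. enn2real (\<integral>\<^sup>+y. ennreal (g y) \<partial>N x) \<partial>M) = enn2real (\<integral>\<^sup>+y. ennreal (g y) \<partial>(M \<bind> N))"
      using g nn[OF g] by (subst integral_eq_nn_integral) auto
  qed
  have eq: "AE x in M. (\<integral>y. f y \<partial>N x) =
      enn2real (\<integral>\<^sup>+y. ennreal (f y) \<partial>N x) - enn2real (\<integral>\<^sup>+y. ennreal (- f y) \<partial>N x)"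
    using AE by eventually_elim (rule real_lebesgue_integral_def)
  have d: "integrable M (\<lambda>x. enn2real (\<integral>\<^sup>+y. ennreal (f y) \<partial>N x) - enn2real (\<integral>\<^sup>+y. ennreal (- f y) \<partial>N x))"
    by (intro Bochner_Integration.integrable_diff I) auto
  show "integrable M (\<lambda>x. \<integral>y. f y \<partial>N x)"
    using d eq by (subst integrable_cong_AE) (auto intro: borel_measurable_integrable)
  have "(\<integral>x. \<integral>y. f y \<partial>N x \<partial>M) =
      (\<integral>x. enn2real (\<integral>\<^sup>+y. ennreal (f y) \<partial>N x) - enn2real (\<integral>\<^sup>+y. ennreal (- f y) \<partial>N x) \<partial>M)"
    using eq by (intro integral_cong_AE) (auto intro: borel_measurable_integrable d)
  also have "\<dots> = (\<integral>y. f y \<partial>(M \<bind> N))"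
    using int by (subst Bochner_Integration.integral_diff) (auto intro!: I simp: E real_lebesgue_integral_def)
  finally show "(\<integral>y. f y \<partial>(M \<bind> N)) = (\<integral>x. \<integral>y. f y \<partial>N x \<partial>M)" ..
qed

section \<open>Square integrable functions\<close>

lemma L2_measurable: "f \<in> L2 M \<Longrightarrow> f \<in> borel_measurable M"
  and L2_integrable_square: "f \<in> L2 M \<Longrightarrow> integrable M (\<lambda>x. (f x)\<^sup>2)"
  by (auto simp: L2_def)

lemma L2_integrable_mult:
  assumes "f \<in> L2 M" "g \<in> L2 M"
  shows "integrable M (\<lambda>x. f x * g x)"
proof (rule Bochner_Integration.integrable_bound)
  show "integrable M (\<lambda>x. (f x)\<^sup>2 + (g x)\<^sup>2)"
    using assms by (auto simp: L2_def)
  show "(\<lambda>x. f x * g x) \<in> borel_measurable M"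
    using assms by (auto simp: L2_def)
  have "\<bar>a * b\<bar> \<le> a\<^sup>2 + b\<^sup>2" for a b :: real
    using sum_squares_bound[of a b] sum_squares_bound[of a "- b"] sum_power2_ge_zero[of a b] by (auto simp: abs_if)
  then show "AE x in M. norm (f x * g x) \<le> norm ((f x)\<^sup>2 + (g x)\<^sup>2)"
    by simp
qed

lemma L2_add: "f \<in> L2 M \<Longrightarrow> g \<in> L2 M \<Longrightarrow> (\<lambda>x. f x + g x) \<in> L2 M"
  using L2_integrable_mult[of f M g]
  by (auto simp: L2_def power2_sum mult.assoc)

lemma L2_scale: "f \<in> L2 M \<Longrightarrow> (\<lambda>x. c * f x) \<in> L2 M"
  by (auto simp: L2_def power_mult_distrib)

lemma L2_diff: "f \<in> L2 M \<Longrightarrow> g \<in> L2 M \<Longrightarrow> (\<lambda>x. f x - g x) \<in> L2 M"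
  using L2_add[of f M "\<lambda>x. (-1) * g x"] L2_scale[of g M "-1"] by simp

lemma L2_sum: "(\<And>i. i \<in> I \<Longrightarrow> f i \<in> L2 M) \<Longrightarrow> (\<lambda>x. \<Sum>i\<in>I. f i x) \<in> L2 M"
  by (induction I rule: infinite_finite_induct) (simp_all add: L2_add, simp_all add: L2_def)

lemma L2_const: "finite_measure M \<Longrightarrow> (\<lambda>_. c) \<in> L2 M"
  by (simp add: L2_def finite_measure.integrable_const)

lemma L2_integrable: "finite_measure M \<Longrightarrow> f \<in> L2 M \<Longrightarrow> integrable M f"
  using L2_integrable_mult[OF L2_const, of M f 1] by simp

lemma L2_distr:
  assumes "\<phi> \<in> measurable M N" and "f \<in> L2 (distr M N \<phi>)"
  shows "(\<lambda>x. f (\<phi> x)) \<in> L2 M"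
  using assms by (auto simp: L2_def integrable_distr_eq)

lemma power_mult_bounded_tendsto:
  fixes a :: "nat \<Rightarrow> real"
  assumes "0 \<le> r" "r < 1" and "\<And>n. \<bar>a n\<bar> \<le> C"
  shows "(\<lambda>n. r ^ n * a n) \<longlonglongrightarrow> 0"
proof (rule tendsto_0_le[where K = C])
  show "(\<lambda>n. r ^ n) \<longlonglongrightarrow> 0" using assms by (intro LIMSEQ_power_zero) auto
  show "\<forall>\<^sub>F n in sequentially. norm (r ^ n * a n) \<le> norm (r ^ n) * C"
    using assms by (simp add: abs_mult mult_left_mono)
qed

section \<open>The law of two consecutive states and its symmetry\<close>

locale reversible_chain = prob_space \<mu>
  for \<mu> :: "'a measure" +
  fixes H :: "'a \<Rightarrow> 'a measure"
  assumes kernel: "H \<in> measurable \<mu> (prob_algebra \<mu>)"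
    and reversible: "reversible_wrt \<mu> H"
begin

lemma kernel_subprob[measurable]: "H \<in> measurable \<mu> (subprob_algebra \<mu>)"
  by (rule measurable_prob_algebraD[OF kernel])

lemma prob_space_kernel: "x \<in> space \<mu> \<Longrightarrow> prob_space (H x)"
  and sets_H: "x \<in> space \<mu> \<Longrightarrow> sets (H x) = sets \<mu>"
  using measurable_space[OF kernel] by (auto simp: space_prob_algebra)

lemma emeasure_kernel_space[simp]: "x \<in> space \<mu> \<Longrightarrow> emeasure (H x) (space \<mu>) = 1"
  using prob_space.emeasure_space_1[OF prob_space_kernel] sets_eq_imp_space_eq[OF sets_H] by metis

lemma space_kernel[simp]: "x \<in> space \<mu> \<Longrightarrow> space (H x) = space \<mu>"
  by (rule sets_eq_imp_space_eq[OF sets_H])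

definition joint :: "('a \<times> 'a) measure" where
  "joint = \<mu> \<bind> (\<lambda>x. distr (H x) (\<mu> \<Otimes>\<^sub>M \<mu>) (Pair x))"

lemma joint_kernel[measurable]:
  "(\<lambda>x. distr (H x) (\<mu> \<Otimes>\<^sub>M \<mu>) (Pair x)) \<in> measurable \<mu> (prob_algebra (\<mu> \<Otimes>\<^sub>M \<mu>))"
  by (rule measurable_distr_prob_space2[OF kernel]) simp

lemma sets_joint[measurable_cong, simp]: "sets joint = sets (\<mu> \<Otimes>\<^sub>M \<mu>)"
  unfolding joint_def by (rule sets_bind) (auto simp: not_empty)

lemma space_joint: "space joint = space \<mu> \<times> space \<mu>"
  using sets_eq_imp_space_eq[OF sets_joint] by (simp add: space_pair_measure)

lemma nn_integral_joint:
  assumes [measurable]: "F \<in> borel_measurable (\<mu> \<Otimes>\<^sub>M \<mu>)"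
  shows "(\<integral>\<^sup>+z. F z \<partial>joint) = (\<integral>\<^sup>+x. \<integral>\<^sup>+y. F (x, y) \<partial>H x \<partial>\<mu>)"
proof -
  have "(\<integral>\<^sup>+z. F z \<partial>joint) = (\<integral>\<^sup>+x. \<integral>\<^sup>+z. F z \<partial>distr (H x) (\<mu> \<Otimes>\<^sub>M \<mu>) (Pair x) \<partial>\<mu>)"
    unfolding joint_def
    by (rule nn_integral_bind[OF _ measurable_prob_algebraD[OF joint_kernel]]) simp
  also have "\<dots> = (\<integral>\<^sup>+x. \<integral>\<^sup>+y. F (x, y) \<partial>H x \<partial>\<mu>)"
    by (intro nn_integral_cong nn_integral_distr) (auto simp: measurable_cong_sets[OF sets_H refl])
  finally show ?thesis .
qed

lemma emeasure_joint:
  assumes [measurable]: "A \<in> sets \<mu>" "B \<in> sets \<mu>"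
  shows "emeasure joint (A \<times> B) = (\<integral>\<^sup>+x\<in>A. emeasure (H x) B \<partial>\<mu>)"
proof -
  have "emeasure joint (A \<times> B) = (\<integral>\<^sup>+z. indicator (A \<times> B) z \<partial>joint)"
    by simp
  also have "\<dots> = (\<integral>\<^sup>+x. \<integral>\<^sup>+y. indicator (A \<times> B) (x, y) \<partial>H x \<partial>\<mu>)"
    by (rule nn_integral_joint) simp
  also have "\<dots> = (\<integral>\<^sup>+x. \<integral>\<^sup>+y. indicator A x * indicator B y \<partial>H x \<partial>\<mu>)"
    by (simp add: indicator_times)
  also have "\<dots> = (\<integral>\<^sup>+x\<in>A. emeasure (H x) B \<partial>\<mu>)"
    by (intro nn_integral_cong) (simp add: nn_integral_cmult sets_H mult.commute)
  finally show ?thesis .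
qed

text \<open>Reversibility says precisely that the two measures agree on rectangles, and these form
  an intersection-stable generator of the product sigma-algebra.\<close>

lemma joint_swap: "distr joint (\<mu> \<Otimes>\<^sub>M \<mu>) prod.swap = joint"
proof (rule measure_eqI_generator_eq[where E = "{a \<times> b | a b. a \<in> sets \<mu> \<and> b \<in> sets \<mu>}"
      and \<Omega> = "space \<mu> \<times> space \<mu>" and A = "\<lambda>_. space \<mu> \<times> space \<mu>"])
  show "Int_stable {a \<times> b |a b. a \<in> sets \<mu> \<and> b \<in> sets \<mu>}"
    by (rule Int_stable_pair_measure_generator)
  show "{a \<times> b |a b. a \<in> sets \<mu> \<and> b \<in> sets \<mu>} \<subseteq> Pow (space \<mu> \<times> space \<mu>)"
    using sets.space_closed by auto
  have sw: "prod.swap \<in> measurable joint (\<mu> \<Otimes>\<^sub>M \<mu>)"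
    by (simp add: measurable_cong_sets[OF sets_joint refl] prod.swap_def[abs_def])
  have e: "emeasure (distr joint (\<mu> \<Otimes>\<^sub>M \<mu>) prod.swap) (a \<times> b) = emeasure joint (a \<times> b)"
    if [measurable]: "a \<in> sets \<mu>" "b \<in> sets \<mu>" for a b
  proof -
    have "prod.swap -` (a \<times> b) \<inter> space joint = b \<times> a"
      using sets.sets_into_space[OF that(1)] sets.sets_into_space[OF that(2)] by (auto simp: space_joint)
    then show ?thesis
      using reversible that by (simp add: emeasure_distr[OF sw] emeasure_joint reversible_wrt_def)
  qed
  show "emeasure (distr joint (\<mu> \<Otimes>\<^sub>M \<mu>) prod.swap) X = emeasure joint X"
    if "X \<in> {a \<times> b |a b. a \<in> sets \<mu> \<and> b \<in> sets \<mu>}" for X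
    using that e by auto
  have "emeasure joint (space \<mu> \<times> space \<mu>) = (\<integral>\<^sup>+x. 1 \<partial>\<mu>)"
    by (subst emeasure_joint) (auto intro!: nn_integral_cong simp del: nn_integral_const)
  then show "emeasure (distr joint (\<mu> \<Otimes>\<^sub>M \<mu>) prod.swap) (space \<mu> \<times> space \<mu>) \<noteq> \<infinity>" for i :: nat
    by (subst e) (auto simp: emeasure_space_1)
qed (auto simp: sets_pair_measure)

lemma nn_integral_joint_fst:
  assumes [measurable]: "F \<in> borel_measurable \<mu>"
  shows "(\<integral>\<^sup>+z. F (fst z) \<partial>joint) = (\<integral>\<^sup>+x. F x \<partial>\<mu>)"
  by (subst nn_integral_joint)
     (auto intro!: nn_integral_cong)

lemma distr_joint_fst: "distr joint \<mu> fst = \<mu>"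
proof (rule measure_eqI)
  fix A assume [measurable]: "A \<in> sets (distr joint \<mu> fst)"
  have "emeasure (distr joint \<mu> fst) A = (\<integral>\<^sup>+x. indicator A x \<partial>distr joint \<mu> fst)"
    using \<open>A \<in> _\<close> by simp
  also have "\<dots> = (\<integral>\<^sup>+z. indicator A (fst z) \<partial>joint)"
    by (subst nn_integral_distr) auto
  also have "\<dots> = emeasure \<mu> A"
    using \<open>A \<in> _\<close> by (subst nn_integral_joint_fst) auto
  finally show "emeasure (distr joint \<mu> fst) A = emeasure \<mu> A" .
qed simp

lemma distr_joint_snd: "distr joint \<mu> snd = \<mu>"
proof -
  have "distr joint \<mu> snd = distr (distr joint (\<mu> \<Otimes>\<^sub>M \<mu>) prod.swap) \<mu> snd"
    by (simp add: joint_swap)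
  also have "\<dots> = distr joint \<mu> fst"
    by (subst distr_distr) (auto simp: prod.swap_def[abs_def] comp_def)
  finally show ?thesis by (simp add: distr_joint_fst)
qed

text \<open>\<open>\<mu> \<bind> H\<close> is the second marginal of \<open>joint\<close>, which by
  symmetry equals the first, and that is \<open>\<mu>\<close> because every \<open>H x\<close> has
  mass 1.\<close>

lemma stationary: "\<mu> \<bind> H = \<mu>"
proof (rule measure_eqI)
  show s: "sets (\<mu> \<bind> H) = sets \<mu>"
    by (rule sets_bind) (auto simp: sets_H not_empty)
  fix A assume "A \<in> sets (\<mu> \<bind> H)"
  then have A[measurable]: "A \<in> sets \<mu>" by (simp add: s)
  have "emeasure (\<mu> \<bind> H) A = emeasure joint (space \<mu> \<times> A)"
    by (subst emeasure_bind[OF not_empty kernel_subprob A], subst emeasure_joint)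
       (auto intro!: nn_integral_cong)
  also have "\<dots> = emeasure (distr joint \<mu> snd) A"
    using sets.sets_into_space[OF A]
    by (subst emeasure_distr) (auto simp: space_joint intro!: arg_cong[where f = "emeasure joint"])
  finally show "emeasure (\<mu> \<bind> H) A = emeasure \<mu> A" by (simp add: distr_joint_snd)
qed

definition ip :: "('a \<Rightarrow> real) \<Rightarrow> ('a \<Rightarrow> real) \<Rightarrow> real" where
  "ip f g = (\<integral>x. f x * g x \<partial>\<mu>)"

text \<open>Where \<open>f\<close> is not integrable under \<open>H x\<close> the Bochner integral
  takes its default value 0; for \<open>f\<close> in \<open>L2 \<mu>\<close> this happens on a null
  set only.\<close>

definition op_H :: "('a \<Rightarrow> real) \<Rightarrow> 'a \<Rightarrow> real" where
  "op_H f x = (\<integral>y. f y \<partial>H x)"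

text \<open>Positivity of the variance under \<open>H x\<close> bounds the square of the mean by the
  mean of the square; integrating this and using stationarity makes \<open>op_H\<close> a
  contraction.\<close>

lemma L2_op_H:
  assumes f: "f \<in> L2 \<mu>"
  shows "op_H f \<in> L2 \<mu>" and "ip (op_H f) (op_H f) \<le> ip f f"
proof -
  note [measurable] = L2_measurable[OF f]
  have i1: "integrable (\<mu> \<bind> H) f" and i2: "integrable (\<mu> \<bind> H) (\<lambda>x. (f x)\<^sup>2)"
    using L2_integrable[OF finite_measure_axioms f] L2_integrable_square[OF f] by (simp_all add: stationary)
  have m2: "(\<lambda>x. (f x)\<^sup>2) \<in> borel_measurable \<mu>" by simp
  have m[measurable]: "op_H f \<in> borel_measurable \<mu>"
    unfolding op_H_def[abs_def]
    by (rule measurable_compose[OF kernel_subprob integral_measurable_subprob_algebra]) simp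
  have jensen: "AE x in \<mu>. (op_H f x)\<^sup>2 \<le> (\<integral>y. (f y)\<^sup>2 \<partial>H x)"
    using AE_integrable_bind[OF kernel_subprob L2_measurable[OF f] i1]
      AE_integrable_bind[OF kernel_subprob m2 i2] AE_space
  proof eventually_elim
    case (elim x)
    interpret Hx: prob_space "H x" by (rule prob_space_kernel) fact
    have "0 \<le> Hx.variance f" by (rule Hx.variance_positive)
    also have "Hx.variance f = (\<integral>y. (f y)\<^sup>2 \<partial>H x) - (\<integral>y. f y \<partial>H x)\<^sup>2"
      using elim by (intro Hx.variance_eq) auto
    finally show ?case by (simp add: op_H_def)
  qed
  have i3: "integrable \<mu> (\<lambda>x. \<integral>y. (f y)\<^sup>2 \<partial>H x)"
    by (rule integrable_integral_bind[OF kernel_subprob _ i2]) simp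
  have i4: "integrable \<mu> (\<lambda>x. (op_H f x)\<^sup>2)"
    by (rule Bochner_Integration.integrable_bound[OF i3]) (use jensen in \<open>auto elim!: eventually_mono\<close>)
  then show "op_H f \<in> L2 \<mu>" by (simp add: L2_def)
  have "(\<integral>x. (op_H f x)\<^sup>2 \<partial>\<mu>) \<le> (\<integral>x. \<integral>y. (f y)\<^sup>2 \<partial>H x \<partial>\<mu>)"
    by (rule integral_mono_AE[OF i4 i3 jensen])
  also have "\<dots> = (\<integral>x. (f x)\<^sup>2 \<partial>\<mu>)"
    using integral_bind_integrable[OF kernel_subprob _ i2] by (simp add: stationary)
  finally show "ip (op_H f) (op_H f) \<le> ip f f"
    by (simp add: ip_def power2_eq_square)
qed

lemma L2_joint:
  assumes "f \<in> L2 \<mu>"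
  shows "(\<lambda>z. f (fst z)) \<in> L2 joint" and "(\<lambda>z. f (snd z)) \<in> L2 joint"
  using L2_distr[of fst joint \<mu> f] L2_distr[of snd joint \<mu> f] assms
  by (simp_all add: distr_joint_fst distr_joint_snd)

lemma integral_joint:
  assumes f: "f \<in> L2 \<mu>" and g: "g \<in> L2 \<mu>"
  shows "(\<integral>z. f (fst z) * g (snd z) \<partial>joint) = ip f (op_H g)"
proof -
  note [measurable] = L2_measurable[OF f] L2_measurable[OF g]
  have "integrable joint (\<lambda>z. f (fst z) * g (snd z))"
    by (rule L2_integrable_mult[OF L2_joint(1)[OF f] L2_joint(2)[OF g]])
  then have "(\<integral>z. f (fst z) * g (snd z) \<partial>joint) =
      (\<integral>x. \<integral>z. f (fst z) * g (snd z) \<partial>distr (H x) (\<mu> \<Otimes>\<^sub>M \<mu>) (Pair x) \<partial>\<mu>)"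
    unfolding joint_def
    by (intro integral_bind_integrable[OF measurable_prob_algebraD[OF joint_kernel]]) simp_all
  also have "\<dots> = (\<integral>x. f x * op_H g x \<partial>\<mu>)"
    unfolding op_H_def
    by (intro Bochner_Integration.integral_cong refl, subst integral_distr)
       (auto simp: measurable_cong_sets[OF sets_H refl])
  finally show ?thesis by (simp add: ip_def)
qed

lemma ip_commute: "ip f g = ip g f"
  by (simp add: ip_def mult.commute)

text \<open>Self-adjointness is the symmetry of \<open>joint\<close>: both sides integrate the same
  product, with the two coordinates exchanged.\<close>

lemma ip_op_H_commute:
  assumes f: "f \<in> L2 \<mu>" and g: "g \<in> L2 \<mu>"
  shows "ip f (op_H g) = ip (op_H f) g"
proof -
  note [measurable] = L2_measurable[OF f] L2_measurable[OF g]
  have "ip f (op_H g) = (\<integral>z. f (fst z) * g (snd z) \<partial>distr joint (\<mu> \<Otimes>\<^sub>M \<mu>) prod.swap)"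
    using assms by (simp add: joint_swap integral_joint)
  also have "\<dots> = (\<integral>z. g (fst z) * f (snd z) \<partial>joint)"
    by (subst integral_distr) (auto simp: prod.swap_def[abs_def] mult.commute)
  finally show ?thesis using assms by (simp add: integral_joint ip_commute)
qed

text \<open>
  The linearity of \<open>op_H\<close> holds only almost everywhere, so the bilinear form \<open>ip f (op_H g)\<close> is
  expanded through the law of two consecutive states.
\<close>

lemma dirichlet_form:
  assumes f: "f \<in> L2 \<mu>"
  shows "(\<integral>z. (f (fst z) - f (snd z))\<^sup>2 \<partial>joint) = 2 * (ip f f - ip f (op_H f))"
    and "(\<integral>z. (f (fst z) + f (snd z))\<^sup>2 \<partial>joint) = 2 * (ip f f + ip f (op_H f))"
proof -
  note [measurable] = L2_measurable[OF f]
  note L = L2_integrable_square[OF L2_joint(1)[OF f]] L2_integrable_square[OF L2_joint(2)[OF f]]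
    L2_integrable_mult[OF L2_joint(1)[OF f] L2_joint(2)[OF f]]
  have "(\<integral>z. (f (fst z))\<^sup>2 \<partial>joint) = (\<integral>x. (f x)\<^sup>2 \<partial>distr joint \<mu> fst)"
    "(\<integral>z. (f (snd z))\<^sup>2 \<partial>joint) = (\<integral>x. (f x)\<^sup>2 \<partial>distr joint \<mu> snd)"
    by (simp_all add: integral_distr)
  then have s: "(\<integral>z. (f (fst z))\<^sup>2 \<partial>joint) = ip f f" "(\<integral>z. (f (snd z))\<^sup>2 \<partial>joint) = ip f f"
    by (simp_all add: distr_joint_fst distr_joint_snd ip_def power2_eq_square)
  show "(\<integral>z. (f (fst z) - f (snd z))\<^sup>2 \<partial>joint) = 2 * (ip f f - ip f (op_H f))"
    "(\<integral>z. (f (fst z) + f (snd z))\<^sup>2 \<partial>joint) = 2 * (ip f f + ip f (op_H f))"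
    using L by (simp_all add: power2_diff power2_sum mult.assoc s integral_joint f)
qed

text \<open>Both marginals of \<open>joint\<close> are \<open>\<mu>\<close>, so a null set stays
  null in either coordinate. This permits replacing a function of the whole state by an almost
  surely equal function of the parameter.\<close>

lemma dirichlet_cong_AE:
  assumes f: "f \<in> L2 \<mu>" and g: "g \<in> L2 \<mu>" and ae: "AE x in \<mu>. f x = g x"
  shows "ip f f - ip f (op_H f) = ip g g - ip g (op_H g)"
proof -
  note [measurable] = L2_measurable[OF f] L2_measurable[OF g]
  have "AE x in distr joint \<mu> fst. f x = g x" "AE x in distr joint \<mu> snd. f x = g x"
    by (simp_all only: distr_joint_fst distr_joint_snd ae)
  then have "AE z in joint. f (fst z) = g (fst z)" "AE z in joint. f (snd z) = g (snd z)"
    by (auto intro: AE_distrD[of fst joint \<mu> "\<lambda>x. f x = g x"] AE_distrD[of snd joint \<mu> "\<lambda>x. f x = g x"])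
  then have "(\<integral>z. (f (fst z) - f (snd z))\<^sup>2 \<partial>joint) = (\<integral>z. (g (fst z) - g (snd z))\<^sup>2 \<partial>joint)"
    by (intro integral_cong_AE) auto
  then show ?thesis by (simp add: dirichlet_form f g)
qed

text \<open>The bridge to explicit kernels, whose integrals are computed as nonnegative ones so that
  Fubini asks for no integrability.\<close>

lemma nn_integral_dirichlet:
  assumes f: "f \<in> L2 \<mu>"
  shows "(\<integral>\<^sup>+x. \<integral>\<^sup>+y. ennreal ((f x - f y)\<^sup>2) \<partial>H x \<partial>\<mu>) = ennreal (2 * (ip f f - ip f (op_H f)))"
proof -
  note [measurable] = L2_measurable[OF f]
  have "(\<integral>\<^sup>+x. \<integral>\<^sup>+y. ennreal ((f x - f y)\<^sup>2) \<partial>H x \<partial>\<mu>) = (\<integral>\<^sup>+z. ennreal ((f (fst z) - f (snd z))\<^sup>2) \<partial>joint)"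
    by (subst nn_integral_joint) auto
  also have "\<dots> = ennreal (\<integral>z. (f (fst z) - f (snd z))\<^sup>2 \<partial>joint)"
    by (intro nn_integral_eq_integral L2_integrable_square L2_diff L2_joint f) simp
  finally show ?thesis by (simp add: dirichlet_form f)
qed

lemma ip_op_H_bounds:
  assumes f: "f \<in> L2 \<mu>"
  shows "ip f (op_H f) \<le> ip f f" and "- ip f f \<le> ip f (op_H f)"
proof -
  have "0 \<le> (\<integral>z. (f (fst z) - f (snd z))\<^sup>2 \<partial>joint)" "0 \<le> (\<integral>z. (f (fst z) + f (snd z))\<^sup>2 \<partial>joint)"
    by (simp_all add: integral_nonneg_AE)
  then show "ip f (op_H f) \<le> ip f f" and "- ip f f \<le> ip f (op_H f)"
    unfolding dirichlet_form[OF f] by simp_all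
qed

lemma ip_self_nonneg: "0 \<le> ip f f"
  by (simp add: ip_def)

lemma ip_diff_left:
  assumes "f \<in> L2 \<mu>" "g \<in> L2 \<mu>" "h \<in> L2 \<mu>"
  shows "ip (\<lambda>x. f x - g x) h = ip f h - ip g h"
  using assms by (simp add: ip_def left_diff_distrib L2_integrable_mult)

lemma ip_scale_left: "ip (\<lambda>x. c * f x) h = c * ip f h"
  by (simp add: ip_def mult.assoc)

lemma ip_scale_right: "ip f (\<lambda>x. c * h x) = c * ip f h"
  by (simp add: ip_def mult.left_commute)

lemma ip_sum_left:
  assumes "\<And>i. i \<in> I \<Longrightarrow> f i \<in> L2 \<mu>" "h \<in> L2 \<mu>"
  shows "ip (\<lambda>x. \<Sum>i\<in>I. f i x) h = (\<Sum>i\<in>I. ip (f i) h)"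
  using assms by (simp add: ip_def sum_distrib_right L2_integrable_mult)

text \<open>A crude form of Cauchy-Schwarz; it serves to bound \<open>ip (iter f n) u\<close>
  uniformly in \<open>n\<close>.\<close>

lemma ip_bound:
  assumes "f \<in> L2 \<mu>" "g \<in> L2 \<mu>"
  shows "\<bar>ip f g\<bar> \<le> ip f f + ip g g"
proof -
  have "\<bar>ip f g\<bar> \<le> (\<integral>x. \<bar>f x * g x\<bar> \<partial>\<mu>)"
    unfolding ip_def by (rule integral_abs_bound)
  also have "\<dots> \<le> (\<integral>x. f x * f x + g x * g x \<partial>\<mu>)"
  proof (rule integral_mono)
    fix x
    show "\<bar>f x * g x\<bar> \<le> f x * f x + g x * g x"
      using sum_squares_bound[of "f x" "g x"] sum_squares_bound[of "f x" "- g x"] sum_power2_ge_zero[of "f x" "g x"]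
      by (auto simp: abs_if power2_eq_square)
  qed (use assms in \<open>auto intro!: L2_integrable_mult integrable_abs\<close>)
  also have "\<dots> = ip f f + ip g g"
    using assms by (simp add: ip_def L2_integrable_mult)
  finally show ?thesis .
qed

section \<open>Autocovariances and the truncated Neumann series\<close>

definition iter :: "('a \<Rightarrow> real) \<Rightarrow> nat \<Rightarrow> 'a \<Rightarrow> real" where
  "iter f k = (op_H ^^ k) f"

definition autocov :: "('a \<Rightarrow> real) \<Rightarrow> nat \<Rightarrow> real" where
  "autocov f k = ip f (iter f k)"

lemma iter_0[simp]: "iter f 0 = f"
  and iter_Suc: "iter f (Suc k) = op_H (iter f k)"
  and iter_Suc': "iter f (Suc k) = iter (op_H f) k"
  by (simp_all add: iter_def funpow_swap1)

lemma L2_iter: "f \<in> L2 \<mu> \<Longrightarrow> iter f k \<in> L2 \<mu>"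
  by (induction k) (simp_all add: iter_Suc L2_op_H)

text \<open>Self-adjointness moves the applications of \<open>op_H\<close> across one at a time, so
  only their total number counts.\<close>

lemma ip_iter:
  assumes f: "f \<in> L2 \<mu>"
  shows "ip (iter f i) (iter f j) = autocov f (i + j)"
proof (induction i arbitrary: j)
  case (Suc i)
  have "ip (iter f (Suc i)) (iter f j) = ip (iter f i) (iter f (Suc j))"
    by (simp add: iter_Suc ip_op_H_commute L2_iter f)
  then show ?case using Suc.IH by simp
qed (simp add: autocov_def)

lemma reversible_autocovariance_autocov:
  assumes f: "f \<in> L2 \<mu>"
  shows "reversible_autocovariance (autocov f)"
proof
  fix k
  have e: "autocov f (2 * k) = ip (iter f k) (iter f k)"
    by (simp add: ip_iter[OF f] mult_2)
  have o: "autocov f (2 * k + 1) = ip (iter f k) (op_H (iter f k))"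
    by (simp add: ip_iter[OF f] mult_2 flip: iter_Suc)
  show "0 \<le> autocov f (2 * k)" unfolding e by (rule ip_self_nonneg)
  have "autocov f (2 * Suc k) = ip (op_H (iter f k)) (op_H (iter f k))"
    by (simp add: ip_iter[OF f] mult_2 flip: iter_Suc)
  then show "autocov f (2 * Suc k) \<le> autocov f (2 * k)"
    unfolding e by (simp add: L2_op_H L2_iter f)
  show "0 \<le> autocov f (2 * k) + autocov f (2 * k + 1)" "\<bar>autocov f (2 * k + 1)\<bar> \<le> autocov f (2 * k)"
    unfolding e o using ip_op_H_bounds[OF L2_iter[OF f, of k]] by (auto simp: abs_le_iff)
qed

definition resolvent :: "('a \<Rightarrow> real) \<Rightarrow> real \<Rightarrow> nat \<Rightarrow> 'a \<Rightarrow> real" where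
  "resolvent f r n x = (\<Sum>k<n. r ^ k * iter f k x)"

lemma L2_resolvent: "f \<in> L2 \<mu> \<Longrightarrow> resolvent f r n \<in> L2 \<mu>"
  unfolding resolvent_def[abs_def] by (intro L2_sum L2_scale L2_iter)

lemma ip_resolvent:
  assumes "f \<in> L2 \<mu>" "g \<in> L2 \<mu>"
  shows "ip (resolvent f r n) g = (\<Sum>k<n. r ^ k * ip (iter f k) g)"
  unfolding resolvent_def[abs_def] using assms
  by (subst ip_sum_left) (auto intro!: L2_scale L2_iter simp: ip_scale_left)

text \<open>The weak form of \<open>(1 - r H) w = f - r^n H^n f\<close>. It is tested against
  \<open>g\<close>, with \<open>op_H\<close> moved to the other side by self-adjointness, so that
  the series telescopes without linearity of \<open>op_H\<close>.\<close>

lemma resolvent_equation: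
  assumes f: "f \<in> L2 \<mu>" and g: "g \<in> L2 \<mu>"
  shows "ip (resolvent f r n) g - r * ip (resolvent f r n) (op_H g) = ip f g - r ^ n * ip (iter f n) g"
proof -
  have "ip (iter f k) (op_H g) = ip (iter f (Suc k)) g" for k
    using assms by (simp add: iter_Suc ip_op_H_commute L2_iter)
  then have "ip (resolvent f r n) g - r * ip (resolvent f r n) (op_H g) =
      (\<Sum>k<n. r ^ k * ip (iter f k) g - r ^ Suc k * ip (iter f (Suc k)) g)"
    using assms by (simp add: ip_resolvent L2_op_H sum_subtractf sum_distrib_left mult.assoc)
  also have "\<dots> = ip f g - r ^ n * ip (iter f n) g"
    using sum_lessThan_telescope'[of "\<lambda>k. r ^ k * ip (iter f k) g" n] by simp
  finally show ?thesis .
qed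

text \<open>Uniformity in both \<open>n\<close> and \<open>j\<close> matters, because the bound is
  applied along \<open>j = n\<close>, where a factor \<open>r^n\<close> then sends the remainder to
  0.\<close>

lemma ip_resolvent_iter_bound:
  assumes f: "f \<in> L2 \<mu>" and r: "0 \<le> r" "r < 1"
  shows "\<bar>ip (resolvent f r n) (iter f j)\<bar> \<le> autocov f 0 * (1 / (1 - r))"
proof -
  interpret reversible_autocovariance "autocov f"
    by (rule reversible_autocovariance_autocov[OF f])
  have "\<bar>ip (resolvent f r n) (iter f j)\<bar> \<le> (\<Sum>k<n. \<bar>r ^ k * autocov f (k + j)\<bar>)"
    using sum_abs[of "\<lambda>k. r ^ k * autocov f (k + j)" "{..<n}"]
    by (simp add: ip_resolvent L2_iter f ip_iter)
  also have "\<dots> \<le> (\<Sum>k<n. autocov f 0 * r ^ k)"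
    using r abs_le by (intro sum_mono) (simp add: abs_mult mult.commute[of "autocov f 0"] mult_left_mono)
  also have "\<dots> \<le> (\<Sum>k. autocov f 0 * r ^ k)"
    using r even_nonneg[of 0] by (intro sum_le_suminf summable_mult summable_geometric) auto
  also have "\<dots> = autocov f 0 * (1 / (1 - r))"
    using r by (subst suminf_mult) (auto simp: suminf_geometric summable_geometric)
  finally show ?thesis .
qed

lemma autocov_sums:
  assumes f: "f \<in> L2 \<mu>" and r: "0 \<le> r" "r < 1"
  shows "(\<lambda>k. autocov f k * r ^ k) sums (\<Sum>k. autocov f k * r ^ k)"
  using reversible_autocovariance.summable_abs[OF reversible_autocovariance_autocov[OF f] r]
  by (rule summable_sums[OF summable_rabs_cancel])

text \<open>The first limit is the definition of the Abel sum. The second follows by testing the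
  resolvent equation against the truncated resolvent itself, whose energy is then
  \<open>\<langle>f, w\<rangle>\<close> up to a vanishing remainder.\<close>

lemma
  assumes f: "f \<in> L2 \<mu>" and r: "0 \<le> r" "r < 1"
  shows tendsto_ip_resolvent:
      "(\<lambda>n. ip f (resolvent f r n)) \<longlonglongrightarrow> (\<Sum>k. autocov f k * r ^ k)" (is "?A \<longlonglongrightarrow> _")
    and tendsto_resolvent_energy:
      "(\<lambda>n. ip (resolvent f r n) (resolvent f r n) - r * ip (resolvent f r n) (op_H (resolvent f r n)))
        \<longlonglongrightarrow> (\<Sum>k. autocov f k * r ^ k)"
proof -
  have "?A n = (\<Sum>k<n. autocov f k * r ^ k)" for n
    using f by (simp add: ip_commute[of f] ip_resolvent autocov_def mult.commute)
  then show A: "?A \<longlonglongrightarrow> (\<Sum>k. autocov f k * r ^ k)"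
    using autocov_sums[OF assms] by (simp add: sums_def)
  have "(\<lambda>n. r ^ n * ip (resolvent f r n) (iter f n)) \<longlonglongrightarrow> 0"
    by (rule power_mult_bounded_tendsto[OF r ip_resolvent_iter_bound[OF assms]])
  from tendsto_diff[OF A this]
  show "(\<lambda>n. ip (resolvent f r n) (resolvent f r n) - r * ip (resolvent f r n) (op_H (resolvent f r n)))
        \<longlonglongrightarrow> (\<Sum>k. autocov f k * r ^ k)"
    using f by (simp add: resolvent_equation L2_resolvent ip_commute[of "iter f _"])
qed

text \<open>
  The Abel sum is the supremum over \<open>u\<close> of \<open>2 \<langle>f, u\<rangle> - \<langle>u, (1 - r H) u\<rangle>\<close>, attained
  at the resolvent. Truncated resolvent series replace the resolvent, so no completeness is needed.
\<close>

lemma abel_variational: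
  assumes f: "f \<in> L2 \<mu>" and u: "u \<in> L2 \<mu>" and r: "0 \<le> r" "r < 1"
  shows "2 * ip f u - (ip u u - r * ip u (op_H u)) \<le> (\<Sum>k. autocov f k * r ^ k)"
proof -
  define E where "E g = ip g g - r * ip g (op_H g)" for g
  have E_nonneg: "0 \<le> E g" if "g \<in> L2 \<mu>" for g
  proof -
    have "r * ip g (op_H g) \<le> r * ip g g"
      using ip_op_H_bounds[OF that] r by (intro mult_left_mono) auto
    also have "\<dots> \<le> 1 * ip g g"
      using r ip_self_nonneg[of g] by (intro mult_right_mono) auto
    finally show ?thesis by (simp add: E_def)
  qed
  \<comment> \<open>This is \<open>0 \<le> E (w - u)\<close> expanded at the truncated resolvent
    \<open>w\<close>; the resolvent equation evaluates the cross term.\<close>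
  have lower: "2 * (ip f u - r ^ n * ip (iter f n) u) - E u \<le> E (resolvent f r n)" for n
  proof -
    let ?w = "resolvent f r n"
    let ?d = "\<lambda>x. ?w x - u x"
    have w: "?w \<in> L2 \<mu>" by (rule L2_resolvent[OF f])
    have d: "?d \<in> L2 \<mu>" by (rule L2_diff[OF w u])
    have c: "ip g (op_H h) = ip h (op_H g)" if "g \<in> L2 \<mu>" "h \<in> L2 \<mu>" for g h
      using that ip_op_H_commute ip_commute by metis
    have dl: "ip ?d h = ip ?w h - ip u h" if "h \<in> L2 \<mu>" for h
      by (rule ip_diff_left[OF w u that])
    have d1: "ip ?d ?d = ip ?w ?w - 2 * ip ?w u + ip u u"
      using dl[OF d] dl[OF w] dl[OF u] ip_commute[of ?w ?d] ip_commute[of u ?d] ip_commute[of u ?w] by simp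
    \<comment> \<open>\<open>op_H\<close> of a difference is never expanded: symmetry brings each
      difference into the left argument of \<open>ip\<close>, where linearity is available.\<close>
    have d2: "ip ?d (op_H ?d) = ip ?w (op_H ?w) - 2 * ip ?w (op_H u) + ip u (op_H u)"
      using dl[OF L2_op_H(1)[OF d]] dl[OF L2_op_H(1)[OF w]] dl[OF L2_op_H(1)[OF u]]
        c[OF w d] c[OF u d] c[OF u w] by simp
    have "E ?d = E ?w - 2 * (ip ?w u - r * ip ?w (op_H u)) + E u"
      unfolding E_def d1 d2 by (simp add: algebra_simps)
    then show ?thesis
      using E_nonneg[OF d] resolvent_equation[OF f u, of r n] by simp
  qed
  have "(\<lambda>n. r ^ n * ip (iter f n) u) \<longlonglongrightarrow> 0"
  proof (rule power_mult_bounded_tendsto[OF r])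
    interpret reversible_autocovariance "autocov f"
      by (rule reversible_autocovariance_autocov[OF f])
    show "\<bar>ip (iter f n) u\<bar> \<le> autocov f 0 + ip u u" for n
      using ip_bound[OF L2_iter[OF f, of n] u] abs_le[of "n + n"] by (simp add: ip_iter[OF f])
  qed
  then have "(\<lambda>n. 2 * (ip f u - r ^ n * ip (iter f n) u) - E u) \<longlonglongrightarrow> 2 * (ip f u - 0) - E u"
    by (intro tendsto_intros)
  from LIMSEQ_le[OF this tendsto_resolvent_energy[OF f r]]
  show ?thesis using lower unfolding E_def by auto
qed

section \<open>Covariances along the trajectory\<close>

sublocale IT: Ionescu_Tulcea "chain_step \<mu> H" "\<lambda>_. \<mu>"
  by (rule Ionescu_Tulcea_chain_step[OF prob_space_axioms kernel])

abbreviation W :: "(nat \<Rightarrow> 'a) measure" where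
  "W \<equiv> chain_law \<mu> H"

lemma sets_chain_law[measurable_cong, simp]: "sets W = sets (PiM UNIV (\<lambda>_. \<mu>))"
  unfolding chain_law_def by (rule IT.PF.sets_lim)

text \<open>The trajectory law is a projective limit; on an initial segment it is the finite
  composition of kernels, which suffices for functions of finitely many coordinates.\<close>

lemma chain_law_prefix:
  "distr W (PiM {0..<n} (\<lambda>_. \<mu>)) (\<lambda>\<omega>. restrict \<omega> {0..<n}) = IT.C 0 n (\<lambda>_. undefined)"
proof -
  have "IT.up_to {0..<n} = n"
    using IT.up_to_less[of "{0..<n}" "IT.up_to {0..<n}"] IT.up_to_iff[of "{0..<n}" n] by force
  then show ?thesis
    using IT.distr_lim[of "{0..<n}"] IT.distr_C[of n n "\<lambda>_. undefined" 0]
    by (simp add: chain_law_def IT.CI_def)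
qed

lemma nn_integral_chain_law:
  assumes [measurable]: "F \<in> borel_measurable (PiM {0..<n} (\<lambda>_. \<mu>))"
    and F: "\<And>\<omega>. F (restrict \<omega> {0..<n}) = F \<omega>"
  shows "(\<integral>\<^sup>+\<omega>. F \<omega> \<partial>W) = (\<integral>\<^sup>+\<omega>. F \<omega> \<partial>IT.C 0 n (\<lambda>_. undefined))"
  unfolding chain_law_prefix[symmetric]
  by (subst nn_integral_distr) (auto simp: F intro!: measurable_restrict)

lemma prob_space_chain_law: "prob_space W"
proof (rule prob_space_distrD)
  show "(\<lambda>\<omega>. restrict \<omega> {0..<1::nat}) \<in> measurable W (PiM {0..<1} (\<lambda>_. \<mu>))"
    by (simp add: measurable_cong_sets[OF sets_chain_law refl])
  show "prob_space (distr W (PiM {0..<1} (\<lambda>_. \<mu>)) (\<lambda>\<omega>. restrict \<omega> {0..<1::nat}))"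
    unfolding chain_law_prefix by (rule IT.prob_space_C) simp
qed

lemma component_measurable[measurable]: "(\<lambda>\<omega>. \<omega> n) \<in> measurable W \<mu>"
  by (simp add: measurable_cong_sets[OF sets_chain_law refl])

text \<open>The Markov property: given the first \<open>Suc n\<close> coordinates, the next is drawn
  from \<open>H (\<omega> n)\<close>. An earlier time \<open>i\<close> is carried along because
  covariances at any lag are reached one step at a time.\<close>

lemma nn_integral_chain_step:
  assumes F[measurable]: "F \<in> borel_measurable (\<mu> \<Otimes>\<^sub>M \<mu>)" and "i \<le> n"
  shows "(\<integral>\<^sup>+\<omega>. F (\<omega> i, \<omega> (Suc n)) \<partial>W) = (\<integral>\<^sup>+\<omega>. \<integral>\<^sup>+y. F (\<omega> i, y) \<partial>H (\<omega> n) \<partial>W)"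
proof -
  let ?P = "\<lambda>n::nat. PiM {0..<n} (\<lambda>_. \<mu>)"
  have [measurable]: "(\<lambda>\<omega>. \<omega> i) \<in> measurable (?P (Suc (Suc n))) \<mu>" "(\<lambda>\<omega>. \<omega> (Suc n)) \<in> measurable (?P (Suc (Suc n))) \<mu>"
    "(\<lambda>\<omega>. \<omega> i) \<in> measurable (?P (Suc n)) \<mu>"
    using \<open>i \<le> n\<close> by (auto intro!: measurable_component_singleton)
  have m: "(\<lambda>\<omega>. F (\<omega> i, \<omega> (Suc n))) \<in> borel_measurable (?P (Suc (Suc n)))"
    by measurable
  have "(\<lambda>\<omega>. \<omega> n) \<in> measurable (?P (Suc n)) \<mu>"
    by (auto intro!: measurable_component_singleton)
  then have Hn: "(\<lambda>\<omega>. H (\<omega> n)) \<in> measurable (?P (Suc n)) (subprob_algebra \<mu>)"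
    by (rule measurable_compose[OF _ kernel_subprob])
  have m': "(\<lambda>\<omega>. \<integral>\<^sup>+y. F (\<omega> i, y) \<partial>H (\<omega> n)) \<in> borel_measurable (?P (Suc n))"
    by (rule nn_integral_measurable_subprob_algebra2[OF _ Hn]) measurable
  have "(\<integral>\<^sup>+\<omega>. F (\<omega> i, \<omega> (Suc n)) \<partial>W) =
      (\<integral>\<^sup>+\<omega>. F (\<omega> i, \<omega> (Suc n)) \<partial>IT.C 0 (Suc (Suc n)) (\<lambda>_. undefined))"
    using \<open>i \<le> n\<close> by (intro nn_integral_chain_law m) auto
  also have "\<dots> = (\<integral>\<^sup>+\<omega>. \<integral>\<^sup>+\<omega>. F (\<omega> i, \<omega> (Suc n)) \<partial>IT.eP (Suc n) \<omega> \<partial>IT.C 0 (Suc n) (\<lambda>_. undefined))"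
    unfolding IT.C.simps(2)[of 0 "Suc n"] add_0
    using IT.measurable_eP[of "Suc n"]
    by (intro nn_integral_bind[OF m]) (simp add: measurable_cong_sets[OF IT.sets_C refl] del: IT.C.simps)
  also have "\<dots> = (\<integral>\<^sup>+\<omega>. \<integral>\<^sup>+y. F (\<omega> i, y) \<partial>H (\<omega> n) \<partial>IT.C 0 (Suc n) (\<lambda>_. undefined))"
    using \<open>i \<le> n\<close>
    by (intro nn_integral_cong, subst IT.nn_integral_eP)
       (auto simp: IT.space_C m chain_step_def simp del: IT.C.simps)
  also have "\<dots> = (\<integral>\<^sup>+\<omega>. \<integral>\<^sup>+y. F (\<omega> i, y) \<partial>H (\<omega> n) \<partial>W)"
    using \<open>i \<le> n\<close> by (intro nn_integral_chain_law[symmetric] m') auto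
  finally show ?thesis .
qed

lemma distr_component: "distr W \<mu> (\<lambda>\<omega>. \<omega> n) = \<mu>"
proof (induction n)
  case 0
  have m: "(\<lambda>\<omega>. F (\<omega> 0)) \<in> borel_measurable (PiM {0..<Suc 0} (\<lambda>_. \<mu>))"
    if "F \<in> borel_measurable \<mu>" for F :: "'a \<Rightarrow> ennreal"
    by (rule measurable_compose[where f = "\<lambda>\<omega>. \<omega> 0", OF _ that]) (auto intro!: measurable_component_singleton)
  show ?case
  proof (rule measure_eqI)
    fix A assume "A \<in> sets (distr W \<mu> (\<lambda>\<omega>. \<omega> 0))"
    then have [measurable]: "A \<in> sets \<mu>" by simp
    have "emeasure (distr W \<mu> (\<lambda>\<omega>. \<omega> 0)) A = (\<integral>\<^sup>+x. indicator A x \<partial>distr W \<mu> (\<lambda>\<omega>. \<omega> 0))"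
      by simp
    also have "\<dots> = (\<integral>\<^sup>+\<omega>. indicator A (\<omega> 0) \<partial>W)"
      by (subst nn_integral_distr) auto
    also have "\<dots> = (\<integral>\<^sup>+\<omega>. indicator A (\<omega> 0) \<partial>IT.C 0 (Suc 0) (\<lambda>_. undefined))"
      by (intro nn_integral_chain_law m) auto
    also have "\<dots> = (\<integral>\<^sup>+\<omega>. indicator A (\<omega> 0) \<partial>IT.eP 0 (\<lambda>_. undefined))"
      using IT.measurable_eP[of 0] by (simp add: bind_return space_PiM)
    also have "\<dots> = (\<integral>\<^sup>+x. indicator A x \<partial>\<mu>)"
      by (subst IT.nn_integral_eP) (auto simp: m chain_step_def space_PiM)
    finally show "emeasure (distr W \<mu> (\<lambda>\<omega>. \<omega> 0)) A = emeasure \<mu> A" by simp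
  qed simp
next
  case (Suc n)
  show ?case
  proof (rule measure_eqI)
    fix A assume "A \<in> sets (distr W \<mu> (\<lambda>\<omega>. \<omega> (Suc n)))"
    then have A[measurable]: "A \<in> sets \<mu>" by simp
    have "emeasure (distr W \<mu> (\<lambda>\<omega>. \<omega> (Suc n))) A = (\<integral>\<^sup>+x. indicator A x \<partial>distr W \<mu> (\<lambda>\<omega>. \<omega> (Suc n)))"
      by simp
    also have "\<dots> = (\<integral>\<^sup>+\<omega>. indicator A (snd (\<omega> n, \<omega> (Suc n))) \<partial>W)"
      by (subst nn_integral_distr) auto
    also have "\<dots> = (\<integral>\<^sup>+\<omega>. \<integral>\<^sup>+y. indicator A (snd (\<omega> n, y)) \<partial>H (\<omega> n) \<partial>W)"
      by (rule nn_integral_chain_step[where F = "\<lambda>z. indicator A (snd z)"]) auto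
    also have "\<dots> = (\<integral>\<^sup>+x. \<integral>\<^sup>+y. indicator A y \<partial>H x \<partial>distr W \<mu> (\<lambda>\<omega>. \<omega> n))"
      by (subst nn_integral_distr)
         (auto intro!: measurable_compose[OF kernel_subprob nn_integral_measurable_subprob_algebra])
    also have "\<dots> = (\<integral>\<^sup>+x. indicator A x \<partial>(\<mu> \<bind> H))"
      unfolding Suc.IH by (rule nn_integral_bind[OF _ kernel_subprob, symmetric]) simp
    finally show "emeasure (distr W \<mu> (\<lambda>\<omega>. \<omega> (Suc n))) A = emeasure \<mu> A"
      by (simp add: stationary)
  qed simp
qed

lemma L2_component: "f \<in> L2 \<mu> \<Longrightarrow> (\<lambda>\<omega>. f (\<omega> i)) \<in> L2 W"
  using L2_distr[OF component_measurable[of i], of f] by (simp add: distr_component)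

lemma pair_kernel_measurable:
  "(\<lambda>\<omega>. distr (H (\<omega> n)) (\<mu> \<Otimes>\<^sub>M \<mu>) (Pair (\<omega> i))) \<in> measurable W (subprob_algebra (\<mu> \<Otimes>\<^sub>M \<mu>))"
  by (rule measurable_prob_algebraD, rule measurable_distr_prob_space2[where M = \<mu>])
     (auto intro: measurable_compose[OF component_measurable kernel])

text \<open>The Markov property as an identity of measures, so that it also applies to integrands of
  changing sign.\<close>

lemma chain_law_pair:
  assumes "i \<le> n"
  shows "distr W (\<mu> \<Otimes>\<^sub>M \<mu>) (\<lambda>\<omega>. (\<omega> i, \<omega> (Suc n))) =
    W \<bind> (\<lambda>\<omega>. distr (H (\<omega> n)) (\<mu> \<Otimes>\<^sub>M \<mu>) (Pair (\<omega> i)))" (is "?L = ?R")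
proof (rule measure_eqI)
  interpret W: prob_space W by (rule prob_space_chain_law)
  show s: "sets ?L = sets ?R"
    by (subst sets_bind[where N = "\<mu> \<Otimes>\<^sub>M \<mu>"]) (auto simp: W.not_empty)
  fix A assume "A \<in> sets ?L"
  then have [measurable]: "A \<in> sets (\<mu> \<Otimes>\<^sub>M \<mu>)" by simp
  have "emeasure ?L A = (\<integral>\<^sup>+z. indicator A z \<partial>?L)" by simp
  also have "\<dots> = (\<integral>\<^sup>+\<omega>. indicator A (\<omega> i, \<omega> (Suc n)) \<partial>W)"
    by (subst nn_integral_distr) auto
  also have "\<dots> = (\<integral>\<^sup>+\<omega>. \<integral>\<^sup>+y. indicator A (\<omega> i, y) \<partial>H (\<omega> n) \<partial>W)"
    by (rule nn_integral_chain_step) (auto simp: assms)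
  also have "\<dots> = (\<integral>\<^sup>+\<omega>. \<integral>\<^sup>+z. indicator A z \<partial>distr (H (\<omega> n)) (\<mu> \<Otimes>\<^sub>M \<mu>) (Pair (\<omega> i)) \<partial>W)"
  proof (intro nn_integral_cong, subst nn_integral_distr)
    fix \<omega> assume "\<omega> \<in> space W"
    then have "\<omega> i \<in> space \<mu>" "\<omega> n \<in> space \<mu>"
      using measurable_space[OF component_measurable \<open>\<omega> \<in> space W\<close>] by simp_all
    then show "Pair (\<omega> i) \<in> measurable (H (\<omega> n)) (\<mu> \<Otimes>\<^sub>M \<mu>)"
      by (simp add: measurable_cong_sets[OF sets_H refl])
  qed auto
  also have "\<dots> = (\<integral>\<^sup>+z. indicator A z \<partial>?R)"
    by (rule nn_integral_bind[OF _ pair_kernel_measurable, symmetric]) simp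
  also have "\<dots> = emeasure ?R A"
    by (rule nn_integral_indicator) (use \<open>A \<in> sets ?L\<close> in \<open>simp only: s\<close>)
  finally show "emeasure ?L A = emeasure ?R A" .
qed

text \<open>Integrating out the last transition replaces \<open>g\<close> by \<open>op_H g\<close>
  and shortens the lag by one, hence the induction for arbitrary \<open>g\<close>.\<close>

lemma chain_covariance:
  assumes f: "f \<in> L2 \<mu>" and g: "g \<in> L2 \<mu>"
  shows "(\<integral>\<omega>. f (\<omega> i) * g (\<omega> (i + k)) \<partial>W) = ip f (iter g k)"
  using g
proof (induction k arbitrary: g)
  case 0
  note [measurable] = L2_measurable[OF f] L2_measurable[OF 0]
  have "(\<integral>\<omega>. f (\<omega> i) * g (\<omega> i) \<partial>W) = (\<integral>x. f x * g x \<partial>distr W \<mu> (\<lambda>\<omega>. \<omega> i))"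
    by (simp add: integral_distr)
  then show ?case by (simp add: distr_component ip_def)
next
  case (Suc k)
  note [measurable] = L2_measurable[OF f] L2_measurable[OF Suc.prems]
  let ?F = "\<lambda>z. f (fst z) * g (snd z)"
  have int: "integrable (distr W (\<mu> \<Otimes>\<^sub>M \<mu>) (\<lambda>\<omega>. (\<omega> i, \<omega> (Suc (i + k))))) ?F"
    using L2_integrable_mult[OF L2_component[OF f, of i] L2_component[OF Suc.prems, of "Suc (i + k)"]]
    by (simp add: integrable_distr_eq)
  have "(\<integral>\<omega>. f (\<omega> i) * g (\<omega> (i + Suc k)) \<partial>W) =
      (\<integral>z. ?F z \<partial>distr W (\<mu> \<Otimes>\<^sub>M \<mu>) (\<lambda>\<omega>. (\<omega> i, \<omega> (Suc (i + k)))))"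
    by (simp add: integral_distr)
  also have "\<dots> = (\<integral>\<omega>. \<integral>z. ?F z \<partial>distr (H (\<omega> (i + k))) (\<mu> \<Otimes>\<^sub>M \<mu>) (Pair (\<omega> i)) \<partial>W)"
    using int unfolding chain_law_pair[OF le_add1]
    by (intro integral_bind_integrable[OF pair_kernel_measurable]) simp_all
  also have "\<dots> = (\<integral>\<omega>. f (\<omega> i) * op_H g (\<omega> (i + k)) \<partial>W)"
  proof (intro Bochner_Integration.integral_cong refl, subst integral_distr)
    fix \<omega> assume "\<omega> \<in> space W"
    then have "\<omega> i \<in> space \<mu>" "\<omega> (i + k) \<in> space \<mu>"
      using measurable_space[OF component_measurable \<open>\<omega> \<in> space W\<close>] by simp_all
    then show "Pair (\<omega> i) \<in> measurable (H (\<omega> (i + k))) (\<mu> \<Otimes>\<^sub>M \<mu>)"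
      by (simp add: measurable_cong_sets[OF sets_H refl])
  qed (auto simp: op_H_def)
  also have "\<dots> = ip f (iter g (Suc k))"
    using Suc.IH[OF L2_op_H(1)[OF Suc.prems]] by (simp add: iter_Suc')
  finally show ?case .
qed

lemma variance_chain_average:
  assumes f: "f \<in> L2 \<mu>"
  shows "real n * prob_space.variance W (chain_average f n) =
    double_sum (autocov (\<lambda>x. f x - expectation f)) n / real n"
proof (cases "n = 0")
  case False
  interpret W: prob_space W by (rule prob_space_chain_law)
  note [measurable] = L2_measurable[OF f]
  let ?g = "\<lambda>x. f x - expectation f"
  have g: "?g \<in> L2 \<mu>"
    by (intro L2_diff f L2_const finite_measure_axioms)
  have "W.expectation (\<lambda>\<omega>. f (\<omega> i)) = integral\<^sup>L (distr W \<mu> (\<lambda>\<omega>. \<omega> i)) f" for i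
    by (simp add: integral_distr)
  then have e: "W.expectation (\<lambda>\<omega>. f (\<omega> i)) = expectation f" for i
    by (simp add: distr_component)
  have "W.expectation (chain_average f n) = expectation f"
    unfolding chain_average_def using False
    by (simp add: e L2_integrable[OF W.finite_measure_axioms L2_component[OF f]])
  then have "chain_average f n \<omega> - W.expectation (chain_average f n) = (1 / real n) * (\<Sum>i<n. ?g (\<omega> i))" for \<omega>
    using False by (simp add: chain_average_def sum_subtractf field_simps)
  then have "W.variance (chain_average f n) = W.expectation (\<lambda>\<omega>. (1 / real n)\<^sup>2 * (\<Sum>i<n. \<Sum>j<n. ?g (\<omega> i) * ?g (\<omega> j)))"
    by (simp only: power_mult_distrib power2_eq_square[of "sum _ _"] sum_product)
  also have "\<dots> = (1 / real n)\<^sup>2 * (\<Sum>i<n. \<Sum>j<n. W.expectation (\<lambda>\<omega>. ?g (\<omega> i) * ?g (\<omega> j)))"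
    by (simp add: L2_integrable_mult[OF L2_component[OF g] L2_component[OF g]])
  also have "(\<Sum>i<n. \<Sum>j<n. W.expectation (\<lambda>\<omega>. ?g (\<omega> i) * ?g (\<omega> j))) = double_sum (autocov ?g) n"
    unfolding double_sum_def
  proof (intro sum.cong refl)
    fix i j
    have "W.expectation (\<lambda>\<omega>. ?g (\<omega> i) * ?g (\<omega> j)) = autocov ?g (j - i)" if "i \<le> j" for i j
      using chain_covariance[OF g g, of i "j - i"] that by (simp add: autocov_def)
    from this[of i j] this[of j i]
    show "W.expectation (\<lambda>\<omega>. ?g (\<omega> i) * ?g (\<omega> j)) = autocov ?g (if i \<le> j then j - i else i - j)"
      by (auto simp: mult.commute)
  qed
  finally show ?thesis using False by (simp add: power2_eq_square)
qed (simp add: double_sum_def)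

text \<open>\<open>asymptotic_variance\<close> is defined by \<open>lim\<close>, which has its
  intended meaning only once convergence is known.\<close>

lemma tendsto_asymptotic_variance:
  assumes f: "f \<in> L2 \<mu>"
  shows "(\<lambda>n. ennreal (double_sum (autocov (\<lambda>x. f x - expectation f)) n / real n))
    \<longlonglongrightarrow> asymptotic_variance \<mu> H f"
proof -
  have "(\<lambda>x. f x - expectation f) \<in> L2 \<mu>"
    by (intro L2_diff f L2_const finite_measure_axioms)
  then obtain L where
    "(\<lambda>n. ennreal (double_sum (autocov (\<lambda>x. f x - expectation f)) n / real n)) \<longlonglongrightarrow> L"
    using reversible_autocovariance.double_sum_converges reversible_autocovariance_autocov by blast
  then show ?thesis
    unfolding asymptotic_variance_def variance_chain_average[OF f] using limI by force
qed

text \<open>Even lags give squared norms. Odd lags give the quadratic form of \<open>H\<close> at an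
  iterate of \<open>f\<close>, which is where definiteness is used.\<close>

lemma autocov_nonneg:
  assumes "nonneg_definite \<mu> H" and f: "f \<in> L2 \<mu>"
  shows "0 \<le> autocov f k"
proof (cases "even k")
  case True
  then obtain j where "k = 2 * j" by (elim evenE)
  then show ?thesis
    using reversible_autocovariance.even_nonneg[OF reversible_autocovariance_autocov[OF f]] by simp
next
  case False
  then obtain j where j: "k = 2 * j + 1" by (elim oddE)
  have "0 \<le> ip (iter f j) (op_H (iter f j))"
    using assms(1) L2_iter[OF f] by (simp add: nonneg_definite_def ip_def op_H_def)
  then show ?thesis
    by (simp add: ip_iter[OF f] j mult_2 flip: iter_Suc)
qed

end

text \<open>The chains live on different spaces, so \<open>transfer\<close> matches each test
  function of the first chain with one of the second. One direction suffices: the Abel sum of the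
  first chain is approached along its own truncated resolvents, and that of the second only has to
  be bounded below.\<close>

theorem asymptotic_variance_comparison:
  fixes \<mu> :: "'a measure" and \<mu>' :: "'b measure"
  assumes "reversible_chain \<mu> H" and "reversible_chain \<mu>' H'" and "nonneg_definite \<mu>' H'"
    and f: "f \<in> L2 \<mu>" and f': "f' \<in> L2 \<mu>'" and c: "1 \<le> c"
    and mean: "(\<integral>x. f x \<partial>\<mu>) = e" "(\<integral>x. f' x \<partial>\<mu>') = e"
    and square: "(\<integral>x. (f x - e)\<^sup>2 \<partial>\<mu>) = (\<integral>x. (f' x - e)\<^sup>2 \<partial>\<mu>')"
    and transfer: "\<And>g. g \<in> L2 \<mu> \<Longrightarrow> \<exists>u\<in>L2 \<mu>'.
      (\<integral>x. (f' x - e) * u x \<partial>\<mu>') = (\<integral>x. (f x - e) * g x \<partial>\<mu>) \<and>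
      (\<integral>x. (u x)\<^sup>2 \<partial>\<mu>') = (\<integral>x. (g x)\<^sup>2 \<partial>\<mu>) \<and>
      (\<integral>x. (u x)\<^sup>2 \<partial>\<mu>') - (\<integral>x. u x * (\<integral>y. u y \<partial>H' x) \<partial>\<mu>')
        \<le> c * ((\<integral>x. (g x)\<^sup>2 \<partial>\<mu>) - (\<integral>x. g x * (\<integral>y. g y \<partial>H x) \<partial>\<mu>))"
  shows "asymptotic_variance \<mu> H f \<le> ennreal (2 * c) * asymptotic_variance \<mu>' H' f'"
proof -
  interpret A: reversible_chain \<mu> H by fact
  interpret B: reversible_chain \<mu>' H' by fact
  let ?f = "\<lambda>x. f x - e" and ?f' = "\<lambda>x. f' x - e"
  have f0: "?f \<in> L2 \<mu>" and f0': "?f' \<in> L2 \<mu>'"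
    by (intro L2_diff f f' L2_const A.finite_measure_axioms B.finite_measure_axioms)+
  show ?thesis
  proof (rule asymptotic_comparison[OF _ _ c])
    show "reversible_autocovariance (A.autocov ?f)" "reversible_autocovariance (B.autocov ?f')"
      by (intro A.reversible_autocovariance_autocov B.reversible_autocovariance_autocov f0 f0')+
    show "A.autocov ?f 0 = B.autocov ?f' 0"
      using square by (simp add: A.autocov_def B.autocov_def A.ip_def B.ip_def power2_eq_square)
    show "0 \<le> B.autocov ?f' k" for k
      by (rule B.autocov_nonneg) fact+
    show "(\<lambda>n. ennreal (double_sum (A.autocov ?f) n / real n)) \<longlonglongrightarrow> asymptotic_variance \<mu> H f"
      "(\<lambda>n. ennreal (double_sum (B.autocov ?f') n / real n)) \<longlonglongrightarrow> asymptotic_variance \<mu>' H' f'"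
      using A.tendsto_asymptotic_variance[OF f] B.tendsto_asymptotic_variance[OF f'] by (simp_all add: mean)
    fix r :: real assume r: "0 < r" "r < 1"
    let ?S = "\<Sum>k. A.autocov ?f k * r ^ k" and ?S' = "\<Sum>k. B.autocov ?f' k * r ^ k"
    let ?E = "\<lambda>g. A.ip g g - r * A.ip g (A.op_H g)"
    have step: "2 / c * A.ip ?f g - 1 / c * ?E g \<le> ?S'" if g: "g \<in> L2 \<mu>" for g
    proof -
      obtain u where u: "u \<in> L2 \<mu>'" "B.ip ?f' u = A.ip ?f g" "B.ip u u = A.ip g g"
        "B.ip u u - B.ip u (B.op_H u) \<le> c * (A.ip g g - A.ip g (A.op_H g))"
        using transfer[OF g]
        by (auto simp: A.ip_def B.ip_def A.op_H_def B.op_H_def power2_eq_square)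
      \<comment> \<open>The scaling by \<open>1 / c\<close> multiplies the quadratic term by
        \<open>1 / c^2\<close>. One factor cancels the \<open>c\<close> in the bound on the
        Dirichlet form, so the whole functional is scaled by \<open>1 / c\<close>.\<close>
      have cs: "(\<lambda>x. (1 / c) * u x) \<in> L2 \<mu>'" by (rule L2_scale[OF u(1)])
      have op: "B.op_H (\<lambda>x. (1 / c) * u x) = (\<lambda>x. (1 / c) * B.op_H u x)"
        by (simp add: B.op_H_def fun_eq_iff)
      have "2 * ((1 / c) * B.ip ?f' u) - ((1 / c) * ((1 / c) * B.ip u u) - r * ((1 / c) * ((1 / c) * B.ip u (B.op_H u)))) \<le> ?S'"
        using B.abel_variational[OF f0' cs less_imp_le[OF r(1)] r(2)]
        by (simp only: op B.ip_scale_left B.ip_scale_right)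
      then have "2 / c * A.ip ?f g - (1 / c)\<^sup>2 * (B.ip u u - r * B.ip u (B.op_H u)) \<le> ?S'"
        by (simp add: u(2) power2_eq_square algebra_simps)
      moreover have "(1 / c)\<^sup>2 * (B.ip u u - r * B.ip u (B.op_H u)) \<le> (1 / c)\<^sup>2 * (c * ?E g)"
      proof (intro mult_left_mono)
        \<comment> \<open>The form of \<open>1 - r H\<close> is a convex combination of the squared
          norm and the Dirichlet form; for the squared norm the factor \<open>c\<close> is
          affordable because \<open>1 \<le> c\<close>.\<close>
        have "B.ip u u - r * B.ip u (B.op_H u) = (1 - r) * B.ip u u + r * (B.ip u u - B.ip u (B.op_H u))"
          by (simp add: algebra_simps)
        also have "\<dots> \<le> (1 - r) * (c * A.ip g g) + r * (c * (A.ip g g - A.ip g (A.op_H g)))"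
        proof (intro add_mono mult_left_mono u(4))
          show "B.ip u u \<le> c * A.ip g g"
            using mult_right_mono[OF c A.ip_self_nonneg[of g]] by (simp add: u(3))
        qed (use r in auto)
        also have "\<dots> = c * ?E g" by (simp add: algebra_simps)
        finally show "B.ip u u - r * B.ip u (B.op_H u) \<le> c * ?E g" .
      qed simp
      moreover have "(1 / c)\<^sup>2 * (c * ?E g) = 1 / c * ?E g"
        using c by (simp add: power2_eq_square)
      ultimately show ?thesis by linarith
    qed
    \<comment> \<open>Along the truncated resolvents pairing and energy both tend to the Abel sum,
      so the left side tends to \<open>1 / c\<close> times it.\<close>
    have "(\<lambda>n. 2 / c * A.ip ?f (A.resolvent ?f r n) - 1 / c * ?E (A.resolvent ?f r n)) \<longlonglongrightarrow> 2 / c * ?S - 1 / c * ?S"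
      using A.tendsto_ip_resolvent[OF f0, of r] A.tendsto_resolvent_energy[OF f0, of r] r
      by (intro tendsto_intros) auto
    then have "2 / c * ?S - 1 / c * ?S \<le> ?S'"
      by (rule LIMSEQ_le_const2) (use step[OF A.L2_resolvent[OF f0]] in blast)
    then show "?S \<le> c * ?S'"
      using c by (simp add: field_simps)
  qed
qed

section \<open>The ABC-MCMC chain\<close>

lemma density_kernel_measurable:
  assumes "sigma_finite_measure M"
    and f[measurable]: "(\<lambda>(x, y). f x y) \<in> borel_measurable (N \<Otimes>\<^sub>M M)"
    and one: "\<And>x. x \<in> space N \<Longrightarrow> (\<integral>\<^sup>+y. ennreal (f x y) \<partial>M) = 1"
  shows "(\<lambda>x. density M (\<lambda>y. ennreal (f x y))) \<in> measurable N (prob_algebra M)"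
proof (rule measurable_prob_algebraI)
  interpret sigma_finite_measure M by fact
  show p: "prob_space (density M (\<lambda>y. ennreal (f x y)))" if "x \<in> space N" for x
  proof (rule prob_spaceI)
    have [measurable]: "f x \<in> borel_measurable M"
      using measurable_Pair2[OF f that] by simp
    show "emeasure (density M (\<lambda>y. ennreal (f x y))) (space (density M (\<lambda>y. ennreal (f x y)))) = 1"
      using one[OF that] by (simp add: emeasure_density cong: nn_integral_cong)
  qed
  show "(\<lambda>x. density M (\<lambda>y. ennreal (f x y))) \<in> measurable N (subprob_algebra M)"
  proof (rule measurable_subprob_algebra)
    fix A assume [measurable]: "A \<in> sets M"
    have [measurable]: "f x \<in> borel_measurable M" if "x \<in> space N" for x
      using measurable_Pair2[OF f that] by simp
    have "(\<lambda>x. \<integral>\<^sup>+y. ennreal (f x y) * indicator A y \<partial>M) \<in> borel_measurable N"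
      by measurable
    then show "(\<lambda>x. emeasure (density M (\<lambda>y. ennreal (f x y))) A) \<in> borel_measurable N"
      by (rule measurable_cong[THEN iffD1, rotated]) (simp add: emeasure_density)
  qed (use p in \<open>auto intro: prob_space_imp_subprob_space\<close>)
qed

text \<open>On rectangles the mass is a finite product of measurable functions of the parameter, and
  rectangles generate.\<close>

lemma PiM_kernel_measurable:
  assumes k: "\<kappa> \<in> measurable N (prob_algebra M)" and I: "finite I"
  shows "(\<lambda>x. PiM I (\<lambda>_. \<kappa> x)) \<in> measurable N (prob_algebra (PiM I (\<lambda>_. M)))"
proof (rule measurable_prob_algebra_generated[OF sets_PiM Int_stable_prod_algebra prod_algebra_sets_into_space])
  have p: "prob_space (\<kappa> x)" and s: "sets (\<kappa> x) = sets M" if "x \<in> space N" for x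
    using measurable_space[OF k that] by (auto simp: space_prob_algebra)
  show "prob_space (PiM I (\<lambda>_. \<kappa> x))" if "x \<in> space N" for x
    using p[OF that] by (intro prob_space_PiM)
  show "sets (PiM I (\<lambda>_. \<kappa> x)) = sets (PiM I (\<lambda>_. M))" if "x \<in> space N" for x
    using s[OF that] by (intro sets_PiM_cong) auto
  fix A assume "A \<in> prod_algebra I (\<lambda>_. M)"
  then obtain E where A: "A = Pi\<^sub>E I E" and E: "\<And>i. i \<in> I \<Longrightarrow> E i \<in> sets M"
    using I by (auto simp: prod_algebra_eq_finite Pi_iff)
  have "(\<lambda>x. \<Prod>i\<in>I. emeasure (\<kappa> x) (E i)) \<in> borel_measurable N"
    using E by (intro borel_measurable_prod_ennreal
        measurable_emeasure_kernel[OF measurable_prob_algebraD[OF k]]) auto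
  then show "(\<lambda>x. emeasure (PiM I (\<lambda>_. \<kappa> x)) A) \<in> borel_measurable N"
  proof (rule measurable_cong[THEN iffD1, rotated])
    fix x assume x: "x \<in> space N"
    interpret K: prob_space "\<kappa> x" by (rule p[OF x])
    interpret finite_product_sigma_finite "\<lambda>_. \<kappa> x" I
      by standard (rule I)
    show "(\<Prod>i\<in>I. emeasure (\<kappa> x) (E i)) = emeasure (PiM I (\<lambda>_. \<kappa> x)) A"
      unfolding A using E by (simp add: s[OF x] measure_times)
  qed
qed

lemma bernoulli_kernel_measurable:
  assumes [measurable]: "a \<in> borel_measurable N" and a: "\<And>x. x \<in> space N \<Longrightarrow> 0 \<le> a x \<and> a x \<le> 1"
  shows "(\<lambda>x. measure_pmf (bernoulli_pmf (a x))) \<in> measurable N (prob_algebra (count_space UNIV))"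
proof (rule measurable_prob_algebraI)
  show "(\<lambda>x. measure_pmf (bernoulli_pmf (a x))) \<in> measurable N (subprob_algebra (count_space UNIV))"
  proof (rule measurable_subprob_algebra)
    fix A :: "bool set"
    have "(\<lambda>x. indicator A True * ennreal (a x) + indicator A False * ennreal (1 - a x)) \<in> borel_measurable N"
      by measurable
    then show "(\<lambda>x. emeasure (measure_pmf (bernoulli_pmf (a x))) A) \<in> borel_measurable N"
    proof (rule measurable_cong[THEN iffD1, rotated])
      fix x assume "x \<in> space N"
      then have "(\<integral>\<^sup>+b. indicator A b \<partial>measure_pmf (bernoulli_pmf (a x))) =
          indicator A True * ennreal (a x) + indicator A False * ennreal (1 - a x)"
        using a by (intro nn_integral_bernoulli_pmf) auto
      then show "indicator A True * ennreal (a x) + indicator A False * ennreal (1 - a x) =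
          emeasure (measure_pmf (bernoulli_pmf (a x))) A"
        by simp
    qed
  qed (auto intro: measure_pmf.subprob_space_axioms)
qed (rule measure_pmf.prob_space_axioms)

lemma L2_distr_iff:
  assumes [measurable]: "\<phi> \<in> measurable M N" "f \<in> borel_measurable N"
  shows "f \<in> L2 (distr M N \<phi>) \<longleftrightarrow> (\<lambda>x. f (\<phi> x)) \<in> L2 M"
  by (simp add: L2_def integrable_distr_eq)

text \<open>The uniform kernel takes only the values 0 and 1; nothing else about it matters.\<close>

locale binary_abc_model = abc_model \<Theta> Y prior p yobs \<eta> K q
  for \<Theta> :: "'a measure" and Y :: "'b measure" and prior p yobs
    and \<eta> :: "'b \<Rightarrow> 'e::real_normed_vector" and K q +
  assumes K_binary: "K z = 0 \<or> K z = 1"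
begin

sublocale \<Theta>: sigma_finite_measure \<Theta> by (rule \<Theta>_sigma_finite)
sublocale Y: sigma_finite_measure Y by (rule Y_sigma_finite)

lemma space_\<Theta>_nonempty: "space \<Theta> \<noteq> {}"
  using normalizing_constant_pos nn_integral_empty[of \<Theta>] by auto

abbreviation hit :: "'b \<Rightarrow> real" where
  "hit y \<equiv> K (\<eta> yobs - \<eta> y)"

abbreviation T_space :: "real measure" where
  "T_space \<equiv> restrict_space borel {0..}"

declare prior_measurable[measurable]

lemma hit_measurable[measurable]: "hit \<in> borel_measurable Y"
proof -
  have "(\<lambda>z. \<eta> yobs - z) \<in> borel_measurable borel"
    by (intro borel_measurable_continuous_onI continuous_intros)
  then show ?thesis
    using measurable_compose[OF measurable_compose[OF \<eta>_measurable] K_measurable] by blast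
qed

lemma q_compose_measurable[measurable (raw)]:
  assumes "f \<in> measurable N \<Theta>" "g \<in> measurable N \<Theta>"
  shows "(\<lambda>x. q (f x) (g x)) \<in> borel_measurable N"
  using measurable_compose[OF measurable_Pair[OF assms] q_measurable] by simp

lemma sets_state_space[measurable_cong]: "sets state_space = sets (\<Theta> \<Otimes>\<^sub>M T_space)"
  by (simp add: state_space_def)

lemma space_state_space: "space state_space = space \<Theta> \<times> {0..}"
  by (simp add: state_space_def space_pair_measure space_restrict_space)

lemma T_space_id[measurable]: "(\<lambda>t. t) \<in> borel_measurable T_space"
  by (rule measurable_restrict_space1) simp

lemma state_snd_measurable[measurable]: "snd \<in> borel_measurable state_space"
  using measurable_compose[OF measurable_snd T_space_id, of \<Theta>] by (simp add: state_space_def)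

lemma state_fst_measurable[measurable]: "fst \<in> measurable state_space \<Theta>"
  by (simp add: state_space_def)

lemma model_kernel:
  "(\<lambda>\<theta>. density Y (\<lambda>y. ennreal (p \<theta> y))) \<in> measurable \<Theta> (prob_algebra Y)"
  using p_measurable p_integral by (intro density_kernel_measurable Y_sigma_finite)

lemma proposal_kernel:
  "(\<lambda>\<theta>. density \<Theta> (\<lambda>\<theta>'. ennreal (q \<theta> \<theta>'))) \<in> measurable \<Theta> (prob_algebra \<Theta>)"
  using q_measurable q_integral by (intro density_kernel_measurable \<Theta>_sigma_finite)

lemma model_prob_space: "\<theta> \<in> space \<Theta> \<Longrightarrow> prob_space (density Y (\<lambda>y. ennreal (p \<theta> y)))"
  using measurable_space[OF model_kernel] by (auto simp: space_prob_algebra)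

lemma T_value_nonneg: "\<theta> \<in> space \<Theta> \<Longrightarrow> 0 \<le> T_value m \<theta> y"
  by (simp add: T_value_def prior_nonneg K_nonneg sum_nonneg)

lemma T_value_measurable:
  "(\<lambda>(\<theta>, y). T_value m \<theta> y) \<in> measurable (\<Theta> \<Otimes>\<^sub>M PiM {..<m} (\<lambda>_. Y)) T_space"
proof (rule measurable_restrict_space2)
  show "(\<lambda>(\<theta>, y). T_value m \<theta> y) \<in> borel_measurable (\<Theta> \<Otimes>\<^sub>M PiM {..<m} (\<lambda>_. Y))"
    unfolding T_value_def by measurable
qed (auto simp: space_pair_measure T_value_nonneg)

lemma T_law_kernel: "T_law m \<in> measurable \<Theta> (prob_algebra T_space)"
  unfolding T_law_def[abs_def]
  by (rule measurable_distr_prob_space2[OF PiM_kernel_measurable[OF model_kernel] T_value_measurable]) simp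

lemma T_law_subprob_kernel[measurable]: "T_law m \<in> measurable \<Theta> (subprob_algebra T_space)"
  by (rule measurable_prob_algebraD[OF T_law_kernel])

lemma T_law_prob_space: "\<theta> \<in> space \<Theta> \<Longrightarrow> prob_space (T_law m \<theta>)"
  and sets_T_law[simp, measurable_cong]: "sets (T_law m \<theta>) = sets T_space"
  using measurable_space[OF T_law_kernel] by (auto simp: space_prob_algebra T_law_def)

section \<open>The mean of the weight and the stationary law\<close>

lemma nn_integral_T_law:
  assumes \<theta>: "\<theta> \<in> space \<Theta>" and h: "h \<in> borel_measurable T_space"
  shows "(\<integral>\<^sup>+t. h t \<partial>T_law m \<theta>) =
    (\<integral>\<^sup>+y. h (T_value m \<theta> y) \<partial>PiM {..<m} (\<lambda>_. density Y (\<lambda>y. ennreal (p \<theta> y))))"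
proof -
  have "T_value m \<theta> \<in> measurable (PiM {..<m} (\<lambda>_. Y)) T_space"
    using measurable_Pair2[OF T_value_measurable \<theta>] by simp
  moreover have "sets (PiM {..<m} (\<lambda>_. density Y (\<lambda>y. ennreal (p \<theta> y)))) = sets (PiM {..<m} (\<lambda>_. Y))"
    by (intro sets_PiM_cong) auto
  ultimately show ?thesis
    unfolding T_law_def using h by (intro nn_integral_distr) (simp_all cong: measurable_cong_sets)
qed

definition hit_prob :: "'a \<Rightarrow> ennreal" where
  "hit_prob \<theta> = (\<integral>\<^sup>+y. ennreal (hit y * p \<theta> y) \<partial>Y)"

lemma p_section_measurable: "\<theta> \<in> space \<Theta> \<Longrightarrow> p \<theta> \<in> borel_measurable Y"
  using measurable_Pair2[OF p_measurable] by simp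

lemma nn_integral_sum_hit:
  assumes \<theta>: "\<theta> \<in> space \<Theta>"
  shows "(\<integral>\<^sup>+y. ennreal (\<Sum>i<m. hit (y i)) \<partial>PiM {..<m} (\<lambda>_. density Y (\<lambda>y. ennreal (p \<theta> y)))) = of_nat m * hit_prob \<theta>"
proof -
  let ?D = "density Y (\<lambda>y. ennreal (p \<theta> y))"
  let ?P = "PiM {..<m} (\<lambda>_. ?D)"
  note [measurable] = p_section_measurable[OF \<theta>]
  have c[measurable]: "(\<lambda>y. y i) \<in> measurable ?P ?D" if "i < m" for i
    using that by (intro measurable_component_singleton) auto
  have "(\<integral>\<^sup>+y. ennreal (\<Sum>i<m. hit (y i)) \<partial>?P) = (\<integral>\<^sup>+y. (\<Sum>i<m. ennreal (hit (y i))) \<partial>?P)"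
    by (simp add: sum_ennreal K_nonneg)
  also have "\<dots> = (\<Sum>i<m. \<integral>\<^sup>+y. ennreal (hit (y i)) \<partial>?P)"
    by (rule nn_integral_sum) (auto intro!: measurable_compose[OF c])
  also have "\<dots> = (\<Sum>i<m. \<integral>\<^sup>+y. ennreal (hit y) \<partial>?D)"
  proof (intro sum.cong refl)
    fix i assume "i \<in> {..<m}"
    then have "(\<integral>\<^sup>+y. ennreal (hit (y i)) \<partial>?P) = (\<integral>\<^sup>+y. ennreal (hit y) \<partial>distr ?P ?D (\<lambda>y. y i))"
      by (intro nn_integral_distr[symmetric] c) auto
    also have "distr ?P ?D (\<lambda>y. y i) = ?D"
      using \<open>i \<in> _\<close> by (intro distr_PiM_component model_prob_space \<theta>) auto
    finally show "(\<integral>\<^sup>+y. ennreal (hit (y i)) \<partial>?P) = (\<integral>\<^sup>+y. ennreal (hit y) \<partial>?D)" .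
  qed
  also have "(\<integral>\<^sup>+y. ennreal (hit y) \<partial>?D) = hit_prob \<theta>"
    using p_nonneg[OF \<theta>]
    by (subst nn_integral_density)
       (auto simp: hit_prob_def ennreal_mult' K_nonneg mult.commute ennreal_mult intro!: nn_integral_cong)
  finally show ?thesis by simp
qed

text \<open>The average is an unbiased estimate, so its mean does not depend on \<open>m\<close>;
  therefore all the chains share the marginal \<open>\<pi>_K\<close>.\<close>

lemma nn_integral_T_law_id:
  assumes \<theta>: "\<theta> \<in> space \<Theta>" and m: "1 \<le> m"
  shows "(\<integral>\<^sup>+t. ennreal t \<partial>T_law m \<theta>) = ennreal (prior \<theta>) * hit_prob \<theta>"
proof -
  let ?P = "PiM {..<m} (\<lambda>_. density Y (\<lambda>y. ennreal (p \<theta> y)))"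
  have [measurable]: "(\<lambda>y. \<Sum>i<m. hit (y i)) \<in> borel_measurable ?P"
    by (subst measurable_cong_sets[OF sets_PiM_cong[OF refl sets_density] refl]) measurable
  have "(\<integral>\<^sup>+t. ennreal t \<partial>T_law m \<theta>) = (\<integral>\<^sup>+y. ennreal (T_value m \<theta> y) \<partial>?P)"
    by (rule nn_integral_T_law[OF \<theta>]) simp
  also have "\<dots> = (\<integral>\<^sup>+y. ennreal (prior \<theta> / m) * ennreal (\<Sum>i<m. hit (y i)) \<partial>?P)"
    by (simp add: T_value_def prior_nonneg[OF \<theta>] K_nonneg sum_nonneg flip: ennreal_mult)
  also have "\<dots> = ennreal (prior \<theta> / m) * (of_nat m * hit_prob \<theta>)"
    by (simp add: nn_integral_cmult nn_integral_sum_hit[OF \<theta>])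
  also have "\<dots> = ennreal (prior \<theta> / m) * ennreal (real m) * hit_prob \<theta>"
    by (simp only: ennreal_of_nat_eq_real_of_nat mult.assoc)
  also have "ennreal (prior \<theta> / m) * ennreal (real m) = ennreal (prior \<theta>)"
    using m prior_nonneg[OF \<theta>] by (simp flip: ennreal_mult)
  finally show ?thesis .
qed

text \<open>The common reference measure: \<open>\<pi>_tilde m\<close> has density proportional to
  the weight with respect to it, and a proposal has the density \<open>q\<close>. Its total mass is
  that of \<open>\<Theta>\<close>, which may be infinite.\<close>

definition base :: "nat \<Rightarrow> ('a \<times> real) measure" where
  "base m = \<Theta> \<bind> (\<lambda>\<theta>. distr (T_law m \<theta>) state_space (Pair \<theta>))"

lemma base_kernel:
  "(\<lambda>\<theta>. distr (T_law m \<theta>) state_space (Pair \<theta>)) \<in> measurable \<Theta> (prob_algebra state_space)"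
  by (rule measurable_distr_prob_space2[OF T_law_kernel]) (simp add: state_space_def)

lemma sets_base[simp, measurable_cong]: "sets (base m) = sets state_space"
  unfolding base_def by (rule sets_bind) (auto simp: space_\<Theta>_nonempty)

lemma space_base: "space (base m) = space \<Theta> \<times> {0..}"
  using sets_eq_imp_space_eq[OF sets_base] space_state_space by simp

lemma nn_integral_base:
  assumes [measurable]: "\<phi> \<in> borel_measurable state_space"
  shows "(\<integral>\<^sup>+x. \<phi> x \<partial>base m) = (\<integral>\<^sup>+\<theta>. \<integral>\<^sup>+t. \<phi> (\<theta>, t) \<partial>T_law m \<theta> \<partial>\<Theta>)"
proof -
  have "(\<integral>\<^sup>+x. \<phi> x \<partial>base m) = (\<integral>\<^sup>+\<theta>. \<integral>\<^sup>+x. \<phi> x \<partial>distr (T_law m \<theta>) state_space (Pair \<theta>) \<partial>\<Theta>)"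
    unfolding base_def by (rule nn_integral_bind[OF _ measurable_prob_algebraD[OF base_kernel]]) simp
  also have "\<dots> = (\<integral>\<^sup>+\<theta>. \<integral>\<^sup>+t. \<phi> (\<theta>, t) \<partial>T_law m \<theta> \<partial>\<Theta>)"
    by (intro nn_integral_cong nn_integral_distr)
       (auto simp: state_space_def measurable_cong_sets[OF sets_T_law refl])
  finally show ?thesis .
qed

text \<open>Every fibre carries a probability measure, so a cylinder has the mass of its base and a
  countable cover of \<open>\<Theta>\<close> lifts. Fubini in the proof of detailed balance depends
  on this.\<close>

lemma sigma_finite_base: "sigma_finite_measure (base m)"
proof
  obtain A where A: "countable A" "A \<subseteq> sets \<Theta>" "\<Union>A = space \<Theta>" "\<forall>a\<in>A. emeasure \<Theta> a \<noteq> \<infinity>"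
    using \<Theta>.sigma_finite_countable by blast
  have rect: "a \<times> {0..} \<in> sets state_space" if "a \<in> sets \<Theta>" for a
    unfolding state_space_def using that by (intro pair_measureI) (auto simp: sets_restrict_space)
  have e: "emeasure (base m) (a \<times> {0..}) = emeasure \<Theta> a" if [measurable]: "a \<in> sets \<Theta>" for a
  proof -
    note [measurable] = rect[OF that]
    have "emeasure (base m) (a \<times> {0..}) = (\<integral>\<^sup>+x. indicator (a \<times> {0..}) x \<partial>base m)"
      by simp
    also have "\<dots> = (\<integral>\<^sup>+\<theta>. \<integral>\<^sup>+t. indicator (a \<times> {0..}) (\<theta>, t) \<partial>T_law m \<theta> \<partial>\<Theta>)"
      by (rule nn_integral_base) simp
    also have "\<dots> = (\<integral>\<^sup>+\<theta>. \<integral>\<^sup>+t. indicator a \<theta> \<partial>T_law m \<theta> \<partial>\<Theta>)"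
      using sets_eq_imp_space_eq[OF sets_T_law]
      by (intro nn_integral_cong) (auto simp: space_restrict_space split: split_indicator)
    also have "\<dots> = (\<integral>\<^sup>+\<theta>. indicator a \<theta> \<partial>\<Theta>)"
      by (intro nn_integral_cong) (simp add: prob_space.emeasure_space_1[OF T_law_prob_space])
    finally show ?thesis by simp
  qed
  show "\<exists>B. countable B \<and> B \<subseteq> sets (base m) \<and> \<Union>B = space (base m) \<and> (\<forall>b\<in>B. emeasure (base m) b \<noteq> \<infinity>)"
  proof (intro exI[of _ "(\<lambda>a. a \<times> {0..}) ` A"] conjI)
    show "(\<lambda>a. a \<times> {0..}) ` A \<subseteq> sets (base m)"
      using A(2) rect by auto
    show "\<forall>b\<in>(\<lambda>a. a \<times> {0..}) ` A. emeasure (base m) b \<noteq> \<infinity>"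
      using A(2,4) e by auto
  qed (use A(1,3) in \<open>auto simp: space_base\<close>)
qed

definition norm_const :: ennreal where
  "norm_const = (\<integral>\<^sup>+\<theta>. ennreal (prior \<theta>) * hit_prob \<theta> \<partial>\<Theta>)"

lemma norm_const: "norm_const \<noteq> 0" "norm_const \<noteq> \<infinity>"
  using normalizing_constant_pos normalizing_constant_finite
  by (auto simp: norm_const_def hit_prob_def)

lemma hit_prob_measurable[measurable]: "hit_prob \<in> borel_measurable \<Theta>"
proof -
  have [measurable]: "(\<lambda>x. p (fst x) (snd x)) \<in> borel_measurable (\<Theta> \<Otimes>\<^sub>M Y)"
    using p_measurable by (simp add: split_beta')
  show ?thesis
    unfolding hit_prob_def[abs_def]
    by (rule Y.borel_measurable_nn_integral) (simp add: split_beta')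
qed

lemma nn_integral_\<pi>_K:
  assumes [measurable]: "\<phi> \<in> borel_measurable \<Theta>"
  shows "(\<integral>\<^sup>+\<theta>. \<phi> \<theta> \<partial>\<pi>_K) = (1 / norm_const) * (\<integral>\<^sup>+\<theta>. ennreal (prior \<theta>) * hit_prob \<theta> * \<phi> \<theta> \<partial>\<Theta>)"
proof -
  let ?D = "density \<Theta> (\<lambda>\<theta>. ennreal (prior \<theta>) * hit_prob \<theta>)"
  have "emeasure ?D (space ?D) = norm_const"
    by (simp add: emeasure_density norm_const_def cong: nn_integral_cong)
  then have "\<pi>_K = scale_measure (1 / norm_const) ?D"
    unfolding \<pi>_K_def normalized_def hit_prob_def by simp
  then show ?thesis
    by (simp add: nn_integral_scale_measure nn_integral_density)
qed

lemma nn_integral_\<pi>_tilde: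
  assumes m: "1 \<le> m" and [measurable]: "\<phi> \<in> borel_measurable state_space"
  shows "(\<integral>\<^sup>+x. \<phi> x \<partial>\<pi>_tilde m) = (1 / norm_const) * (\<integral>\<^sup>+x. ennreal (snd x) * \<phi> x \<partial>base m)"
proof -
  let ?D = "density (base m) (\<lambda>x. ennreal (snd x))"
  have "emeasure ?D (space ?D) = (\<integral>\<^sup>+x. 1 \<partial>?D)"
    by simp
  also have "\<dots> = (\<integral>\<^sup>+x. ennreal (snd x) \<partial>base m)"
    by (subst nn_integral_density) auto
  also have "\<dots> = norm_const"
    unfolding norm_const_def
    by (subst nn_integral_base) (auto intro!: nn_integral_cong nn_integral_T_law_id m)
  finally have "emeasure ?D (space ?D) = norm_const" .
  then have "\<pi>_tilde m = scale_measure (1 / norm_const) ?D"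
    unfolding \<pi>_tilde_def normalized_def base_def by (simp add: case_prod_unfold)
  then show ?thesis
    by (simp add: nn_integral_scale_measure nn_integral_density)
qed

lemma sets_\<pi>_tilde[simp, measurable_cong]: "sets (\<pi>_tilde m) = sets state_space"
  using sets_base[of m] by (simp add: \<pi>_tilde_def normalized_def base_def)

lemma sets_\<pi>_K[simp, measurable_cong]: "sets \<pi>_K = sets \<Theta>"
  by (simp add: \<pi>_K_def normalized_def)

lemma distr_\<pi>_tilde_fst:
  assumes m: "1 \<le> m"
  shows "distr (\<pi>_tilde m) \<Theta> fst = \<pi>_K"
proof (rule measure_eqI)
  fix A assume "A \<in> sets (distr (\<pi>_tilde m) \<Theta> fst)"
  then have [measurable]: "A \<in> sets \<Theta>" by simp
  have "emeasure (distr (\<pi>_tilde m) \<Theta> fst) A = (\<integral>\<^sup>+\<theta>. indicator A \<theta> \<partial>distr (\<pi>_tilde m) \<Theta> fst)"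
    by simp
  also have "\<dots> = (\<integral>\<^sup>+x. indicator A (fst x) \<partial>\<pi>_tilde m)"
    by (subst nn_integral_distr) auto
  also have "\<dots> = (1 / norm_const) * (\<integral>\<^sup>+x. ennreal (snd x) * indicator A (fst x) \<partial>base m)"
    by (rule nn_integral_\<pi>_tilde[OF m]) simp
  also have "(\<integral>\<^sup>+x. ennreal (snd x) * indicator A (fst x) \<partial>base m) =
      (\<integral>\<^sup>+\<theta>. \<integral>\<^sup>+t. ennreal t * indicator A \<theta> \<partial>T_law m \<theta> \<partial>\<Theta>)"
    by (subst nn_integral_base) auto
  also have "\<dots> = (\<integral>\<^sup>+\<theta>. ennreal (prior \<theta>) * hit_prob \<theta> * indicator A \<theta> \<partial>\<Theta>)"
    by (intro nn_integral_cong, subst nn_integral_multc) (auto simp: nn_integral_T_law_id[OF _ m])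
  also have "(1 / norm_const) * \<dots> = (\<integral>\<^sup>+\<theta>. indicator A \<theta> \<partial>\<pi>_K)"
    by (rule nn_integral_\<pi>_K[symmetric]) simp
  finally show "emeasure (distr (\<pi>_tilde m) \<Theta> fst) A = emeasure \<pi>_K A" by simp
qed simp

lemma prob_space_\<pi>_K: "prob_space \<pi>_K"
proof (rule prob_spaceI)
  have "emeasure \<pi>_K (space \<pi>_K) = (\<integral>\<^sup>+\<theta>. 1 \<partial>\<pi>_K)" by simp
  also have "\<dots> = (1 / norm_const) * norm_const"
    by (subst nn_integral_\<pi>_K) (auto simp: norm_const_def)
  also have "\<dots> = 1"
    using norm_const by (simp add: ennreal_divide_times ennreal_divide_self less_top)
  finally show "emeasure \<pi>_K (space \<pi>_K) = 1" .
qed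

lemma prob_space_\<pi>_tilde: "1 \<le> m \<Longrightarrow> prob_space (\<pi>_tilde m)"
  using prob_space_distrD[of fst "\<pi>_tilde m" \<Theta>] prob_space_\<pi>_K by (simp add: distr_\<pi>_tilde_fst)

section \<open>The transition kernel and detailed balance\<close>

lemma acceptance_eq:
  "acceptance x z = (if snd x * q (fst x) (fst z) = 0 then 1
    else min 1 (snd z * q (fst z) (fst x) / (snd x * q (fst x) (fst z))))"
  by (simp add: acceptance_def split_beta)

lemma acceptance_bounds:
  assumes "x \<in> space state_space" "z \<in> space state_space"
  shows "0 \<le> acceptance x z \<and> acceptance x z \<le> 1"
  using assms q_nonneg by (auto simp: acceptance_eq space_state_space)

lemma acceptance_measurable[measurable (raw)]:
  assumes [measurable]: "f \<in> measurable N state_space" "g \<in> measurable N state_space"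
  shows "(\<lambda>x. acceptance (f x) (g x)) \<in> borel_measurable N"
  unfolding acceptance_eq by measurable

text \<open>Up to \<open>norm_const\<close>, the density of accepted moves at stationarity with
  respect to two copies of \<open>base m\<close>. Its symmetry is detailed balance.\<close>

definition flow :: "'a \<times> real \<Rightarrow> 'a \<times> real \<Rightarrow> ennreal" where
  "flow x z = ennreal (min (snd x * q (fst x) (fst z)) (snd z * q (fst z) (fst x)))"

lemma flow_commute: "flow x z = flow z x"
  by (simp add: flow_def min.commute)

lemma flow_measurable[measurable (raw)]:
  assumes [measurable]: "f \<in> measurable N state_space" "g \<in> measurable N state_space"
  shows "(\<lambda>x. flow (f x) (g x)) \<in> borel_measurable N"
  unfolding flow_def by measurable

lemma flow_eq:
  assumes "x \<in> space state_space" "z \<in> space state_space"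
  shows "ennreal (snd x) * (ennreal (q (fst x) (fst z)) * ennreal (acceptance x z)) = flow x z"
proof -
  define a b where "a = snd x * q (fst x) (fst z)" and "b = snd z * q (fst z) (fst x)"
  have nn: "0 \<le> snd x" "0 \<le> q (fst x) (fst z)" "0 \<le> a" "0 \<le> b" "0 \<le> acceptance x z"
    using assms q_nonneg acceptance_bounds[OF assms] by (auto simp: a_def b_def space_state_space)
  have "acceptance x z = (if a = 0 then 1 else min 1 (b / a))"
    by (simp only: acceptance_eq a_def b_def)
  \<comment> \<open>For \<open>a = 0\<close>, where the acceptance probability is 1 by convention,
    both sides are 0 because \<open>0 \<le> b\<close>.\<close>
  then have "a * acceptance x z = min a b"
    using nn by (auto simp: min_def field_simps)
  then show ?thesis
    using nn by (simp add: flow_def a_def b_def mult.assoc flip: ennreal_mult)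
qed

text \<open>The nesting \<open>((x, \<theta>'), t')\<close> follows the order of the draws in
  \<open>Q\<close>, so that the two binds can be peeled off from the right.\<close>

lemma transition_measurable:
  "(\<lambda>((x, \<theta>'), t'). distr (bernoulli_pmf (acceptance x (\<theta>', t'))) state_space
      (\<lambda>accept. if accept then (\<theta>', t') else x))
    \<in> measurable ((state_space \<Otimes>\<^sub>M \<Theta>) \<Otimes>\<^sub>M T_space) (prob_algebra state_space)"
proof -
  let ?N = "(state_space \<Otimes>\<^sub>M \<Theta>) \<Otimes>\<^sub>M T_space"
  have z[measurable]: "(\<lambda>w. (snd (fst w), snd w)) \<in> measurable ?N state_space"
    unfolding state_space_def by measurable
  have "(\<lambda>w. measure_pmf (bernoulli_pmf (acceptance (fst (fst w)) (snd (fst w), snd w))))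
      \<in> measurable ?N (prob_algebra (count_space UNIV))"
  proof (rule bernoulli_kernel_measurable)
    fix w assume "w \<in> space ?N"
    then show "0 \<le> acceptance (fst (fst w)) (snd (fst w), snd w) \<and> acceptance (fst (fst w)) (snd (fst w), snd w) \<le> 1"
      by (intro acceptance_bounds) (auto simp: space_pair_measure space_state_space space_restrict_space)
  qed measurable
  then have "(\<lambda>w. distr (bernoulli_pmf (acceptance (fst (fst w)) (snd (fst w), snd w))) state_space
      (\<lambda>accept. if accept then (snd (fst w), snd w) else fst (fst w))) \<in> measurable ?N (prob_algebra state_space)"
    by (rule measurable_distr_prob_space2) (simp add: split_beta')
  then show ?thesis by (simp add: split_beta')
qed

lemma proposal_kernel_state:
  "(\<lambda>x. density \<Theta> (\<lambda>\<theta>'. ennreal (q (fst x) \<theta>'))) \<in> measurable state_space (prob_algebra \<Theta>)"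
  by (rule measurable_compose[OF state_fst_measurable proposal_kernel])

lemma draw_measurable:
  "(\<lambda>(x, \<theta>'). T_law m \<theta>' \<bind> (\<lambda>t'. distr (bernoulli_pmf (acceptance x (\<theta>', t'))) state_space
      (\<lambda>accept. if accept then (\<theta>', t') else x)))
    \<in> measurable (state_space \<Otimes>\<^sub>M \<Theta>) (prob_algebra state_space)"
proof -
  have "(\<lambda>w. T_law m (snd w) \<bind> (\<lambda>t'. distr (bernoulli_pmf (acceptance (fst w) (snd w, t'))) state_space
      (\<lambda>accept. if accept then (snd w, t') else fst w)))
    \<in> measurable (state_space \<Otimes>\<^sub>M \<Theta>) (prob_algebra state_space)"
    using transition_measurable
    by (intro measurable_bind_prob_space2[OF measurable_compose[OF measurable_snd T_law_kernel]])
       (simp add: split_beta')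
  then show ?thesis by (simp add: split_beta')
qed

lemma Q_kernel: "Q m \<in> measurable state_space (prob_algebra state_space)"
  unfolding Q_def[abs_def]
  by (rule measurable_bind_prob_space2[OF proposal_kernel_state draw_measurable])

text \<open>The draws of the parameter and of its weight merge into one integral over
  \<open>base m\<close>, and the Bernoulli draw splits the integrand into acceptance and
  rejection.\<close>

lemma nn_integral_Q:
  assumes x: "x \<in> space state_space" and \<phi>[measurable]: "\<phi> \<in> borel_measurable state_space"
  shows "(\<integral>\<^sup>+z. \<phi> z \<partial>Q m x) = (\<integral>\<^sup>+z. ennreal (q (fst x) (fst z)) *
    (ennreal (acceptance x z) * \<phi> z + ennreal (1 - acceptance x z) * \<phi> x) \<partial>base m)"
proof -
  let ?h = "\<lambda>z. ennreal (acceptance x z) * \<phi> z + ennreal (1 - acceptance x z) * \<phi> x"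
  let ?B = "\<lambda>\<theta>' t'. distr (bernoulli_pmf (acceptance x (\<theta>', t'))) state_space (\<lambda>accept. if accept then (\<theta>', t') else x)"
  have [measurable]: "(\<lambda>z. acceptance x z) \<in> borel_measurable state_space"
    by (rule acceptance_measurable) (use x in auto)
  have fx: "fst x \<in> space \<Theta>" using x by (auto simp: space_state_space)
  have [measurable]: "(\<lambda>z. q (fst x) z) \<in> borel_measurable \<Theta>"
    using fx by measurable
  have h[measurable]: "?h \<in> borel_measurable state_space" by measurable
  have T_h: "(\<lambda>t'. ?h (\<theta>', t')) \<in> borel_measurable T_space" if "\<theta>' \<in> space \<Theta>" for \<theta>'
    using measurable_Pair2[OF h[unfolded state_space_def] that] .
  have draw: "(\<integral>\<^sup>+z. \<phi> z \<partial>(T_law m \<theta>' \<bind> ?B \<theta>')) = (\<integral>\<^sup>+t'. ?h (\<theta>', t') \<partial>T_law m \<theta>')" if \<theta>': "\<theta>' \<in> space \<Theta>" for \<theta>'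
  proof -
    have "?B \<theta>' \<in> measurable T_space (prob_algebra state_space)"
      using measurable_Pair2[OF transition_measurable, of "(x, \<theta>')"] x \<theta>' by (simp add: space_pair_measure)
    then have "?B \<theta>' \<in> measurable (T_law m \<theta>') (subprob_algebra state_space)"
      by (intro measurable_prob_algebraD) (simp add: measurable_cong_sets[OF sets_T_law refl])
    then have "(\<integral>\<^sup>+z. \<phi> z \<partial>(T_law m \<theta>' \<bind> ?B \<theta>')) = (\<integral>\<^sup>+t'. \<integral>\<^sup>+z. \<phi> z \<partial>?B \<theta>' t' \<partial>T_law m \<theta>')"
      by (rule nn_integral_bind[OF \<phi>])
    also have "\<dots> = (\<integral>\<^sup>+t'. ?h (\<theta>', t') \<partial>T_law m \<theta>')"
    proof (rule nn_integral_cong)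
      fix t' assume "t' \<in> space (T_law m \<theta>')"
      then have z: "(\<theta>', t') \<in> space state_space"
        using \<theta>' sets_eq_imp_space_eq[OF sets_T_law] by (simp add: space_state_space space_restrict_space)
      have "(\<integral>\<^sup>+z. \<phi> z \<partial>?B \<theta>' t') =
          (\<integral>\<^sup>+b. \<phi> (if b then (\<theta>', t') else x) \<partial>measure_pmf (bernoulli_pmf (acceptance x (\<theta>', t'))))"
        using x z by (intro nn_integral_distr) auto
      also have "\<dots> = ?h (\<theta>', t')"
        using acceptance_bounds[OF x z] by (subst nn_integral_bernoulli_pmf) (auto simp: mult.commute)
      finally show "(\<integral>\<^sup>+z. \<phi> z \<partial>?B \<theta>' t') = ?h (\<theta>', t')" .
    qed
    finally show ?thesis .
  qed
  have D: "(\<lambda>\<theta>'. T_law m \<theta>' \<bind> ?B \<theta>') \<in> measurable \<Theta> (subprob_algebra state_space)"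
    using measurable_prob_algebraD[OF measurable_Pair2[OF draw_measurable x]] by simp
  have "(\<integral>\<^sup>+z. \<phi> z \<partial>Q m x) =
      (\<integral>\<^sup>+\<theta>'. \<integral>\<^sup>+z. \<phi> z \<partial>(T_law m \<theta>' \<bind> ?B \<theta>') \<partial>density \<Theta> (\<lambda>\<theta>'. ennreal (q (fst x) \<theta>')))"
    unfolding Q_def using D by (intro nn_integral_bind[OF \<phi>]) simp
  also have "\<dots> = (\<integral>\<^sup>+\<theta>'. ennreal (q (fst x) \<theta>') * (\<integral>\<^sup>+z. \<phi> z \<partial>(T_law m \<theta>' \<bind> ?B \<theta>')) \<partial>\<Theta>)"
    by (rule nn_integral_density)
       (auto intro: measurable_compose[OF D nn_integral_measurable_subprob_algebra[OF \<phi>]])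
  also have "\<dots> = (\<integral>\<^sup>+\<theta>'. \<integral>\<^sup>+t'. ennreal (q (fst x) \<theta>') * ?h (\<theta>', t') \<partial>T_law m \<theta>' \<partial>\<Theta>)"
    by (intro nn_integral_cong)
       (simp add: draw nn_integral_cmult T_h measurable_cong_sets[OF sets_T_law refl])
  also have "\<dots> = (\<integral>\<^sup>+z. ennreal (q (fst x) (fst z)) * ?h z \<partial>base m)"
    by (subst nn_integral_base) auto
  finally show ?thesis .
qed

definition rejection :: "nat \<Rightarrow> 'a \<times> real \<Rightarrow> ennreal" where
  "rejection m x = ennreal (snd x) * (\<integral>\<^sup>+z. ennreal (q (fst x) (fst z)) * ennreal (1 - acceptance x z) \<partial>base m)"

lemma rejection_measurable[measurable]: "rejection m \<in> borel_measurable state_space"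
proof -
  interpret B: sigma_finite_measure "base m" by (rule sigma_finite_base)
  show ?thesis unfolding rejection_def[abs_def] by measurable
qed

text \<open>Two consecutive states have a law with a symmetric density plus a part on the diagonal.
  Both parts are reversible, and squared differences see only the first.\<close>

lemma nn_integral_joint_Q:
  assumes m: "1 \<le> m" and [measurable]: "\<psi> \<in> borel_measurable (state_space \<Otimes>\<^sub>M state_space)"
  shows "(\<integral>\<^sup>+x. \<integral>\<^sup>+z. \<psi> (x, z) \<partial>Q m x \<partial>\<pi>_tilde m) = (1 / norm_const) *
    ((\<integral>\<^sup>+x. \<integral>\<^sup>+z. flow x z * \<psi> (x, z) \<partial>base m \<partial>base m) + (\<integral>\<^sup>+x. rejection m x * \<psi> (x, x) \<partial>base m))"
proof -
  interpret B: sigma_finite_measure "base m" by (rule sigma_finite_base)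
  note Qs[measurable] = measurable_prob_algebraD[OF Q_kernel[of m]]
  have "(\<integral>\<^sup>+x. \<integral>\<^sup>+z. \<psi> (x, z) \<partial>Q m x \<partial>\<pi>_tilde m) =
      (1 / norm_const) * (\<integral>\<^sup>+x. ennreal (snd x) * (\<integral>\<^sup>+z. \<psi> (x, z) \<partial>Q m x) \<partial>base m)"
    by (intro nn_integral_\<pi>_tilde m nn_integral_measurable_subprob_algebra2[OF _ Qs]) (simp add: split_beta')
  also have "(\<integral>\<^sup>+x. ennreal (snd x) * (\<integral>\<^sup>+z. \<psi> (x, z) \<partial>Q m x) \<partial>base m) =
      (\<integral>\<^sup>+x. (\<integral>\<^sup>+z. flow x z * \<psi> (x, z) \<partial>base m) + rejection m x * \<psi> (x, x) \<partial>base m)"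
  proof (rule nn_integral_cong)
    fix x assume "x \<in> space (base m)"
    then have x: "x \<in> space state_space" by (simp add: space_base space_state_space)
    then have fx: "fst x \<in> space \<Theta>" by (auto simp: space_state_space)
    have [measurable]: "(\<lambda>z. acceptance x z) \<in> borel_measurable state_space"
      "(\<lambda>z. q (fst x) (fst z)) \<in> borel_measurable state_space"
      "(\<lambda>z. flow x z) \<in> borel_measurable state_space" "(\<lambda>z. \<psi> (x, z)) \<in> borel_measurable state_space"
      using x fx by measurable
    let ?q = "\<lambda>z. ennreal (q (fst x) (fst z))" and ?a = "acceptance x"
    have "ennreal (snd x) * (\<integral>\<^sup>+z. \<psi> (x, z) \<partial>Q m x) =
        (\<integral>\<^sup>+z. ennreal (snd x) * (?q z * (ennreal (?a z) * \<psi> (x, z) + ennreal (1 - ?a z) * \<psi> (x, x))) \<partial>base m)"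
      using x by (simp add: nn_integral_Q nn_integral_cmult)
    also have "\<dots> = (\<integral>\<^sup>+z. flow x z * \<psi> (x, z) + ennreal (snd x) * (?q z * ennreal (1 - ?a z)) * \<psi> (x, x) \<partial>base m)"
      by (intro nn_integral_cong)
         (simp add: space_base space_state_space[symmetric] flow_eq[OF x, symmetric] distrib_left mult.assoc)
    also have "\<dots> = (\<integral>\<^sup>+z. flow x z * \<psi> (x, z) \<partial>base m) + rejection m x * \<psi> (x, x)"
      by (simp add: nn_integral_add nn_integral_multc nn_integral_cmult rejection_def)
    finally show "ennreal (snd x) * (\<integral>\<^sup>+z. \<psi> (x, z) \<partial>Q m x) =
      (\<integral>\<^sup>+z. flow x z * \<psi> (x, z) \<partial>base m) + rejection m x * \<psi> (x, x)" .
  qed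
  also have "\<dots> = (\<integral>\<^sup>+x. \<integral>\<^sup>+z. flow x z * \<psi> (x, z) \<partial>base m \<partial>base m) + (\<integral>\<^sup>+x. rejection m x * \<psi> (x, x) \<partial>base m)"
    by (intro nn_integral_add) measurable
  finally show ?thesis .
qed

lemma reversible_Q:
  assumes m: "1 \<le> m"
  shows "reversible_wrt (\<pi>_tilde m) (Q m)"
  unfolding reversible_wrt_def sets_\<pi>_tilde
proof (intro ballI)
  fix A B assume [measurable]: "A \<in> sets state_space" "B \<in> sets state_space"
  interpret B: sigma_finite_measure "base m" by (rule sigma_finite_base)
  interpret P: pair_sigma_finite "base m" "base m" ..
  let ?F = "\<lambda>A B. (\<integral>\<^sup>+x. \<integral>\<^sup>+z. flow x z * (indicator A x * indicator B z) \<partial>base m \<partial>base m)"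
  let ?R = "\<lambda>A B. (\<integral>\<^sup>+x. rejection m x * (indicator A x * indicator B x) \<partial>base m)"
  have eq: "(\<integral>\<^sup>+x\<in>A. emeasure (Q m x) B \<partial>\<pi>_tilde m) = (1 / norm_const) * (?F A B + ?R A B)"
    if [measurable]: "A \<in> sets state_space" "B \<in> sets state_space" for A B
  proof -
    have "(\<integral>\<^sup>+x\<in>A. emeasure (Q m x) B \<partial>\<pi>_tilde m) =
        (\<integral>\<^sup>+x. \<integral>\<^sup>+z. indicator A (fst (x, z)) * indicator B (snd (x, z)) \<partial>Q m x \<partial>\<pi>_tilde m)"
    proof (rule nn_integral_cong)
      fix x assume "x \<in> space (\<pi>_tilde m)"
      then have "sets (Q m x) = sets state_space"
        using measurable_space[OF Q_kernel, of x m] sets_eq_imp_space_eq[OF sets_\<pi>_tilde]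
        by (auto simp: space_prob_algebra)
      then show "emeasure (Q m x) B * indicator A x =
          (\<integral>\<^sup>+z. indicator A (fst (x, z)) * indicator B (snd (x, z)) \<partial>Q m x)"
        using that by (simp add: nn_integral_cmult mult.commute)
    qed
    also have "\<dots> = (1 / norm_const) * (?F A B + ?R A B)"
      by (subst nn_integral_joint_Q[OF m]) auto
    finally show ?thesis .
  qed
  have "?F A B = (\<integral>\<^sup>+z. \<integral>\<^sup>+x. flow x z * (indicator A x * indicator B z) \<partial>base m \<partial>base m)"
    by (rule P.Fubini'[symmetric]) measurable
  then have "?F A B = ?F B A"
    by (simp add: flow_commute[of _ z for z] mult.commute[of "indicator A _"] cong: nn_integral_cong)
  moreover have "?R A B = ?R B A"
    by (simp add: mult.commute[of "indicator A _"])
  ultimately show "(\<integral>\<^sup>+x\<in>A. emeasure (Q m x) B \<partial>\<pi>_tilde m) = (\<integral>\<^sup>+x\<in>B. emeasure (Q m x) A \<partial>\<pi>_tilde m)"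
    by (simp add: eq)
qed

lemma reversible_chain_Q:
  assumes "1 \<le> m"
  shows "reversible_chain (\<pi>_tilde m) (Q m)"
proof -
  interpret prob_space "\<pi>_tilde m" by (rule prob_space_\<pi>_tilde[OF assms])
  have "prob_algebra (\<pi>_tilde m) = prob_algebra state_space"
    by (simp add: prob_algebra_def cong: subprob_algebra_cong)
  then have "Q m \<in> measurable (\<pi>_tilde m) (prob_algebra (\<pi>_tilde m))"
    using Q_kernel[of m] by (simp add: measurable_cong_sets[OF sets_\<pi>_tilde refl])
  then show ?thesis
    by unfold_locales (simp_all add: reversible_Q[OF assms])
qed

text \<open>
  The integral of the acceptance flow over the two random weights. Since the number of hits is a
  natural number, \<open>min (a s) (a' s') \<le> min a a' s s'\<close>, with equality when
  \<open>s\<close> and \<open>s'\<close> are 0 or 1; hence averaging over \<open>m\<close> pseudo-samples increases the flow between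
  two parameters at most by the factor \<open>m\<close>.
\<close>

definition pair_flow :: "nat \<Rightarrow> 'a \<Rightarrow> 'a \<Rightarrow> ennreal" where
  "pair_flow m \<theta> \<theta>' = (\<integral>\<^sup>+t. \<integral>\<^sup>+t'. flow (\<theta>, t) (\<theta>', t') \<partial>T_law m \<theta>' \<partial>T_law m \<theta>)"

definition hit_flow :: "'a \<Rightarrow> 'a \<Rightarrow> ennreal" where
  "hit_flow \<theta> \<theta>' = ennreal (min (prior \<theta> * q \<theta> \<theta>') (prior \<theta>' * q \<theta>' \<theta>)) * (hit_prob \<theta> * hit_prob \<theta>')"

lemma sum_hit_Nats:
  fixes m :: nat
  shows "(\<Sum>i<m. hit (y i)) \<in> \<nat>"
proof (induction m)
  case (Suc m)
  then show ?case using K_binary[of "\<eta> yobs - \<eta> (y m)"] by (auto intro: Nats_add)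
qed simp

lemma flow_T_value:
  fixes y y' :: "nat \<Rightarrow> 'b" and m :: nat
  assumes \<theta>: "\<theta> \<in> space \<Theta>" "\<theta>' \<in> space \<Theta>"
  defines "a \<equiv> prior \<theta> * q \<theta> \<theta>'" and "a' \<equiv> prior \<theta>' * q \<theta>' \<theta>"
    and "s \<equiv> \<Sum>i<m. hit (y i)" and "s' \<equiv> \<Sum>i<m. hit (y' i)"
  shows "flow (\<theta>, T_value m \<theta> y) (\<theta>', T_value m \<theta>' y') \<le> ennreal (min a a' / m) * (ennreal s * ennreal s')"
    and "m = 1 \<Longrightarrow> flow (\<theta>, T_value m \<theta> y) (\<theta>', T_value m \<theta>' y') = ennreal (min a a' / m) * (ennreal s * ennreal s')"
proof -
  have a: "0 \<le> a" "0 \<le> a'" using \<theta> prior_nonneg q_nonneg by (auto simp: a_def a'_def)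
  have s: "s = 0 \<or> 1 \<le> s" "s' = 0 \<or> 1 \<le> s'"
    using sum_hit_Nats[of y m] sum_hit_Nats[of y' m] by (auto simp: s_def s'_def elim!: Nats_cases)
  have f: "flow (\<theta>, T_value m \<theta> y) (\<theta>', T_value m \<theta>' y') = ennreal (min (a * s / m) (a' * s' / m))"
    by (simp add: flow_def T_value_def a_def a'_def s_def s'_def ac_simps)
  have r: "ennreal (min a a' / m) * (ennreal s * ennreal s') = ennreal (min a a' * s * s' / m)"
    using a s by (auto simp: mult.assoc simp flip: ennreal_mult)
  \<comment> \<open>If both counts are at least 1, multiplying either argument of the minimum by the
    other count cannot decrease it; if one count is 0, both sides vanish.\<close>
  have "min (a * s) (a' * s') \<le> min a a' * s * s'"
  proof (cases "s = 0 \<or> s' = 0")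
    case False
    then have "1 \<le> s" "1 \<le> s'" using s by auto
    then have "a * s * 1 \<le> a * s * s'" "a' * s' * 1 \<le> a' * s' * s"
      using a by (intro mult_left_mono mult_nonneg_nonneg; linarith)+
    then show ?thesis by (auto simp: min_def ac_simps)
  qed (use a s in \<open>auto simp: min_def\<close>)
  then have "min (a * s) (a' * s') / m \<le> min a a' * s * s' / m"
    by (rule divide_right_mono) simp
  then show "flow (\<theta>, T_value m \<theta> y) (\<theta>', T_value m \<theta>' y') \<le> ennreal (min a a' / m) * (ennreal s * ennreal s')"
    unfolding f r by (intro ennreal_leI) (simp add: min_divide_distrib_right)
  assume m: "m = 1"
  then have "s = 0 \<or> s = 1" "s' = 0 \<or> s' = 1"
    using K_binary by (auto simp: s_def s'_def)
  then show "flow (\<theta>, T_value m \<theta> y) (\<theta>', T_value m \<theta>' y') = ennreal (min a a' / m) * (ennreal s * ennreal s')"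
    unfolding f r using m a by (auto simp: min_def)
qed

lemma pair_flow_eq:
  assumes \<theta>: "\<theta> \<in> space \<Theta>" "\<theta>' \<in> space \<Theta>"
  shows "pair_flow m \<theta> \<theta>' = (\<integral>\<^sup>+y. \<integral>\<^sup>+y'. flow (\<theta>, T_value m \<theta> y) (\<theta>', T_value m \<theta>' y')
    \<partial>PiM {..<m} (\<lambda>_. density Y (\<lambda>y. ennreal (p \<theta>' y))) \<partial>PiM {..<m} (\<lambda>_. density Y (\<lambda>y. ennreal (p \<theta> y))))"
proof -
  have t[measurable]: "(\<lambda>w. (\<theta>, fst w)) \<in> measurable (T_space \<Otimes>\<^sub>M T_space) state_space"
    "(\<lambda>w. (\<theta>', snd w)) \<in> measurable (T_space \<Otimes>\<^sub>M T_space) state_space"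
    "(\<lambda>t. (\<theta>', t)) \<in> measurable T_space state_space"
    using \<theta> unfolding state_space_def by measurable
  interpret L: prob_space "T_law m \<theta>'" by (rule T_law_prob_space[OF \<theta>(2)])
  have "(\<lambda>t. \<integral>\<^sup>+t'. flow (\<theta>, t) (\<theta>', t') \<partial>T_law m \<theta>') \<in> borel_measurable T_space"
    by (rule L.borel_measurable_nn_integral) (simp add: split_beta' measurable_cong_sets[OF sets_pair_measure_cong[OF refl sets_T_law] refl])
  then have "pair_flow m \<theta> \<theta>' = (\<integral>\<^sup>+y. \<integral>\<^sup>+t'. flow (\<theta>, T_value m \<theta> y) (\<theta>', t') \<partial>T_law m \<theta>'
      \<partial>PiM {..<m} (\<lambda>_. density Y (\<lambda>y. ennreal (p \<theta> y))))"
    unfolding pair_flow_def by (rule nn_integral_T_law[OF \<theta>(1)])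
  also have "\<dots> = (\<integral>\<^sup>+y. \<integral>\<^sup>+y'. flow (\<theta>, T_value m \<theta> y) (\<theta>', T_value m \<theta>' y')
    \<partial>PiM {..<m} (\<lambda>_. density Y (\<lambda>y. ennreal (p \<theta>' y))) \<partial>PiM {..<m} (\<lambda>_. density Y (\<lambda>y. ennreal (p \<theta> y))))"
  proof (intro nn_integral_cong nn_integral_T_law[OF \<theta>(2)])
    fix y
    have "(\<theta>, T_value m \<theta> y) \<in> space state_space"
      using \<theta> T_value_nonneg by (simp add: space_state_space)
    then show "(\<lambda>t'. flow (\<theta>, T_value m \<theta> y) (\<theta>', t')) \<in> borel_measurable T_space"
      by measurable
  qed
  finally show ?thesis .
qed

lemma
  assumes \<theta>: "\<theta> \<in> space \<Theta>" "\<theta>' \<in> space \<Theta>"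
  shows pair_flow_le: "1 \<le> m \<Longrightarrow> pair_flow m \<theta> \<theta>' \<le> of_nat m * hit_flow \<theta> \<theta>'"
    and pair_flow_1: "pair_flow 1 \<theta> \<theta>' = hit_flow \<theta> \<theta>'"
proof -
  let ?P = "\<lambda>m \<theta>. PiM {..<m} (\<lambda>_. density Y (\<lambda>y. ennreal (p \<theta> y)))"
  let ?c = "min (prior \<theta> * q \<theta> \<theta>') (prior \<theta>' * q \<theta>' \<theta>)"
  let ?S = "\<lambda>(m::nat) y. ennreal (\<Sum>i<m. hit (y i))"
  have c: "0 \<le> ?c" using \<theta> prior_nonneg q_nonneg by auto
  have [measurable]: "?S m \<in> borel_measurable (?P m \<theta>)" for m \<theta>
    by (subst measurable_cong_sets[OF sets_PiM_cong[OF refl sets_density] refl]) measurable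
  \<comment> \<open>The two independent sums of hits contribute \<open>m\<close> each, and the
    prefactor \<open>1 / m\<close> from the averages cancels one of them.\<close>
  have int: "(\<integral>\<^sup>+y. \<integral>\<^sup>+y'. ennreal (?c / m) * (?S m y * ?S m y') \<partial>?P m \<theta>' \<partial>?P m \<theta>) = of_nat m * hit_flow \<theta> \<theta>'"
    if m: "1 \<le> m" for m
  proof -
    have "(\<integral>\<^sup>+y. \<integral>\<^sup>+y'. ennreal (?c / m) * (?S m y * ?S m y') \<partial>?P m \<theta>' \<partial>?P m \<theta>) =
        ennreal (?c / m) * ((of_nat m * hit_prob \<theta>) * (of_nat m * hit_prob \<theta>'))"
      using \<theta> by (simp add: nn_integral_cmult nn_integral_multc nn_integral_sum_hit)
    also have "\<dots> = (ennreal (?c / m) * ennreal (real m)) * (of_nat m * (hit_prob \<theta> * hit_prob \<theta>'))"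
      by (simp only: ennreal_of_nat_eq_real_of_nat ac_simps)
    also have "ennreal (?c / m) * ennreal (real m) = ennreal ?c"
      using m c by (simp flip: ennreal_mult)
    finally show ?thesis by (simp only: hit_flow_def ac_simps)
  qed
  show "pair_flow m \<theta> \<theta>' \<le> of_nat m * hit_flow \<theta> \<theta>'" if "1 \<le> m"
    unfolding pair_flow_eq[OF \<theta>] int[OF that, symmetric]
    by (intro nn_integral_mono flow_T_value \<theta>)
  show "pair_flow 1 \<theta> \<theta>' = hit_flow \<theta> \<theta>'"
    using int[of 1] unfolding pair_flow_eq[OF \<theta>] flow_T_value(2)[OF \<theta> refl] by simp
qed

text \<open>The squared difference depends on the parameters only, so both weights can be integrated
  out. This requires exchanging the first weight with the second parameter, hence the inner use of
  Fubini.\<close>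

lemma nn_integral_flow:
  assumes u[measurable]: "u \<in> borel_measurable \<Theta>"
  shows "(\<integral>\<^sup>+x. \<integral>\<^sup>+z. flow x z * ennreal ((u (fst x) - u (fst z))\<^sup>2) \<partial>base m \<partial>base m) =
    (\<integral>\<^sup>+\<theta>. \<integral>\<^sup>+\<theta>'. ennreal ((u \<theta> - u \<theta>')\<^sup>2) * pair_flow m \<theta> \<theta>' \<partial>\<Theta> \<partial>\<Theta>)"
proof -
  interpret B: sigma_finite_measure "base m" by (rule sigma_finite_base)
  let ?d = "\<lambda>\<theta> \<theta>'. ennreal ((u \<theta> - u \<theta>')\<^sup>2)"
  have "(\<integral>\<^sup>+x. \<integral>\<^sup>+z. flow x z * ?d (fst x) (fst z) \<partial>base m \<partial>base m) =
      (\<integral>\<^sup>+\<theta>. \<integral>\<^sup>+t. \<integral>\<^sup>+z. flow (\<theta>, t) z * ?d \<theta> (fst z) \<partial>base m \<partial>T_law m \<theta> \<partial>\<Theta>)"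
    by (subst nn_integral_base) auto
  also have "\<dots> = (\<integral>\<^sup>+\<theta>. \<integral>\<^sup>+\<theta>'. ?d \<theta> \<theta>' * pair_flow m \<theta> \<theta>' \<partial>\<Theta> \<partial>\<Theta>)"
  proof (rule nn_integral_cong)
    fix \<theta> assume \<theta>: "\<theta> \<in> space \<Theta>"
    interpret L: prob_space "T_law m \<theta>" by (rule T_law_prob_space[OF \<theta>])
    interpret P: pair_sigma_finite "T_law m \<theta>" \<Theta> ..
    have x: "(\<theta>, t) \<in> space state_space" if "t \<in> space (T_law m \<theta>)" for t
      using \<theta> that sets_eq_imp_space_eq[OF sets_T_law] by (simp add: space_state_space space_restrict_space)
    let ?N = "(T_law m \<theta> \<Otimes>\<^sub>M \<Theta>) \<Otimes>\<^sub>M T_space"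
    have s1: "(\<lambda>w. (\<theta>, fst (fst w))) \<in> measurable ?N state_space"
      using \<theta> unfolding state_space_def
      by (intro measurable_Pair measurable_compose[OF measurable_fst[THEN measurable_compose[OF measurable_fst]]])
        (auto simp: measurable_cong_sets[OF refl sets_T_law, symmetric])
    have s2: "(\<lambda>w. (snd (fst w), snd w)) \<in> measurable ?N state_space"
      unfolding state_space_def by measurable
    have fm: "(\<lambda>w. \<integral>\<^sup>+t'. flow (\<theta>, fst w) (snd w, t') \<partial>T_law m (snd w)) \<in> borel_measurable (T_law m \<theta> \<Otimes>\<^sub>M \<Theta>)"
      by (rule nn_integral_measurable_subprob_algebra2[OF _ measurable_compose[OF measurable_snd T_law_subprob_kernel]])
         (use flow_measurable[OF s1 s2] in \<open>simp add: split_beta'\<close>)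
    have inner: "(\<integral>\<^sup>+z. flow (\<theta>, t) z * ?d \<theta> (fst z) \<partial>base m) =
        (\<integral>\<^sup>+\<theta>'. ?d \<theta> \<theta>' * (\<integral>\<^sup>+t'. flow (\<theta>, t) (\<theta>', t') \<partial>T_law m \<theta>') \<partial>\<Theta>)" if t: "t \<in> space (T_law m \<theta>)" for t
    proof -
      have [measurable]: "(\<lambda>z. flow (\<theta>, t) z) \<in> borel_measurable state_space"
        using x[OF t] by measurable
      have "(\<integral>\<^sup>+z. flow (\<theta>, t) z * ?d \<theta> (fst z) \<partial>base m) =
          (\<integral>\<^sup>+\<theta>'. \<integral>\<^sup>+t'. flow (\<theta>, t) (\<theta>', t') * ?d \<theta> \<theta>' \<partial>T_law m \<theta>' \<partial>\<Theta>)"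
        by (subst nn_integral_base) auto
      also have "\<dots> = (\<integral>\<^sup>+\<theta>'. ?d \<theta> \<theta>' * (\<integral>\<^sup>+t'. flow (\<theta>, t) (\<theta>', t') \<partial>T_law m \<theta>') \<partial>\<Theta>)"
      proof (rule nn_integral_cong)
        fix \<theta>' assume "\<theta>' \<in> space \<Theta>"
        then have "Pair \<theta>' \<in> measurable (T_law m \<theta>') state_space"
          by (simp add: state_space_def measurable_cong_sets[OF sets_T_law refl])
        then have "(\<lambda>t'. flow (\<theta>, t) (\<theta>', t')) \<in> borel_measurable (T_law m \<theta>')"
          using x[OF t] by (intro flow_measurable) auto
        then show "(\<integral>\<^sup>+t'. flow (\<theta>, t) (\<theta>', t') * ?d \<theta> \<theta>' \<partial>T_law m \<theta>') =
            ?d \<theta> \<theta>' * (\<integral>\<^sup>+t'. flow (\<theta>, t) (\<theta>', t') \<partial>T_law m \<theta>')"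
          by (simp add: nn_integral_multc mult.commute)
      qed
      finally show ?thesis .
    qed
    have "(\<integral>\<^sup>+t. \<integral>\<^sup>+z. flow (\<theta>, t) z * ?d \<theta> (fst z) \<partial>base m \<partial>T_law m \<theta>) =
        (\<integral>\<^sup>+t. \<integral>\<^sup>+\<theta>'. ?d \<theta> \<theta>' * (\<integral>\<^sup>+t'. flow (\<theta>, t) (\<theta>', t') \<partial>T_law m \<theta>') \<partial>\<Theta> \<partial>T_law m \<theta>)"
      by (intro nn_integral_cong inner)
    also have "\<dots> = (\<integral>\<^sup>+\<theta>'. \<integral>\<^sup>+t. ?d \<theta> \<theta>' * (\<integral>\<^sup>+t'. flow (\<theta>, t) (\<theta>', t') \<partial>T_law m \<theta>') \<partial>T_law m \<theta> \<partial>\<Theta>)"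
      using \<theta> fm by (intro P.Fubini'[symmetric]) (simp add: split_beta')
    also have "\<dots> = (\<integral>\<^sup>+\<theta>'. ?d \<theta> \<theta>' * pair_flow m \<theta> \<theta>' \<partial>\<Theta>)"
      unfolding pair_flow_def
    proof (intro nn_integral_cong nn_integral_cmult)
      fix \<theta>' assume "\<theta>' \<in> space \<Theta>"
      from measurable_compose[OF measurable_Pair2'[OF this] fm]
      show "(\<lambda>t. \<integral>\<^sup>+t'. flow (\<theta>, t) (\<theta>', t') \<partial>T_law m \<theta>') \<in> borel_measurable (T_law m \<theta>)"
        by simp
    qed
    finally show "(\<integral>\<^sup>+t. \<integral>\<^sup>+z. flow (\<theta>, t) z * ?d \<theta> (fst z) \<partial>base m \<partial>T_law m \<theta>) =
      (\<integral>\<^sup>+\<theta>'. ?d \<theta> \<theta>' * pair_flow m \<theta> \<theta>' \<partial>\<Theta>)" .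
  qed
  finally show ?thesis .
qed

text \<open>Twice the Dirichlet form of \<open>u\<close> as a function of the state, written as a
  nonnegative integral so that it makes sense without integrability of \<open>u\<close>.\<close>

definition energy :: "nat \<Rightarrow> ('a \<Rightarrow> real) \<Rightarrow> ennreal" where
  "energy m u = (\<integral>\<^sup>+x. \<integral>\<^sup>+z. ennreal ((u (fst x) - u (fst z))\<^sup>2) \<partial>Q m x \<partial>\<pi>_tilde m)"

lemma energy_eq:
  assumes m: "1 \<le> m" and [measurable]: "u \<in> borel_measurable \<Theta>"
  shows "energy m u = (1 / norm_const) *
    (\<integral>\<^sup>+\<theta>. \<integral>\<^sup>+\<theta>'. ennreal ((u \<theta> - u \<theta>')\<^sup>2) * pair_flow m \<theta> \<theta>' \<partial>\<Theta> \<partial>\<Theta>)"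
  using nn_integral_joint_Q[OF m, of "\<lambda>w. ennreal ((u (fst (fst w)) - u (fst (snd w)))\<^sup>2)"]
  by (simp add: energy_def nn_integral_flow)

text \<open>The flows are compared pointwise through the explicit \<open>hit_flow\<close>, which is
  also the pair flow of a single pseudo-sample.\<close>

lemma energy_le:
  assumes m: "1 \<le> m" and [measurable]: "u \<in> borel_measurable \<Theta>"
  shows "energy m u \<le> of_nat m * energy 1 u"
proof -
  let ?d = "\<lambda>\<theta> \<theta>'. ennreal ((u \<theta> - u \<theta>')\<^sup>2)"
  have [measurable]: "(\<lambda>w. hit_flow (fst w) (snd w)) \<in> borel_measurable (\<Theta> \<Otimes>\<^sub>M \<Theta>)"
    unfolding hit_flow_def by measurable
  have [measurable]: "(\<lambda>\<theta>'. hit_flow \<theta> \<theta>') \<in> borel_measurable \<Theta>" if "\<theta> \<in> space \<Theta>" for \<theta>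
    unfolding hit_flow_def using that by measurable
  have "(\<integral>\<^sup>+\<theta>. \<integral>\<^sup>+\<theta>'. ?d \<theta> \<theta>' * pair_flow m \<theta> \<theta>' \<partial>\<Theta> \<partial>\<Theta>)
      \<le> (\<integral>\<^sup>+\<theta>. \<integral>\<^sup>+\<theta>'. of_nat m * (?d \<theta> \<theta>' * hit_flow \<theta> \<theta>') \<partial>\<Theta> \<partial>\<Theta>)"
    using pair_flow_le[OF _ _ m]
    by (intro nn_integral_mono) (simp add: mult.left_commute[of "of_nat m"] mult_left_mono)
  also have "\<dots> = (\<integral>\<^sup>+\<theta>. of_nat m * (\<integral>\<^sup>+\<theta>'. ?d \<theta> \<theta>' * hit_flow \<theta> \<theta>' \<partial>\<Theta>) \<partial>\<Theta>)"
    by (intro nn_integral_cong nn_integral_cmult) simp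
  also have "\<dots> = of_nat m * (\<integral>\<^sup>+\<theta>. \<integral>\<^sup>+\<theta>'. ?d \<theta> \<theta>' * hit_flow \<theta> \<theta>' \<partial>\<Theta> \<partial>\<Theta>)"
    by (intro nn_integral_cmult \<Theta>.borel_measurable_nn_integral) (simp add: split_beta')
  also have "(\<integral>\<^sup>+\<theta>. \<integral>\<^sup>+\<theta>'. ?d \<theta> \<theta>' * hit_flow \<theta> \<theta>' \<partial>\<Theta> \<partial>\<Theta>) =
      (\<integral>\<^sup>+\<theta>. \<integral>\<^sup>+\<theta>'. ?d \<theta> \<theta>' * pair_flow 1 \<theta> \<theta>' \<partial>\<Theta> \<partial>\<Theta>)"
    by (intro nn_integral_cong) (simp add: pair_flow_1[unfolded One_nat_def])
  finally have "energy m u \<le> (1 / norm_const) *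
      (of_nat m * (\<integral>\<^sup>+\<theta>. \<integral>\<^sup>+\<theta>'. ?d \<theta> \<theta>' * pair_flow 1 \<theta> \<theta>' \<partial>\<Theta> \<partial>\<Theta>))"
    by (simp add: energy_eq[OF m] mult_left_mono)
  also have "\<dots> = of_nat m * energy 1 u"
    by (subst energy_eq[OF order_refl]) (simp_all add: mult.left_commute)
  finally show ?thesis .
qed

text \<open>A single pseudo-sample gives a weight equal to 0 or to the prior, and the density
  \<open>t\<close> of the stationary law removes the states of weight 0.\<close>

lemma AE_\<pi>_tilde_1: "AE x in \<pi>_tilde 1. snd x = prior (fst x)"
proof -
  let ?A = "{x \<in> space state_space. snd x \<noteq> prior (fst x)}"
  have [measurable]: "?A \<in> sets state_space" by measurable
  have "emeasure (\<pi>_tilde 1) ?A = (\<integral>\<^sup>+x. indicator ?A x \<partial>\<pi>_tilde 1)"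
    by simp
  also have "\<dots> = (1 / norm_const) * (\<integral>\<^sup>+x. ennreal (snd x) * indicator ?A x \<partial>base 1)"
    by (rule nn_integral_\<pi>_tilde) simp_all
  also have "(\<integral>\<^sup>+x. ennreal (snd x) * indicator ?A x \<partial>base 1) =
      (\<integral>\<^sup>+\<theta>. \<integral>\<^sup>+t. ennreal t * indicator ?A (\<theta>, t) \<partial>T_law 1 \<theta> \<partial>\<Theta>)"
    by (subst nn_integral_base) auto
  also have "\<dots> = (\<integral>\<^sup>+\<theta>. 0 \<partial>\<Theta>)"
  proof (rule nn_integral_cong)
    fix \<theta> assume \<theta>: "\<theta> \<in> space \<Theta>"
    then have [measurable]: "Pair \<theta> \<in> measurable T_space state_space"
      by (simp add: state_space_def)
    have zero: "ennreal (T_value 1 \<theta> y) * indicator ?A (\<theta>, T_value 1 \<theta> y) = 0" for y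
      using K_binary[of "\<eta> yobs - \<eta> (y 0)"] by (auto simp: T_value_def)
    have "(\<lambda>t. ennreal t * indicator ?A (\<theta>, t)) \<in> borel_measurable T_space"
      by measurable
    from nn_integral_T_law[OF \<theta> this, of 1]
    show "(\<integral>\<^sup>+t. ennreal t * indicator ?A (\<theta>, t) \<partial>T_law 1 \<theta>) = 0"
      by (simp only: zero nn_integral_const mult_zero_left)
  qed
  finally have "emeasure (\<pi>_tilde 1) ?A = 0" by simp
  then show ?thesis
    by (intro AE_I[of _ _ ?A]) (auto simp: sets_eq_imp_space_eq[OF sets_\<pi>_tilde])
qed

section \<open>Functions of the parameter under both chains\<close>

lemma
  assumes m: "1 \<le> m" and [measurable]: "h \<in> borel_measurable \<Theta>"
  shows L2_\<pi>_tilde_fst: "(\<lambda>x. h (fst x)) \<in> L2 (\<pi>_tilde m) \<longleftrightarrow> h \<in> L2 \<pi>_K"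
    and integral_\<pi>_tilde_fst: "(\<integral>x. h (fst x) \<partial>\<pi>_tilde m) = (\<integral>\<theta>. h \<theta> \<partial>\<pi>_K)"
  unfolding distr_\<pi>_tilde_fst[OF m, symmetric]
  by (simp_all add: L2_distr_iff integral_distr)

lemma dirichlet_energy:
  assumes m: "1 \<le> m" and u: "(\<lambda>x. u (fst x)) \<in> L2 (\<pi>_tilde m)"
  shows "energy m u = ennreal (2 * ((\<integral>x. (u (fst x))\<^sup>2 \<partial>\<pi>_tilde m)
    - (\<integral>x. u (fst x) * (\<integral>y. u (fst y) \<partial>Q m x) \<partial>\<pi>_tilde m)))"
proof -
  interpret reversible_chain "\<pi>_tilde m" "Q m" by (rule reversible_chain_Q[OF m])
  show ?thesis
    using nn_integral_dirichlet[OF u] by (simp add: energy_def ip_def op_H_def power2_eq_square)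
qed

lemma dirichlet_nonneg:
  assumes m: "1 \<le> m" and u: "u \<in> L2 (\<pi>_tilde m)"
  shows "(\<integral>x. u x * (\<integral>y. u y \<partial>Q m x) \<partial>\<pi>_tilde m) \<le> (\<integral>x. (u x)\<^sup>2 \<partial>\<pi>_tilde m)"
proof -
  interpret reversible_chain "\<pi>_tilde m" "Q m" by (rule reversible_chain_Q[OF m])
  show ?thesis
    using ip_op_H_bounds(1)[OF u] by (simp add: ip_def op_H_def power2_eq_square)
qed

text \<open>
  Under \<open>\<pi>_tilde 1\<close> the weight is almost surely the prior density, so every function of the state
  is almost surely a function of the parameter, to which the two chains can be compared.
\<close>

lemma v_1_le:
  assumes m: "1 \<le> m" and nonneg: "nonneg_definite (\<pi>_tilde m) (Q m)" and f: "f \<in> L2 \<pi>_K"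
  shows "v f 1 \<le> ennreal (2 * real m) * v f m"
proof -
  note [measurable] = L2_measurable[OF f, unfolded measurable_cong_sets[OF sets_\<pi>_K refl]]
  let ?e = "\<integral>\<theta>. f \<theta> \<partial>\<pi>_K"
  show ?thesis
    unfolding v_def split_beta'
  proof (rule asymptotic_variance_comparison[where e = ?e])
    show "reversible_chain (\<pi>_tilde 1) (Q 1)" "reversible_chain (\<pi>_tilde m) (Q m)"
      using m by (auto intro: reversible_chain_Q)
    show "nonneg_definite (\<pi>_tilde m) (Q m)" by fact
    show "(\<lambda>x. f (fst x)) \<in> L2 (\<pi>_tilde 1)" "(\<lambda>x. f (fst x)) \<in> L2 (\<pi>_tilde m)"
      using m f by (simp_all add: L2_\<pi>_tilde_fst)
    show "1 \<le> real m" using m by simp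
    show "(\<integral>x. f (fst x) \<partial>\<pi>_tilde 1) = ?e" "(\<integral>x. f (fst x) \<partial>\<pi>_tilde m) = ?e"
      using m by (simp_all add: integral_\<pi>_tilde_fst)
    show "(\<integral>x. (f (fst x) - ?e)\<^sup>2 \<partial>\<pi>_tilde 1) = (\<integral>x. (f (fst x) - ?e)\<^sup>2 \<partial>\<pi>_tilde m)"
      using m integral_\<pi>_tilde_fst[of _ "\<lambda>\<theta>. (f \<theta> - ?e)\<^sup>2"] by simp
    fix g assume g: "g \<in> L2 (\<pi>_tilde 1)"
    interpret A: reversible_chain "\<pi>_tilde 1" "Q 1" by (rule reversible_chain_Q) simp
    note [measurable] = L2_measurable[OF g, unfolded measurable_cong_sets[OF sets_\<pi>_tilde refl]]
    define u where "u \<theta> = g (\<theta>, prior \<theta>)" for \<theta>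
    have "(\<lambda>\<theta>. (\<theta>, prior \<theta>)) \<in> measurable \<Theta> state_space"
      unfolding state_space_def
      by (intro measurable_Pair measurable_restrict_space2) (auto simp: prior_nonneg)
    then have u[measurable]: "u \<in> borel_measurable \<Theta>"
      unfolding u_def[abs_def] by measurable
    have ae: "AE x in \<pi>_tilde 1. g x = u (fst x)"
      using AE_\<pi>_tilde_1 by eventually_elim (metis prod.collapse u_def)
    have sq: "integrable (\<pi>_tilde 1) (\<lambda>x. (u (fst x))\<^sup>2)"
      using L2_integrable_square[OF g] ae
      by (subst (asm) integrable_cong_AE[where g = "\<lambda>x. (u (fst x))\<^sup>2"]) (auto elim: eventually_mono)
    then have u1: "(\<lambda>x. u (fst x)) \<in> L2 (\<pi>_tilde 1)"
      by (simp add: L2_def)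
    \<comment> \<open>Square integrability passes from one chain to the other through the common
      marginal \<open>\<pi>_K\<close>.\<close>
    then have um: "(\<lambda>x. u (fst x)) \<in> L2 (\<pi>_tilde m)"
      using L2_\<pi>_tilde_fst[of 1 u] L2_\<pi>_tilde_fst[of m u] m by simp
    have fg: "(\<integral>x. (f (fst x) - ?e) * u (fst x) \<partial>\<pi>_tilde m) = (\<integral>x. (f (fst x) - ?e) * g x \<partial>\<pi>_tilde 1)"
    proof -
      have "(\<integral>x. (f (fst x) - ?e) * g x \<partial>\<pi>_tilde 1) = (\<integral>x. (f (fst x) - ?e) * u (fst x) \<partial>\<pi>_tilde 1)"
        using ae by (intro integral_cong_AE) auto
      then show ?thesis
        using m integral_\<pi>_tilde_fst[of _ "\<lambda>\<theta>. (f \<theta> - ?e) * u \<theta>"] by simp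
    qed
    have gg: "(\<integral>x. (u (fst x))\<^sup>2 \<partial>\<pi>_tilde 1) = (\<integral>x. (g x)\<^sup>2 \<partial>\<pi>_tilde 1)"
      using ae by (intro integral_cong_AE) auto
    have uu: "(\<integral>x. (u (fst x))\<^sup>2 \<partial>\<pi>_tilde m) = (\<integral>x. (u (fst x))\<^sup>2 \<partial>\<pi>_tilde 1)"
      using m integral_\<pi>_tilde_fst[of _ "\<lambda>\<theta>. (u \<theta>)\<^sup>2"] by simp
    let ?D = "\<lambda>m g. (\<integral>x. (g x)\<^sup>2 \<partial>\<pi>_tilde m) - (\<integral>x. g x * (\<integral>y. g y \<partial>Q m x) \<partial>\<pi>_tilde m)"
    have D: "?D 1 g = ?D 1 (\<lambda>x. u (fst x))"
      using A.dirichlet_cong_AE[OF g u1 ae] unfolding A.ip_def A.op_H_def power2_eq_square .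
    \<comment> \<open>\<open>ennreal\<close> sends negative numbers to 0, so the sign is needed to
      read a real inequality off the inequality of energies.\<close>
    have D0: "0 \<le> ?D 1 (\<lambda>x. u (fst x))"
      using dirichlet_nonneg[OF _ u1] by simp
    have "ennreal (2 * ?D m (\<lambda>x. u (fst x))) \<le> of_nat m * ennreal (2 * ?D 1 (\<lambda>x. u (fst x)))"
      using energy_le[OF m u] unfolding dirichlet_energy[OF m um] dirichlet_energy[OF order_refl u1] .
    also have "\<dots> = ennreal (real m * (2 * ?D 1 (\<lambda>x. u (fst x))))"
      using D0 by (simp add: ennreal_of_nat_eq_real_of_nat ennreal_mult)
    finally have "2 * ?D m (\<lambda>x. u (fst x)) \<le> real m * (2 * ?D 1 (\<lambda>x. u (fst x)))"
      using D0 by (subst (asm) ennreal_le_iff) (intro mult_nonneg_nonneg, simp_all)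
    then have "?D m (\<lambda>x. u (fst x)) \<le> real m * ?D 1 (\<lambda>x. u (fst x))"
      by (simp only: mult.left_commute[of "real m"] mult_le_cancel_left_pos zero_less_numeral)
    then show "\<exists>u\<in>L2 (\<pi>_tilde m).
        (\<integral>x. (f (fst x) - ?e) * u x \<partial>\<pi>_tilde m) = (\<integral>x. (f (fst x) - ?e) * g x \<partial>\<pi>_tilde 1) \<and>
        (\<integral>x. (u x)\<^sup>2 \<partial>\<pi>_tilde m) = (\<integral>x. (g x)\<^sup>2 \<partial>\<pi>_tilde 1) \<and> ?D m u \<le> real m * ?D 1 g"
      using um fg gg uu D by (intro bexI[of _ "\<lambda>x. u (fst x)"]) simp_all
  qed
qed

end

theorem corollary5:
  fixes \<Theta> :: "'a measure" and Y :: "'b measure"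
    and prior :: "'a \<Rightarrow> real" and p :: "'a \<Rightarrow> 'b \<Rightarrow> real"
    and yobs :: 'b and \<eta> :: "'b \<Rightarrow> 'e::real_normed_vector" and K :: "'e \<Rightarrow> real"
    and q :: "'a \<Rightarrow> 'a \<Rightarrow> real" and \<epsilon> \<delta> :: real and M :: nat and f :: "'a \<Rightarrow> real"
  assumes "abc_model \<Theta> Y prior p yobs \<eta> K q"
    and "0 < \<epsilon>" and "K = uniform_kernel \<epsilon>"
    and "1 \<le> M"
    and "nonneg_definite (abc_model.\<pi>_tilde \<Theta> Y prior p yobs \<eta> K M)
      (abc_model.Q \<Theta> Y prior p yobs \<eta> K q M)"
    and "f \<in> L2 (abc_model.\<pi>_K \<Theta> Y prior p yobs \<eta> K)"
    and "0 < \<delta>"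
  shows "abc_model.serial_time \<Theta> Y prior p yobs \<eta> K q f 1 \<delta>
      \<le> 2 * abc_model.serial_time \<Theta> Y prior p yobs \<eta> K q f M \<delta>
    \<and> abc_model.parallel_time_multiple_chains \<Theta> Y prior p yobs \<eta> K q f M \<delta>
      \<le> 2 * abc_model.parallel_time_single_chain \<Theta> Y prior p yobs \<eta> K q f M \<delta>"
proof -
  let ?v = "abc_model.v \<Theta> Y prior p yobs \<eta> K q f"
  interpret binary_abc_model \<Theta> Y prior p yobs \<eta> K q
  proof (intro binary_abc_model.intro binary_abc_model_axioms.intro)
    show "K z = 0 \<or> K z = 1" for z
      using \<open>K = uniform_kernel \<epsilon>\<close> by (simp add: uniform_kernel_def indicator_def)
  qed fact
  \<comment> \<open>Both claims rest on this inequality: serial time weights \<open>v f M\<close>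
    with the \<open>M\<close> samples per iteration, and parallel time divides \<open>v f 1\<close>
    by the \<open>M\<close> chains.\<close>
  have v: "v f 1 \<le> 2 * (of_nat M * v f M)"
  proof -
    have "v f 1 \<le> ennreal (2 * real M) * v f M"
      using assms by (intro v_1_le) auto
    also have "\<dots> = 2 * (of_nat M * v f M)"
      by (simp add: ennreal_mult ennreal_of_nat_eq_real_of_nat mult.assoc)
    finally show ?thesis .
  qed
  have "serial_time f 1 \<delta> \<le> 2 * serial_time f M \<delta>"
    using divide_right_mono_ennreal[OF v] by (simp add: serial_time_def ennreal_times_divide)
  moreover have "parallel_time_multiple_chains f M \<delta> \<le> 2 * parallel_time_single_chain f M \<delta>"
  proof -
    have "v f 1 / ennreal (\<delta> * real M) \<le> 2 * (of_nat M * v f M) / ennreal (\<delta> * real M)"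
      by (rule divide_right_mono_ennreal[OF v])
    also have "\<dots> = (2 * v f M) * ennreal (real M) / (ennreal \<delta> * ennreal (real M))"
      using \<open>0 < \<delta>\<close> by (simp add: ennreal_mult ennreal_of_nat_eq_real_of_nat ac_simps)
    also have "\<dots> = (2 * v f M) / ennreal \<delta>"
      using \<open>1 \<le> M\<close> by (intro divide_mult_eq) auto
    finally show ?thesis
      by (simp add: parallel_time_multiple_chains_def parallel_time_single_chain_def ennreal_times_divide)
  qed
  ultimately show ?thesis ..
qed

end
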